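(* For every $p<1/12$ there exists $C_p>0$ such that for all $n\in\mathbb{N}$, $n\ge1$, $$\operatorname{Fav}(\mathcal{S}_n)\le C_p\,n^{-p}.$$
   Context: For $E\subset\mathbb{C}$, the Favard length is $\operatorname{Fav}(E)=\frac1\pi\int_0^\pi|\mathrm{proj}_\theta(E)|\,d\theta$, where $\mathrm{proj}_\theta$ is orthogonal projection onto the line through the origin making angle $\theta$ with the real axis and $|\cdot|$ is one-dimensional Lebesgue measure. With $B(z_0,r)=\{z\in\mathbb{C}:|z-z_0|<r\}$, the ($n$-th approximation of the) Sierpinski gasket is $$\mathcal{S}_n:=\bigcup_{\alpha\in\{-1,0,1\}^n}B(z_\alpha,3^{-n}),\qquad z_\alpha:=\sum_{k=1}^n 3^{-k}e^{i\pi\left(\frac12+\frac23\alpha_k\right)}.$$ *)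

theory Defs
  imports "HOL-Analysis.Analysis"
begin

definition proj_line :: "real \<Rightarrow> complex \<Rightarrow> complex" where
  "proj_line \<theta> z = (z \<bullet> cis \<theta>) *\<^sub>R cis \<theta>"

lemma proj_line_in_span: "proj_line \<theta> z \<in> span {cis \<theta>}"
  by (simp add: proj_line_def span_mul span_base)

lemma proj_line_orthogonal:
  assumes "w \<in> span {cis \<theta>}"
  shows "(z - proj_line \<theta> z) \<bullet> w = 0"
proof -
  have "cis \<theta> \<bullet> cis \<theta> = 1"
    by (simp add: dot_square_norm)
  with assms show ?thesis
    by (auto simp: proj_line_def span_singleton inner_diff_left)
qed

(* One-dimensional Lebesgue measure on the line spanned by cis \<theta>, transported from the
   real line along the isometry t \<mapsto> t cis \<theta>. It is 0, by the convention for emeasure,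
   on sets that are not Lebesgue measurable; the projections of open sets are open. *)
definition line_measure :: "real \<Rightarrow> complex set \<Rightarrow> ennreal" where
  "line_measure \<theta> A = emeasure lebesgue {t::real. t *\<^sub>R cis \<theta> \<in> A}"

lemma line_measure_proj_line:
  "line_measure \<theta> (proj_line \<theta> ` E) = emeasure lebesgue ((\<lambda>z. z \<bullet> cis \<theta>) ` E)"
proof -
  have "{t. t *\<^sub>R cis \<theta> \<in> proj_line \<theta> ` E} = (\<lambda>z. z \<bullet> cis \<theta>) ` E"
    by (auto simp: proj_line_def image_iff)
  then show ?thesis
    by (simp add: line_measure_def)
qed

(* Extended-real valued, so that no integrability side condition hides in the definition. *)
definition Fav :: "complex set \<Rightarrow> ennreal" where
  "Fav E = ennreal (1 / pi) *
     (\<integral>\<^sup>+ \<theta>\<in>{0..pi}. line_measure \<theta> (proj_line \<theta> ` E) \<partial>lebesgue)"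

definition gasket_centre :: "nat \<Rightarrow> (nat \<Rightarrow> int) \<Rightarrow> complex" where
  "gasket_centre n \<alpha> =
     (\<Sum>k=1..n. (1 / 3 ^ k) *\<^sub>R cis (pi * (1/2 + 2/3 * real_of_int (\<alpha> k))))"

definition gasket :: "nat \<Rightarrow> complex set" where
  "gasket n = (\<Union>\<alpha> \<in> {1..n} \<rightarrow>\<^sub>E {-1, 0, 1}. ball (gasket_centre n \<alpha>) (1 / 3 ^ n))"

end

theory Submission
  imports Defs
begin

text \<open>
  In the coordinate \<open>t = 1/2 + (sqrt 3 / 2) * tan \<theta>\<close> the projections of the gasket are, up to affine maps,
  the neighbourhoods of the points with base-3 digits 0, 1, t; rotation by \<open>2 * pi / 3\<close> permutes the
  digits, so \<open>\<bar>\<theta>\<bar> \<le> pi / 3\<close>, i.e. \<open>-1 \<le> t \<le> 2\<close>, suffices. Fix a height K and \<open>N = K^10\<close>, and call a triadic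
  interval of length \<open>3^-k\<close>, \<open>k \<le> N\<close>, a stop if it is a maximal one that is met by at least K words of
  length k.

  If the stops have total length at least of order \<open>K^-2\<close>, a Vitali selection of stops shows that
  passing from level n to level \<open>N + n\<close> contracts the length of the projection by a factor
  \<open>1 - c / K\<close>, up to a limit O(1/K); hence level \<open>K^2 * N = K^12\<close> has length O(1/K).
  Otherwise, splitting pairs of close words at their first stop gives by induction the energy bound
  \<open>2 * K * 3^n\<close> for the number of pairs at distance below \<open>3^-n\<close>, \<open>n \<le> N\<close>.

  The slopes with small energy have measure at most 1/K. For them the product of the factors
  \<open>1 + e^(iu) + e^(itu)\<close> over the scales has small mean square, so that some block of m scales,
  \<open>3^m\<close> of order K, carries little mass. On such a block the low-frequency factors are bounded below by
  telescoping the inequality \<open>D(3a, 3b) \<le> 9 |1 + e^(ia) + e^(ib)|^2 D(a, b)\<close> for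
  \<open>D = 9 - |1 + e^(ia) + e^(ib)|^2\<close>, which vanishes only on the lattice of periods. The neighbourhood of
  the lattice is negligible on average over t, by integrating over the plane of the points (u, tu)
  and using the orthogonality of the exponentials on the torus.
\<close>

section \<open>Words, cells and energy\<close>

text \<open>Two facts are played against each other. Heavy overlap is wasteful: at every deeper
  level, many words over one short interval cost no more than that interval. Light overlap is a mean
  square statement about the counting function, hence about its Fourier transform, and it fails for
  most slopes: each of many disjoint frequency blocks would have to carry a fixed share of a bounded
  total mass. The obstacle is that \<open>1 + cis a + cis b\<close> has zeros, so partial products
  can be small. At a zero, 1, \<open>cis a\<close> and \<open>cis b\<close> are the three cube roots
  of unity, and tripling sends them all to 1. So the smallness of m consecutive factors can be
  charged to one value of the defect at the end of the block. What remains, the vicinity of the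
  lattice, is harmless only for most slopes, not for each one. With \<open>3^m\<close> of order K, a
  set of flat slopes of measure above 1/K allows only order \<open>K^6\<close> blocks, so
  \<open>N = K^10\<close> leaves ample room for them. The exponent 12 is this 10 plus the 2 from the
  \<open>K^2\<close> repetitions that the contraction needs.\<close>

definition words :: "nat \<Rightarrow> int list set" where
  "words n = {w. set w \<subseteq> {-1, 0, 1} \<and> length w = n}"

text \<open>The direction of digit 1 serves as origin of the projected triangle; those of -1 and 0 are then
  at the relative positions 1 and t.\<close>

definition digit :: "real \<Rightarrow> int \<Rightarrow> real" where
  "digit t d = (if d = 1 then 0 else if d = 0 then t else 1)"

primrec node :: "real \<Rightarrow> int list \<Rightarrow> real" where
  "node t [] = 0"
| "node t (d # w) = 3 ^ length w * digit t d + node t w"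

lemma finite_words [simp]: "finite (words n)"
  unfolding words_def by (rule finite_lists_length_eq) simp

lemma card_words [simp]: "card (words n) = 3 ^ n"
proof -
  have "card {-1, 0, 1 :: int} = 3" by simp
  then show ?thesis unfolding words_def by (simp only: card_lists_length_eq finite.intros)
qed

lemma words_0 [simp]: "words 0 = {[]}"
  by (auto simp: words_def)

lemma length_words [simp]: "w \<in> words n \<Longrightarrow> length w = n"
  by (simp add: words_def)

lemma take_words: "w \<in> words n \<Longrightarrow> k \<le> n \<Longrightarrow> take k w \<in> words k"
  unfolding words_def using set_take_subset[of k w] by auto

lemma drop_words: "w \<in> words n \<Longrightarrow> drop k w \<in> words (n - k)"
  unfolding words_def using set_drop_subset[of k w] by auto

lemma append_words: "u \<in> words k \<Longrightarrow> v \<in> words m \<Longrightarrow> u @ v \<in> words (k + m)"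
  unfolding words_def by simp

lemma words_Suc: "words (Suc n) = (\<lambda>(d, w). d # w) ` ({-1, 0, 1} \<times> words n)"
  unfolding words_def
proof safe
  fix w :: "int list" assume "set w \<subseteq> {-1, 0, 1}" "length w = Suc n"
  then show "w \<in> (\<lambda>(d, w). d # w) ` ({-1, 0, 1} \<times> {w. set w \<subseteq> {-1, 0, 1} \<and> length w = n})"
    by (cases w) auto
qed auto

lemma node_append: "node t (u @ v) = 3 ^ length v * node t u + node t v"
  by (induction u) (auto simp: algebra_simps power_add)

lemma digit_bounds: "-1 \<le> t \<Longrightarrow> t \<le> 2 \<Longrightarrow> -1 \<le> digit t d \<and> digit t d \<le> 2"
  by (auto simp: digit_def)

lemma node_bounds:
  assumes "-1 \<le> t" "t \<le> 2"
  shows "-(3 ^ length w) / 2 \<le> node t w \<and> node t w \<le> 3 ^ length w"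
proof -
  have "1 - 3 ^ length w \<le> 2 * node t w \<and> node t w \<le> 3 ^ length w - 1"
  proof (induction w)
    case (Cons d w)
    define P :: real where "P = 3 ^ length w"
    have "0 < P" by (simp add: P_def)
    then have *: "P * -1 \<le> P * digit t d" "P * digit t d \<le> P * 2"
      using digit_bounds[OF assms, of d] by (intro mult_left_mono; simp)+
    have IH: "1 - P \<le> 2 * node t w" "node t w \<le> P - 1" using Cons by (simp_all add: P_def)
    have "node t (d # w) = P * digit t d + node t w" "3 ^ length (d # w) = 3 * P"
      by (simp_all add: P_def)
    then show ?case using * IH by linarith
  qed simp
  then show ?thesis by linarith
qed

text \<open>The words whose interval of radius 2 around \<open>node t w\<close> meets \<open>{j..<j + 1}\<close>; with this radius
  the intervals of the descendants of a word stay inside its own, rescaled interval.\<close>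

definition cell :: "real \<Rightarrow> nat \<Rightarrow> int \<Rightarrow> int list set" where
  "cell t n j = {w \<in> words n. of_int j - 2 < node t w \<and> node t w < of_int j + 3}"

lemma cell_subset: "cell t n j \<subseteq> words n"
  by (auto simp: cell_def)

lemma finite_cell [simp]: "finite (cell t n j)"
  by (rule finite_subset[OF cell_subset]) simp

text \<open>The real x only names a chain of nested triadic intervals, one per level, each
  containing x. Appending a digit triples the node and adds something in [-1, 2], while the index
  triples and gains 0, 1 or 2; the margins 2 and 3 of \<open>cell\<close> absorb both.\<close>

lemma cell_take_step:
  fixes x :: real
  assumes t: "-1 \<le> t" "t \<le> 2" and w: "w \<in> cell t (Suc k) \<lfloor>3 ^ Suc k * x\<rfloor>"
  shows "take k w \<in> cell t k \<lfloor>3 ^ k * x\<rfloor>"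
proof -
  define y where "y = 3 ^ k * x"
  have ww: "w \<in> words (Suc k)" using w by (simp add: cell_def)
  have "w = take k w @ [w ! k]"
    using take_Suc_conv_app_nth[of k w] ww by simp
  moreover have "node t (take k w @ [w ! k]) = 3 * node t (take k w) + digit t (w ! k)"
    by (simp add: node_append)
  ultimately have nd: "node t w = 3 * node t (take k w) + digit t (w ! k)" by simp
  have y3: "3 ^ Suc k * x = 3 * y" by (simp add: y_def)
  have "of_int \<lfloor>3 * y\<rfloor> - 2 < node t w" "node t w < of_int \<lfloor>3 * y\<rfloor> + 3"
    using w unfolding cell_def y3 by blast+
  moreover have "3 * \<lfloor>y\<rfloor> \<le> \<lfloor>3 * y\<rfloor>" "\<lfloor>3 * y\<rfloor> \<le> 3 * \<lfloor>y\<rfloor> + 2" by linarith+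
  moreover from this have "3 * real_of_int \<lfloor>y\<rfloor> \<le> of_int \<lfloor>3 * y\<rfloor>" "of_int \<lfloor>3 * y\<rfloor> \<le> 3 * real_of_int \<lfloor>y\<rfloor> + 2"
    by linarith+
  moreover have "-1 \<le> digit t (w ! k)" "digit t (w ! k) \<le> 2" using digit_bounds[OF t] by blast+
  ultimately have "of_int \<lfloor>y\<rfloor> - 2 < node t (take k w) \<and> node t (take k w) < of_int \<lfloor>y\<rfloor> + 3"
    unfolding nd by linarith
  then show ?thesis
    using take_words[OF ww, of k] by (simp add: cell_def y_def)
qed

lemma cell_take:
  fixes x :: real
  assumes t: "-1 \<le> t" "t \<le> 2" and "k \<le> n" and "w \<in> cell t n \<lfloor>3 ^ n * x\<rfloor>"
  shows "take k w \<in> cell t k \<lfloor>3 ^ k * x\<rfloor>"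
  using assms(3,4)
proof (induction n arbitrary: w)
  case 0
  then show ?case by (auto simp: cell_def)
next
  case (Suc n)
  show ?case
  proof (cases "k = Suc n")
    case True
    have "w \<in> words (Suc n)" using Suc.prems(2) cell_subset by blast
    from length_words[OF this] True have "take k w = w" by simp
    then show ?thesis using Suc.prems(2) True by (simp only:)
  next
    case False
    then have "k \<le> n" using Suc.prems by simp
    from Suc.IH[OF this cell_take_step[OF t Suc.prems(2)]] have "take k (take n w) \<in> cell t k \<lfloor>3 ^ k * x\<rfloor>" .
    moreover have "take k (take n w) = take k w" using \<open>k \<le> n\<close> by (simp add: min_absorb1)
    ultimately show ?thesis by simp
  qed
qed

lemma card_cell_0: "card (cell t 0 j) \<le> 1"
  by (rule order_trans[OF card_mono[OF _ cell_subset]]) simp_all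

text \<open>Each word of the finer cell extends a word of the coarser one by one of three digits.
  Thus a count that reaches K for the first time overshoots it at most by the factor 3.\<close>

lemma card_cell_Suc:
  fixes x :: real
  assumes t: "-1 \<le> t" "t \<le> 2"
  shows "card (cell t (Suc k) \<lfloor>3 ^ Suc k * x\<rfloor>) \<le> 3 * card (cell t k \<lfloor>3 ^ k * x\<rfloor>)"
proof -
  let ?A = "cell t k \<lfloor>3 ^ k * x\<rfloor>"
  have "cell t (Suc k) \<lfloor>3 ^ Suc k * x\<rfloor> \<subseteq> (\<lambda>(u, d). u @ [d]) ` (?A \<times> {-1, 0, 1})"
  proof
    fix w assume w: "w \<in> cell t (Suc k) \<lfloor>3 ^ Suc k * x\<rfloor>"
    then have ww: "w \<in> words (Suc k)" by (simp add: cell_def)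
    have "w = take k w @ [w ! k]"
      using take_Suc_conv_app_nth[of k w] ww by simp
    moreover have "w ! k \<in> {-1, 0, 1}" using ww unfolding words_def
      by (metis (mono_tags, lifting) lessI mem_Collect_eq nth_mem subset_iff)
    ultimately show "w \<in> (\<lambda>(u, d). u @ [d]) ` (?A \<times> {-1, 0, 1})"
      using cell_take_step[OF t w] by force
  qed
  from card_mono[OF _ this] have "card (cell t (Suc k) \<lfloor>3 ^ Suc k * x\<rfloor>) \<le> card ((\<lambda>(u, d). u @ [d]) ` (?A \<times> {-1, 0, 1::int}))"
    by simp
  also have "\<dots> \<le> card (?A \<times> {-1, 0, 1::int})" by (rule card_image_le) simp
  also have "\<dots> = 3 * card ?A" by (simp add: card_cartesian_product)
  finally show ?thesis .
qed

section \<open>Stopping intervals: the maximal triadic intervals of high multiplicity\<close>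

definition stop :: "real \<Rightarrow> nat \<Rightarrow> nat \<Rightarrow> real \<Rightarrow> bool" where
  "stop t K k x \<longleftrightarrow> K \<le> card (cell t k \<lfloor>3 ^ k * x\<rfloor>) \<and> (\<forall>i<k. card (cell t i \<lfloor>3 ^ i * x\<rfloor>) < K)"

lemma floor_grid:
  fixes x :: real
  assumes "i \<le> k"
  shows "\<lfloor>3 ^ i * (of_int \<lfloor>3 ^ k * x\<rfloor> / 3 ^ k :: real)\<rfloor> = \<lfloor>3 ^ i * x\<rfloor>"
proof -
  define m where "m = k - i"
  have k: "k = m + i" using assms by (simp add: m_def)
  have "3 ^ i * (of_int \<lfloor>3 ^ k * x\<rfloor> / 3 ^ k) = (of_int \<lfloor>3 ^ k * x\<rfloor> / of_int (3 ^ m) :: real)"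
    by (simp add: k power_add)
  then have "\<lfloor>3 ^ i * (of_int \<lfloor>3 ^ k * x\<rfloor> / 3 ^ k) :: real\<rfloor> = \<lfloor>3 ^ k * x\<rfloor> div 3 ^ m"
    by (simp only: floor_divide_of_int_eq)
  also have "\<dots> = \<lfloor>(3 ^ k * x) / of_int (3 ^ m)\<rfloor>" by (rule floor_divide_real_eq_div[symmetric]) simp
  also have "(3 ^ k * x) / of_int (3 ^ m) = 3 ^ i * x" by (simp add: k power_add)
  finally show ?thesis .
qed

text \<open>All counts up to level k see x only through its triadic interval of level k. This allows
  \<open>stops\<close> to be indexed by pairs (k, j) and tested at left end points.\<close>

lemma stop_grid: "stop t K k (of_int \<lfloor>3 ^ k * x\<rfloor> / 3 ^ k) \<longleftrightarrow> stop t K k x"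
  unfolding stop_def using floor_grid[of _ k x] by (metis le_refl less_imp_le)

definition stops :: "real \<Rightarrow> nat \<Rightarrow> nat \<Rightarrow> (nat \<times> int) set" where
  "stops t K N = {(k, j). k \<le> N \<and> stop t K k (of_int j / 3 ^ k)}"

lemma stopsD:
  assumes "(k, j) \<in> stops t K N"
  shows "k \<le> N" "K \<le> card (cell t k j)" "stop t K k (of_int j / 3 ^ k)"
  using assms by (auto simp: stops_def stop_def)

text \<open>There is a single word of length 0, too few for K. Positivity of k makes the induction
  in the energy estimate descend to a strictly smaller level.\<close>

lemma stops_pos: "2 \<le> K \<Longrightarrow> (k, j) \<in> stops t K N \<Longrightarrow> 0 < k"
  using card_cell_0[of t j] by (cases k) (auto dest: stopsD(2))

lemma card_cell_stops:
  assumes t: "-1 \<le> t" "t \<le> 2" and "2 \<le> K" and S: "(k, j) \<in> stops t K N"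
  shows "card (cell t k j) \<le> 3 * K"
proof -
  obtain i where k: "k = Suc i" using stops_pos[OF assms(3) S] by (cases k) auto
  define x :: real where "x = of_int j / 3 ^ k"
  have j: "\<lfloor>3 ^ k * x\<rfloor> = j" by (simp add: x_def)
  have "card (cell t i \<lfloor>3 ^ i * x\<rfloor>) < K"
    using stopsD(3)[OF S] unfolding stop_def x_def[symmetric] by (simp add: k)
  moreover have "card (cell t k \<lfloor>3 ^ k * x\<rfloor>) \<le> 3 * card (cell t i \<lfloor>3 ^ i * x\<rfloor>)"
    unfolding k by (rule card_cell_Suc[OF t])
  ultimately show ?thesis unfolding j by simp
qed

lemma finite_stops [simp]:
  assumes t: "-1 \<le> t" "t \<le> 2" and "1 \<le> K"
  shows "finite (stops t K N)"
proof (rule finite_subset)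
  show "stops t K N \<subseteq> (\<Union>k\<le>N. Pair k ` {-(3 ^ k) - 3..3 ^ k + 2})"
  proof safe
    fix k j assume S: "(k, j) \<in> stops t K N"
    from stopsD(2)[OF S] assms(3) have "cell t k j \<noteq> {}" by auto
    then obtain w where w: "w \<in> words k" "of_int j - 2 < node t w" "node t w < of_int j + 3"
      by (auto simp: cell_def)
    have "-(3 ^ k) / 2 \<le> node t w \<and> node t w \<le> 3 ^ k" using node_bounds[OF t, of w] w(1) by simp
    then have "of_int j < of_int (3 ^ k + 2 :: int) + (0::real)" "of_int (-(3 ^ k) - 3) < (of_int j::real)" using w by auto
    then have "j < 3 ^ k + 2" "-(3 ^ k) - 3 < j"
      by (simp_all only: of_int_less_iff add_0_right)
    then have "j \<in> {-(3 ^ k) - 3..3 ^ k + 2}" by simp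
    then show "(k, j) \<in> (\<Union>k\<le>N. Pair k ` {-(3 ^ k) - 3..3 ^ k + 2})"
      using stopsD(1)[OF S] by blast
  qed
qed auto

text \<open>A chain of intervals around x reaches multiplicity K for the first time only once. Hence
  the stopping intervals are disjoint, and their lengths add up to the measure of their
  union.\<close>

lemma stops_unique:
  fixes x :: real
  assumes "(k, j) \<in> stops t K N" "(k', j') \<in> stops t K N" "\<lfloor>3 ^ k * x\<rfloor> = j" "\<lfloor>3 ^ k' * x\<rfloor> = j'"
  shows "k = k' \<and> j = j'"
proof -
  have "stop t K k x" "stop t K k' x"
    using stopsD(3)[OF assms(1)] stopsD(3)[OF assms(2)] assms(3,4) stop_grid by metis+
  then have "k = k'" unfolding stop_def by (metis linorder_neqE_nat not_less)
  then show ?thesis using assms by simp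
qed

lemma stopsI:
  fixes x :: real
  assumes "K \<le> card (cell t n \<lfloor>3 ^ n * x\<rfloor>)" "n \<le> N"
  obtains k where "k \<le> n" "(k, \<lfloor>3 ^ k * x\<rfloor>) \<in> stops t K N"
proof -
  define k where "k = (LEAST k. K \<le> card (cell t k \<lfloor>3 ^ k * x\<rfloor>))"
  have k: "K \<le> card (cell t k \<lfloor>3 ^ k * x\<rfloor>)" "k \<le> n"
    unfolding k_def by (rule LeastI, rule assms(1)) (rule Least_le, rule assms(1))
  have "\<forall>i<k. card (cell t i \<lfloor>3 ^ i * x\<rfloor>) < K"
    unfolding k_def using not_less_Least by (metis not_less)
  with k have "stop t K k x" by (simp add: stop_def)
  then have "(k, \<lfloor>3 ^ k * x\<rfloor>) \<in> stops t K N" using stop_grid k assms(2) by (auto simp: stops_def)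
  with k(2) that show ?thesis by blast
qed

section \<open>Counting close pairs of words\<close>

text \<open>The left side is an autocorrelation \<open>sum of c (j + b) * c j\<close> of the
  occupation numbers c, and an autocorrelation is largest at shift 0, by
  \<open>2 * x * y <= x^2 + y^2\<close>. Two values with equal floor are at distance below
  1.\<close>

lemma card_floor_shift_le:
  fixes f :: "'a \<Rightarrow> real"
  assumes fin: "finite A"
  shows "card {(v, w) \<in> A \<times> A. \<lfloor>f v\<rfloor> = \<lfloor>f w\<rfloor> + b} \<le> card {(v, w) \<in> A \<times> A. \<bar>f v - f w\<bar> < 1}"
proof -
  define J where "J = (\<lambda>v. \<lfloor>f v\<rfloor>) ` A"
  define c where "c j = card {v \<in> A. \<lfloor>f v\<rfloor> = j}" for j
  have finJ: "finite J" using fin by (simp add: J_def)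
  have count: "card {(v, w) \<in> A \<times> A. \<lfloor>f v\<rfloor> = \<lfloor>f w\<rfloor> + b} = (\<Sum>j\<in>J. c (j + b) * c j)" for b
  proof -
    have "{(v, w) \<in> A \<times> A. \<lfloor>f v\<rfloor> = \<lfloor>f w\<rfloor> + b} =
        (\<Union>j\<in>J. {v \<in> A. \<lfloor>f v\<rfloor> = j + b} \<times> {w \<in> A. \<lfloor>f w\<rfloor> = j})"
      by (auto simp: J_def)
    also have "card \<dots> = (\<Sum>j\<in>J. card ({v \<in> A. \<lfloor>f v\<rfloor> = j + b} \<times> {w \<in> A. \<lfloor>f w\<rfloor> = j}))"
      by (rule card_UN_disjoint) (use fin finJ in auto)
    finally show ?thesis by (simp add: card_cartesian_product c_def)
  qed
  have out: "c j = 0" if "j \<notin> J" for j using that by (auto simp: c_def J_def intro!: card_eq_0_iff[THEN iffD2])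
  have "(\<Sum>j\<in>J. (c (j + b))\<^sup>2) = (\<Sum>j\<in>(\<lambda>j. j + b) ` J. (c j)\<^sup>2)"
    by (subst sum.reindex) (auto simp: inj_on_def)
  also have "\<dots> = (\<Sum>j\<in>(\<lambda>j. j + b) ` J \<inter> J. (c j)\<^sup>2)"
    by (rule sum.mono_neutral_right) (use finJ out in auto)
  also have "\<dots> \<le> (\<Sum>j\<in>J. (c j)\<^sup>2)" by (rule sum_mono2) (use finJ in auto)
  finally have shift: "(\<Sum>j\<in>J. (c (j + b))\<^sup>2) \<le> (\<Sum>j\<in>J. (c j)\<^sup>2)" .
  have "2 * (\<Sum>j\<in>J. c (j + b) * c j) \<le> (\<Sum>j\<in>J. (c (j + b))\<^sup>2 + (c j)\<^sup>2)"
    unfolding sum_distrib_left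
  proof (rule sum_mono)
    fix j
    have "0 \<le> (int (c (j + b)) - int (c j))^2" by simp
    then have "2 * (int (c (j + b)) * int (c j)) \<le> int (c (j + b))^2 + int (c j)^2"
      by (simp add: power2_diff)
    then have "int (2 * (c (j + b) * c j)) \<le> int ((c (j + b))\<^sup>2 + (c j)\<^sup>2)"
      by (simp only: of_nat_add of_nat_mult of_nat_numeral of_nat_power)
    then show "2 * (c (j + b) * c j) \<le> (c (j + b))\<^sup>2 + (c j)\<^sup>2"
      by (simp only: of_nat_le_iff)
  qed
  also have "\<dots> \<le> 2 * (\<Sum>j\<in>J. (c j)\<^sup>2)" using shift by (simp add: sum.distrib)
  finally have "(\<Sum>j\<in>J. c (j + b) * c j) \<le> (\<Sum>j\<in>J. (c j)\<^sup>2)" by simp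
  also have "\<dots> = card {(v, w) \<in> A \<times> A. \<lfloor>f v\<rfloor> = \<lfloor>f w\<rfloor> + 0}"
    unfolding count by (simp add: power2_eq_square)
  also have "\<dots> \<le> card {(v, w) \<in> A \<times> A. \<bar>f v - f w\<bar> < 1}"
    by (rule card_mono) (use fin in \<open>auto intro: finite_subset[of _ "A \<times> A"]\<close>, linarith)
  finally show ?thesis using count by simp
qed

text \<open>The difference of the floors can exceed the floor of s only by -1, 0, 1 or 2, whence the
  factor 4. The bound does not depend on s.\<close>

lemma card_near_pairs_shift_le:
  fixes f :: "'a \<Rightarrow> real"
  assumes fin: "finite A"
  shows "card {(v, w) \<in> A \<times> A. \<bar>f v - f w - s\<bar> < 1} \<le> 4 * card {(v, w) \<in> A \<times> A. \<bar>f v - f w\<bar> < 1}"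
proof -
  let ?P = "\<lambda>b. {(v, w) \<in> A \<times> A. \<lfloor>f v\<rfloor> = \<lfloor>f w\<rfloor> + b}"
  have finP: "finite (?P b)" for b by (rule finite_subset[of _ "A \<times> A"]) (use fin in auto)
  have "{(v, w) \<in> A \<times> A. \<bar>f v - f w - s\<bar> < 1} \<subseteq> (\<Union>i\<in>{-1, 0, 1, 2}. ?P (\<lfloor>s\<rfloor> + i))"
  proof safe
    fix v w assume vw: "v \<in> A" "w \<in> A" "\<bar>f v - f w - s\<bar> < 1"
    then have "\<lfloor>f v\<rfloor> - \<lfloor>f w\<rfloor> - \<lfloor>s\<rfloor> \<in> {-1, 0, 1, 2}"
      unfolding insert_iff empty_iff by linarith
    with vw show "(v, w) \<in> (\<Union>i\<in>{-1, 0, 1, 2}. ?P (\<lfloor>s\<rfloor> + i))"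
      by (intro UN_I[of "\<lfloor>f v\<rfloor> - \<lfloor>f w\<rfloor> - \<lfloor>s\<rfloor>"]) auto
  qed
  then have "card {(v, w) \<in> A \<times> A. \<bar>f v - f w - s\<bar> < 1} \<le> card (\<Union>i\<in>{-1, 0, 1, 2}. ?P (\<lfloor>s\<rfloor> + i))"
    using finP by (intro card_mono) auto
  also have "\<dots> \<le> (\<Sum>i\<in>{-1, 0, 1, 2}. card (?P (\<lfloor>s\<rfloor> + i)))" by (rule card_UN_le) simp
  also have "\<dots> \<le> (\<Sum>i\<in>{-1, 0, 1, 2::int}. card {(v, w) \<in> A \<times> A. \<bar>f v - f w\<bar> < 1})"
    by (rule sum_mono) (rule card_floor_shift_le[OF fin])
  finally show ?thesis by simp
qed

definition energy :: "real \<Rightarrow> nat \<Rightarrow> nat" where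
  "energy t n = card {(v, w) \<in> words n \<times> words n. \<bar>node t v - node t w\<bar> < 1}"

lemma near_pair_in_cell:
  assumes "v \<in> words n" "w \<in> words n" "\<bar>node t v - node t w\<bar> < 1"
  shows "v \<in> cell t n \<lfloor>node t v\<rfloor>" "w \<in> cell t n \<lfloor>node t v\<rfloor>"
  using assms unfolding cell_def mem_Collect_eq by (safe; linarith)+

text \<open>Once the prefixes a and b are fixed, closeness of the words is closeness of their tails
  after a shift determined by a and b. A shift of any size costs only the factor 4.\<close>

lemma energy_cell_le:
  fixes j k t
  assumes "k \<le> n"
  defines "C \<equiv> cell t k j"
  shows "card {(v, w) \<in> words n \<times> words n. take k v \<in> C \<and> take k w \<in> C \<and> \<bar>node t v - node t w\<bar> < 1}
    \<le> (card C)\<^sup>2 * (4 * energy t (n - k))" (is "card ?P \<le> _")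
proof -
  let ?Q = "\<lambda>(a, b). {(g, h) \<in> words (n - k) \<times> words (n - k). \<bar>node t g - node t h - 3 ^ (n - k) * (node t b - node t a)\<bar> < 1}"
  have finQ: "finite (?Q p)" for p
    by (rule finite_subset[of _ "words (n - k) \<times> words (n - k)"]) (auto split: prod.splits)
  have "?P \<subseteq> (\<lambda>((a, b), (g, h)). (a @ g, b @ h)) ` (SIGMA p:C \<times> C. ?Q p)"
  proof safe
    fix v w assume vw: "v \<in> words n" "w \<in> words n" "take k v \<in> C" "take k w \<in> C" "\<bar>node t v - node t w\<bar> < 1"
    have nd: "node t u = 3 ^ (n - k) * node t (take k u) + node t (drop k u)" if "u \<in> words n" for u
      using node_append[of t "take k u" "drop k u"] that by simp
    have "\<bar>node t (drop k v) - node t (drop k w) - 3 ^ (n - k) * (node t (take k w) - node t (take k v))\<bar> < 1"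
      using vw(5) unfolding nd[OF vw(1)] nd[OF vw(2)] by (simp add: algebra_simps)
    then show "(v, w) \<in> (\<lambda>((a, b), (g, h)). (a @ g, b @ h)) ` (SIGMA p:C \<times> C. ?Q p)"
      using vw drop_words by (intro image_eqI[of _ _ "((take k v, take k w), (drop k v, drop k w))"]) auto
  qed
  then have "card ?P \<le> card ((\<lambda>((a, b), (g, h)). (a @ g, b @ h)) ` (SIGMA p:C \<times> C. ?Q p))"
    by (rule card_mono[rotated]) (use finQ in \<open>auto simp: C_def\<close>)
  also have "\<dots> \<le> card (SIGMA p:C \<times> C. ?Q p)" by (rule card_image_le) (use finQ in \<open>auto simp: C_def\<close>)
  also have "\<dots> = (\<Sum>p\<in>C \<times> C. card (?Q p))" by (rule card_SigmaI) (use finQ in \<open>auto simp: C_def\<close>)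
  also have "\<dots> \<le> (\<Sum>p\<in>C \<times> C. 4 * energy t (n - k))"
  proof (rule sum_mono)
    fix p assume "p \<in> C \<times> C"
    obtain a b where p: "p = (a, b)" by (cases p)
    show "card (?Q p) \<le> 4 * energy t (n - k)"
      unfolding p prod.case energy_def by (rule card_near_pairs_shift_le) simp
  qed
  also have "\<dots> = (card C)\<^sup>2 * (4 * energy t (n - k))" by (simp add: card_cartesian_product power2_eq_square)
  finally show ?thesis .
qed

text \<open>A close pair (v, w) lies in the cell around \<open>node t v\<close> at level n. If that
  cell has fewer than K words, w has fewer than K choices. Otherwise some ancestor of the cell is a
  stop containing both prefixes, and \<open>36 * K^2\<close> is
  \<open>4 * (3 * K)^2\<close>.\<close>

lemma energy_recursion:
  assumes t: "-1 \<le> t" "t \<le> 2" and K: "2 \<le> K" and nN: "n \<le> N"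
  shows "energy t n \<le> K * 3 ^ n + (\<Sum>(k, j)\<in>{(k, j) \<in> stops t K N. k \<le> n}. 36 * K\<^sup>2 * energy t (n - k))"
proof -
  let ?S = "{(k, j) \<in> stops t K N. k \<le> n}"
  let ?near = "\<lambda>v w. \<bar>node t v - node t w\<bar> < 1"
  let ?B = "SIGMA v:{v \<in> words n. card (cell t n \<lfloor>node t v\<rfloor>) < K}. cell t n \<lfloor>node t v\<rfloor>"
  let ?P = "\<lambda>(k, j). {(v, w) \<in> words n \<times> words n. take k v \<in> cell t k j \<and> take k w \<in> cell t k j \<and> ?near v w}"
  have finS: "finite ?S" using finite_stops[OF t, of K N] K by (auto intro: finite_subset)
  have finP: "finite (?P q)" for q
    by (rule finite_subset[of _ "words n \<times> words n"]) (auto split: prod.splits)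
  have "{(v, w) \<in> words n \<times> words n. ?near v w} \<subseteq> ?B \<union> (\<Union>q\<in>?S. ?P q)"
  proof safe
    fix v w
    assume vw: "v \<in> words n" "w \<in> words n" "?near v w" and no: "(v, w) \<notin> (\<Union>q\<in>?S. ?P q)"
    define x where "x = node t v / 3 ^ n"
    have x: "3 ^ n * x = node t v" by (simp add: x_def)
    note cells = near_pair_in_cell[OF vw]
    show "card (cell t n \<lfloor>node t v\<rfloor>) < K"
    proof (rule ccontr)
      assume "\<not> ?thesis"
      then have "K \<le> card (cell t n \<lfloor>3 ^ n * x\<rfloor>)" by (simp add: x)
      from stopsI[OF this nN] obtain k where k: "k \<le> n" "(k, \<lfloor>3 ^ k * x\<rfloor>) \<in> stops t K N" by blast
      have "take k v \<in> cell t k \<lfloor>3 ^ k * x\<rfloor>" "take k w \<in> cell t k \<lfloor>3 ^ k * x\<rfloor>"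
        using cells by (auto intro!: cell_take[OF t k(1)] simp: x)
      then show False using no k vw by blast
    qed
    show "w \<in> cell t n \<lfloor>node t v\<rfloor>" by (rule cells)
  qed
  then have "energy t n \<le> card (?B \<union> (\<Union>q\<in>?S. ?P q))"
    unfolding energy_def by (rule card_mono[rotated]) (use finS finP in auto)
  also have "\<dots> \<le> card ?B + card (\<Union>q\<in>?S. ?P q)" by (rule card_Un_le)
  also have "card ?B \<le> K * 3 ^ n"
  proof -
    have "card ?B = (\<Sum>v\<in>{v \<in> words n. card (cell t n \<lfloor>node t v\<rfloor>) < K}. card (cell t n \<lfloor>node t v\<rfloor>))"
      by (rule card_SigmaI) auto
    also have "\<dots> \<le> (\<Sum>v\<in>{v \<in> words n. card (cell t n \<lfloor>node t v\<rfloor>) < K}. K)" by (rule sum_mono) auto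
    also have "\<dots> \<le> (\<Sum>v\<in>words n. K)" by (rule sum_mono2) auto
    finally show ?thesis by (simp add: mult.commute)
  qed
  also have "card (\<Union>q\<in>?S. ?P q) \<le> (\<Sum>q\<in>?S. card (?P q))" by (rule card_UN_le[OF finS])
  also have "\<dots> \<le> (\<Sum>(k, j)\<in>?S. 36 * K\<^sup>2 * energy t (n - k))"
  proof (rule sum_mono)
    fix q assume "q \<in> ?S"
    then obtain k j where q: "q = (k, j)" "(k, j) \<in> stops t K N" "k \<le> n" by auto
    have "card (?P q) \<le> (card (cell t k j))\<^sup>2 * (4 * energy t (n - k))"
      using energy_cell_le[OF q(3), of t j] by (simp add: q(1))
    also have "\<dots> \<le> (3 * K)\<^sup>2 * (4 * energy t (n - k))"
      by (intro mult_right_mono power_mono card_cell_stops[OF t K q(2)]) auto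
    finally show "card (?P q) \<le> (case q of (k, j) \<Rightarrow> 36 * K\<^sup>2 * energy t (n - k))"
      by (simp add: q(1) power_mult_distrib)
  qed
  finally show ?thesis by simp
qed

definition stop_mass :: "real \<Rightarrow> nat \<Rightarrow> nat \<Rightarrow> real" where
  "stop_mass t K N = (\<Sum>(k, j)\<in>stops t K N. 1 / 3 ^ k)"

text \<open>Inserting the claim for \<open>n - k\<close> into the recursion turns the sum over the
  stops into \<open>72 * K^3 * 3^n\<close> times their total length. The constant 72 makes this at
  most the main term \<open>K * 3^n\<close>.\<close>

lemma energy_le_of_small_stop_mass:
  assumes t: "-1 \<le> t" "t \<le> 2" and K: "2 \<le> K" and small: "72 * real K ^ 2 * stop_mass t K N \<le> 1"
    and "n \<le> N"
  shows "real (energy t n) \<le> 2 * real K * 3 ^ n"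
  using \<open>n \<le> N\<close>
proof (induction n rule: less_induct)
  case (less n)
  let ?S = "{(k, j) \<in> stops t K N. k \<le> n}"
  have finS: "finite (stops t K N)" using finite_stops[OF t, of K N] K by simp
  have "real (energy t n) \<le> real (K * 3 ^ n + (\<Sum>(k, j)\<in>?S. 36 * K\<^sup>2 * energy t (n - k)))"
    using energy_recursion[OF t K less.prems] by (simp only: of_nat_le_iff)
  also have "\<dots> = real K * 3 ^ n + (\<Sum>(k, j)\<in>?S. 36 * real K ^ 2 * energy t (n - k))"
    by (simp add: case_prod_beta)
  also have "(\<Sum>(k, j)\<in>?S. 36 * real K ^ 2 * energy t (n - k)) \<le> (\<Sum>(k, j)\<in>?S. 36 * real K ^ 2 * (2 * real K * 3 ^ n) * (1 / 3 ^ k))"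
  proof (rule sum_mono, safe)
    fix k j assume kj: "(k, j) \<in> stops t K N" "k \<le> n"
    have "0 < k" by (rule stops_pos[OF K kj(1)])
    then have "real (energy t (n - k)) \<le> 2 * real K * 3 ^ (n - k)" using kj less.prems by (intro less.IH) auto
    also have "\<dots> = 2 * real K * 3 ^ n * (1 / 3 ^ k)" using kj by (simp add: power_diff)
    finally show "36 * real K ^ 2 * energy t (n - k) \<le> 36 * real K ^ 2 * (2 * real K * 3 ^ n) * (1 / 3 ^ k)"
      by (simp only: mult.assoc mult_left_mono zero_le_power2 zero_le_mult_iff of_nat_0_le_iff zero_le_numeral)
  qed
  also have "\<dots> \<le> (\<Sum>(k, j)\<in>stops t K N. 36 * real K ^ 2 * (2 * real K * 3 ^ n) * (1 / 3 ^ k))"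
    by (rule sum_mono2[OF finS]) auto
  also have "\<dots> = 36 * real K ^ 2 * (2 * real K * 3 ^ n) * stop_mass t K N"
    by (simp add: stop_mass_def sum_distrib_left case_prod_beta)
  also have "\<dots> = (real K * 3 ^ n) * (72 * real K ^ 2 * stop_mass t K N)" by simp
  also have "\<dots> \<le> (real K * 3 ^ n) * 1" by (rule mult_left_mono[OF small]) simp
  finally show ?case by simp
qed

section \<open>Contraction of the projections\<close>

lemma emeasure_lborel_affine_image:
  fixes A :: "real set"
  assumes "0 < c" "open A"
  shows "emeasure lborel ((\<lambda>x. a + c * x) ` A) = ennreal c * emeasure lborel A"
proof -
  have "open ((\<lambda>x. a + c * x) ` A)"
    using open_affinity[OF assms(2), of c a] assms(1) by simp
  then have [measurable]: "(\<lambda>x. a + c * x) ` A \<in> sets borel" by simp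
  have "emeasure lborel ((\<lambda>x. a + c * x) ` A) = (\<integral>\<^sup>+x. indicator ((\<lambda>x. a + c * x) ` A) x \<partial>lborel)"
    by simp
  also have "\<dots> = ennreal \<bar>c\<bar> * (\<integral>\<^sup>+x. indicator ((\<lambda>x. a + c * x) ` A) (a + c * x) \<partial>lborel)"
    by (rule nn_integral_real_affine) (use assms in auto)
  also have "(\<lambda>x. indicator ((\<lambda>x. a + c * x) ` A) (a + c * x) :: ennreal) = indicator A"
    using assms(1) by (auto simp: indicator_def image_iff fun_eq_iff)
  finally show ?thesis using assms by (simp add: nn_integral_indicator)
qed

text \<open>The radius 2 agrees with the one built into \<open>cell\<close>. It also leaves room for
  the affine change of coordinate on the projection, which enlarges the original radius at most
  twofold.\<close>

definition shadow :: "real \<Rightarrow> nat \<Rightarrow> real set" where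
  "shadow t n = (\<Union>w\<in>words n. ball (node t w / 3 ^ n) (2 / 3 ^ n))"

lemma open_shadow [simp]: "open (shadow t n)"
  by (auto simp: shadow_def)

lemma shadow_sets [measurable, simp]: "shadow t n \<in> sets borel"
  by (simp add: borel_open)

lemma bounded_shadow: "bounded (shadow t n)"
  by (auto simp: shadow_def)

lemma emeasure_shadow: "emeasure lborel (shadow t n) = ennreal (measure lborel (shadow t n))"
  using emeasure_bounded_finite[OF bounded_shadow] by (intro emeasure_eq_ennreal_measure) (simp add: top.not_eq_extremum)

lemma measure_shadow_0: "measure lborel (shadow t 0) = 4"
  by (simp add: shadow_def ball_eq_greaterThanLessThan)

text \<open>The tail moves the point by between -1/2 and 1 in units of \<open>3^-k\<close>. Added to
  the bounds -2 and 3 of \<open>cell\<close>, this gives -5/2 and 4.\<close>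

lemma node_scaled_bounds:
  assumes t: "-1 \<le> t" "t \<le> 2" and w: "w \<in> words n" and "k \<le> n" and c: "take k w \<in> cell t k j"
  shows "of_int j - 5 / 2 < 3 ^ k * (node t w / 3 ^ n)" "3 ^ k * (node t w / 3 ^ n) < of_int j + 4"
proof -
  define q :: real where "q = 3 ^ (n - k)"
  have q: "0 < q" "3 ^ n = 3 ^ k * q" using \<open>k \<le> n\<close> by (simp_all add: q_def flip: power_add)
  have "node t w = q * node t (take k w) + node t (drop k w)"
    using node_append[of t "take k w" "drop k w"] w by (simp add: q_def)
  then have e: "3 ^ k * (node t w / 3 ^ n) = node t (take k w) + node t (drop k w) / q"
    using q by (simp add: field_simps)
  have "-q / 2 \<le> node t (drop k w)" "node t (drop k w) \<le> q"
    using node_bounds[OF t, of "drop k w"] w by (simp_all add: q_def)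
  then have "-1/2 \<le> node t (drop k w) / q" "node t (drop k w) / q \<le> 1"
    using q(1) by (simp_all add: field_simps)
  then show "of_int j - 5 / 2 < 3 ^ k * (node t w / 3 ^ n)" "3 ^ k * (node t w / 3 ^ n) < of_int j + 4"
    using c unfolding e cell_def by auto
qed

lemma card_words_through_cell:
  assumes "k \<le> N"
  shows "card (cell t k j) * 3 ^ (N - k) \<le> card {w \<in> words N. take k w \<in> cell t k j}"
proof -
  have inj: "inj_on (\<lambda>(u, v). u @ v) (cell t k j \<times> words (N - k))"
  proof (rule inj_onI, clarify)
    fix u v u' v' assume "u \<in> cell t k j" "u' \<in> cell t k j" and e: "u @ v = u' @ v'"
    then have "length u = length u'" using cell_subset by (metis length_words subsetD)
    then show "u = u' \<and> v = v'" using e by simp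
  qed
  have "card (cell t k j) * 3 ^ (N - k) = card (cell t k j \<times> words (N - k))"
    by (simp add: card_cartesian_product)
  also have "\<dots> = card ((\<lambda>(u, v). u @ v) ` (cell t k j \<times> words (N - k)))"
    by (rule card_image[OF inj, symmetric])
  also have "\<dots> \<le> card {w \<in> words N. take k w \<in> cell t k j}"
  proof (rule card_mono)
    show "(\<lambda>(u, v). u @ v) ` (cell t k j \<times> words (N - k)) \<subseteq> {w \<in> words N. take k w \<in> cell t k j}"
    proof clarify
      fix u v assume u: "u \<in> cell t k j" and v: "v \<in> words (N - k)"
      have u': "u \<in> words k" using u cell_subset by blast
      have "u @ v \<in> words N" using append_words[OF u' v] assms by simp
      moreover have "take k (u @ v) = u" using u' by simp
      ultimately show "u @ v \<in> words N \<and> take k (u @ v) \<in> cell t k j" using u by simp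
    qed
  qed simp
  finally show ?thesis .
qed

section \<open>Vitali selection and contraction\<close>

text \<open>In units of \<open>3^-k\<close> this is [j - 5, j + 6]. It contains the points below a
  word of the cell, which lie in (j - 5/2, j + 4), together with their balls of radius at most
  2.\<close>

abbreviation wide :: "nat \<times> int \<Rightarrow> real set" where
  "wide p \<equiv> cball ((of_int (snd p) + 1/2) / 3 ^ fst p) (11/2 / 3 ^ fst p)"

lemma mem_wideI:
  assumes "of_int j - 5 \<le> 3 ^ k * x" "3 ^ k * x \<le> of_int j + 6"
  shows "x \<in> wide (k, j)"
proof -
  have "(of_int j - 5) / 3 ^ k \<le> x" "x \<le> (of_int j + 6) / 3 ^ k"
    using assms by (simp_all add: field_simps)
  then show ?thesis by (simp add: cball_def dist_real_def abs_le_iff field_simps)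
qed

text \<open>The stopping intervals are disjoint and covered by the fivefold enlargements of the
  selected wide intervals. These have length 11 in their own unit, and 55 = 5 * 11.\<close>

lemma stop_mass_le_disjoint:
  assumes t: "-1 \<le> t" "t \<le> 2" and K: "2 \<le> K"
  obtains C where "C \<subseteq> stops t K N" "pairwise (\<lambda>p q. disjnt (wide p) (wide q)) C"
    "stop_mass t K N \<le> 55 * (\<Sum>p\<in>C. 1 / 3 ^ fst p)"
proof -
  let ?S = "stops t K N"
  have finS: "finite ?S" using finite_stops[OF t, of K N] K by simp
  obtain C where C: "C \<subseteq> ?S" "pairwise (\<lambda>p q. disjnt (wide p) (wide q)) C"
    and cover: "(\<Union>p\<in>?S. wide p) \<subseteq> (\<Union>p\<in>C. cball ((of_int (snd p) + 1/2 :: real) / 3 ^ fst p) (5 * (11/2 / 3 ^ fst p)))"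
    by (rule Vitali_covering_lemma_cballs[where S = "\<Union>p\<in>?S. wide p" and K = ?S
      and a = "\<lambda>p. (of_int (snd p) + 1/2) / 3 ^ fst p" and r = "\<lambda>p. 11/2 / 3 ^ fst p" and B = "11/2"])
      (auto simp: field_simps)
  have finC: "finite C" using C(1) finS by (rule finite_subset)
  define J where "J = (\<lambda>(k, j). {of_int j / 3 ^ k ..< (of_int j + 1) / 3 ^ k :: real})"
  have Jiff: "x \<in> J (k, j) \<longleftrightarrow> \<lfloor>3 ^ k * x\<rfloor> = j" for x k j
    unfolding J_def by (auto simp: floor_eq_iff field_simps)
  have Jset[measurable]: "J p \<in> sets borel" for p by (auto simp: J_def split: prod.split)
  have Jm: "emeasure lborel (J p) = ennreal (1 / 3 ^ fst p)" for p
    by (auto simp: J_def field_simps divide_right_mono split: prod.split)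
  have disj: "disjoint_family_on J ?S"
  proof (unfold disjoint_family_on_def, intro ballI impI)
    fix p q assume pq: "p \<in> ?S" "q \<in> ?S" "p \<noteq> q"
    obtain k j k' j' where kj: "p = (k, j)" "q = (k', j')" by (cases p, cases q)
    note * = pq[unfolded kj]
    show "J p \<inter> J q = {}"
    proof (rule ccontr)
      assume "J p \<inter> J q \<noteq> {}"
      then have "J (k, j) \<inter> J (k', j') \<noteq> {}" by (simp add: kj)
      then obtain x :: real where "\<lfloor>3 ^ k * x\<rfloor> = j" "\<lfloor>3 ^ k' * x\<rfloor> = j'" using Jiff by blast
      from stops_unique[OF *(1,2) this] *(3) show False by simp
    qed
  qed
  have "stop_mass t K N = (\<Sum>p\<in>?S. measure lborel (J p))"
    unfolding stop_mass_def by (intro sum.cong) (auto simp: measure_def Jm)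
  also have "\<dots> = measure lborel (\<Union>p\<in>?S. J p)"
    by (rule measure_finite_Union[symmetric]) (use finS disj in \<open>auto simp: Jm\<close>)
  also have "\<dots> \<le> measure lborel (\<Union>p\<in>C. cball ((of_int (snd p) + 1/2 :: real) / 3 ^ fst p) (5 * (11/2 / 3 ^ fst p)))"
  proof (rule measure_mono_fmeasurable)
    have "J p \<subseteq> wide p" for p
    proof
      fix x assume "x \<in> J p"
      moreover obtain k j where p: "p = (k, j)" by (cases p)
      ultimately have "\<lfloor>3 ^ k * x\<rfloor> = j" using Jiff by simp
      then show "x \<in> wide p" unfolding p by (intro mem_wideI) linarith+
    qed
    then show "(\<Union>p\<in>?S. J p) \<subseteq> (\<Union>p\<in>C. cball ((of_int (snd p) + 1/2 :: real) / 3 ^ fst p) (5 * (11/2 / 3 ^ fst p)))"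
      using cover by blast
    show "(\<Union>p\<in>?S. J p) \<in> sets lborel" using finS by auto
    show "(\<Union>p\<in>C. cball ((of_int (snd p) + 1/2 :: real) / 3 ^ fst p) (5 * (11/2 / 3 ^ fst p))) \<in> fmeasurable lborel"
      using finC by (intro fmeasurable.finite_UN fmeasurable_compact) auto
  qed
  also have "\<dots> \<le> (\<Sum>p\<in>C. measure lborel (cball ((of_int (snd p) + 1/2 :: real) / 3 ^ fst p) (5 * (11/2 / 3 ^ fst p))))"
    by (rule measure_UNION_le[OF finC]) auto
  also have "\<dots> = 55 * (\<Sum>p\<in>C. 1 / 3 ^ fst p)"
    unfolding sum_distrib_left by (intro sum.cong) (auto simp: cball_eq_atLeastAtMost field_simps)
  finally show ?thesis using that C by blast
qed

text \<open>Let s be the total length of the selected stops. The words of length N through a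
  selected stop of length \<open>3^-k\<close> number at least \<open>K * 3^(N - k)\<close>, yet at
  every deeper level all their balls stay inside one wide interval of length
  \<open>11 / 3^k\<close>. At most the fraction \<open>1 - K * s\<close> of the words is left, and
  each of these contributes a copy of the shadow of level n scaled by \<open>3^-N\<close>.\<close>

lemma shadow_contraction:
  assumes t: "-1 \<le> t" "t \<le> 2" and K: "2 \<le> K"
  shows "\<exists>s. stop_mass t K N \<le> 55 * s \<and> real K * s \<le> 1 \<and>
    (\<forall>n. measure lborel (shadow t (N + n)) \<le> 11 * s + (1 - K * s) * measure lborel (shadow t n))"
proof -
  obtain C where C: "C \<subseteq> stops t K N" "pairwise (\<lambda>p q. disjnt (wide p) (wide q)) C"
    "stop_mass t K N \<le> 55 * (\<Sum>p\<in>C. 1 / 3 ^ fst p)"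
    using stop_mass_le_disjoint[OF t K] by blast
  define s where "s = (\<Sum>p\<in>C. 1 / 3 ^ fst p :: real)"
  have finC: "finite C" using C(1) finite_stops[OF t, of K N] K by (intro finite_subset[OF C(1)]) simp
  define T where "T p = {w \<in> words N. take (fst p) w \<in> cell t (fst p) (snd p)}" for p
  have kN: "fst p \<le> N" if "p \<in> C" for p using that C(1) by (cases p) (auto dest: stopsD(1))
  have wide: "node t w / 3 ^ (N + n) \<in> wide p" if "p \<in> C" "w \<in> words (N + n)" "take N w \<in> T p" for p w n
  proof -
    have "take (fst p) (take N w) = take (fst p) w" using kN[OF that(1)] by (simp add: min_absorb1)
    then have "take (fst p) w \<in> cell t (fst p) (snd p)" using that(3) by (simp add: T_def)
    note nb = node_scaled_bounds[OF t that(2) _ this]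
    have "node t w / 3 ^ (N + n) \<in> wide (fst p, snd p)"
      by (rule mem_wideI; use nb kN[OF that(1)] in linarith)
    then show ?thesis by simp
  qed
  have disjT: "disjoint_family_on T C"
  proof (unfold disjoint_family_on_def, intro ballI impI)
    fix p q assume pq: "p \<in> C" "q \<in> C" "p \<noteq> q"
    show "T p \<inter> T q = {}"
    proof (rule ccontr)
      assume "T p \<inter> T q \<noteq> {}"
      then obtain w where w: "w \<in> T p" "w \<in> T q" by blast
      \<comment> \<open>With n = 0 the fact \<open>wide\<close> applies to w itself: a word in two
        of the sets would put its own point into two disjoint intervals.\<close>
      then have ww: "w \<in> words (N + 0)" "take N w = w" by (auto simp: T_def)
      from wide[OF pq(1) ww(1)] wide[OF pq(2) ww(1)] w ww(2)
      have "\<not> disjnt (wide p) (wide q)" unfolding disjnt_iff by auto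
      then show False using C(2) pq by (auto simp: pairwise_def)
    qed
  qed
  have finT: "finite (T p)" for p by (rule finite_subset[of _ "words N"]) (auto simp: T_def)
  define R where "R = words N - (\<Union>p\<in>C. T p)"
  have "real K * s * 3 ^ N = (\<Sum>p\<in>C. real K * 3 ^ (N - fst p))"
    unfolding s_def sum_distrib_left sum_distrib_right
    by (intro sum.cong) (auto simp: kN power_diff)
  also have "\<dots> \<le> (\<Sum>p\<in>C. real (card (T p)))"
  proof (rule sum_mono)
    fix p assume p: "p \<in> C"
    have "K \<le> card (cell t (fst p) (snd p))" using p C(1) by (cases p) (auto dest: stopsD(2))
    then have "K * 3 ^ (N - fst p) \<le> card (cell t (fst p) (snd p)) * 3 ^ (N - fst p)" by simp
    also have "\<dots> \<le> card (T p)" unfolding T_def by (rule card_words_through_cell[OF kN[OF p]])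
    finally have "real (K * 3 ^ (N - fst p)) \<le> real (card (T p))" by (simp only: of_nat_le_iff)
    then show "real K * 3 ^ (N - fst p) \<le> real (card (T p))" by simp
  qed
  also have "\<dots> = real (card (\<Union>p\<in>C. T p))"
    by (subst card_UN_disjoint) (use finC finT disjT in \<open>auto simp: disjoint_family_on_def\<close>)
  finally have green: "real K * s * 3 ^ N \<le> real (card (\<Union>p\<in>C. T p))" .
  have sub: "(\<Union>p\<in>C. T p) \<subseteq> words N" by (auto simp: T_def)
  have "card (\<Union>p\<in>C. T p) \<le> 3 ^ N" using card_mono[OF _ sub] by simp
  then have le3: "real (card (\<Union>p\<in>C. T p)) \<le> 3 ^ N" by (metis of_nat_le_iff of_nat_numeral of_nat_power)
  have "real (card R) = 3 ^ N - real (card (\<Union>p\<in>C. T p))"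
    unfolding R_def using card_mono[OF _ sub] finC finT by (subst card_Diff_subset[OF _ sub]) (auto simp: of_nat_diff)
  then have cardR: "real (card R) \<le> (1 - K * s) * 3 ^ N" using green by (simp add: algebra_simps)
  have Ks: "real K * s \<le> 1"
  proof -
    have "(real K * s) * 3 ^ N \<le> 1 * 3 ^ N" using green le3 by linarith
    then show ?thesis by (simp only: mult_le_cancel_right_pos zero_less_power zero_less_numeral)
  qed
  have contr: "measure lborel (shadow t (N + n)) \<le> 11 * s + (1 - K * s) * measure lborel (shadow t n)" for n
  proof -
    let ?f = "\<lambda>w x. node t w / 3 ^ N + 1 / 3 ^ N * x :: real"
    have opf: "open (?f w ` shadow t n)" for w
      using open_affinity[of "shadow t n" "1 / 3 ^ N" "node t w / 3 ^ N"] by simp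
    have finR: "finite R" by (simp add: R_def)
    have mf: "measure lborel (?f w ` shadow t n) = 1 / 3 ^ N * measure lborel (shadow t n)" for w
      unfolding measure_def by (subst emeasure_lborel_affine_image) (simp_all add: enn2real_mult)
    have "shadow t (N + n) \<subseteq> (\<Union>p\<in>C. wide p) \<union> (\<Union>w\<in>R. ?f w ` shadow t n)"
    proof
      fix x assume "x \<in> shadow t (N + n)"
      then obtain w where w: "w \<in> words (N + n)" "\<bar>node t w / 3 ^ (N + n) - x\<bar> < 2 / 3 ^ (N + n)"
        by (auto simp: shadow_def dist_real_def)
      have u: "take N w \<in> words N" by (rule take_words[OF w(1)]) simp
      show "x \<in> (\<Union>p\<in>C. wide p) \<union> (\<Union>w\<in>R. ?f w ` shadow t n)"
      proof (cases "take N w \<in> R")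
        case False
        then obtain p where p: "p \<in> C" "take N w \<in> T p" using u by (auto simp: R_def)
        obtain k j where kj: "p = (k, j)" by (cases p)
        have kn: "k \<le> N + n" using kN[OF p(1)] by (simp add: kj)
        have "take k (take N w) = take k w" using kN[OF p(1)] by (simp add: min_absorb1 kj)
        then have "take k w \<in> cell t k j" using p(2) by (simp add: T_def kj)
        note nb = node_scaled_bounds[OF t w(1) kn this]
        have "\<bar>3 ^ k * (node t w / 3 ^ (N + n)) - 3 ^ k * x\<bar> = 3 ^ k * \<bar>node t w / 3 ^ (N + n) - x\<bar>"
          by (simp only: right_diff_distrib[symmetric] abs_mult) simp
        also have "\<dots> < 3 ^ k * (2 / 3 ^ (N + n))" by (rule mult_strict_left_mono[OF w(2)]) simp
        also have "\<dots> \<le> 2" using kn by (simp add: field_simps power_increasing)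
        finally have "\<bar>3 ^ k * (node t w / 3 ^ (N + n)) - 3 ^ k * x\<bar> < 2" .
        then have "x \<in> wide p" unfolding kj using nb by (intro mem_wideI) linarith+
        then show ?thesis using p(1) by blast
      next
        case True
        have v: "drop N w \<in> words n" using drop_words[OF w(1), of N] by simp
        define y where "y = 3 ^ N * x - node t (take N w)"
        have "node t w = 3 ^ n * node t (take N w) + node t (drop N w)"
          using node_append[of t "take N w" "drop N w"] length_words[OF v] by (simp only: append_take_drop_id)
        then have "node t w / 3 ^ (N + n) - x = (node t (drop N w) / 3 ^ n - y) / 3 ^ N"
          by (simp add: y_def power_add field_simps)
        then have "\<bar>node t (drop N w) / 3 ^ n - y\<bar> / 3 ^ N < 2 / 3 ^ (N + n)" using w(2) by simp
        then have "\<bar>node t (drop N w) / 3 ^ n - y\<bar> < 2 / 3 ^ n" by (simp add: power_add field_simps)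
        then have "y \<in> shadow t n" using v by (auto simp: shadow_def dist_real_def)
        moreover have "x = ?f (take N w) y" by (simp add: y_def field_simps)
        ultimately show ?thesis using True by blast
      qed
    qed
    then have "measure lborel (shadow t (N + n)) \<le> measure lborel ((\<Union>p\<in>C. wide p) \<union> (\<Union>w\<in>R. ?f w ` shadow t n))"
    proof (rule measure_mono_fmeasurable)
      have "bounded (?f w ` shadow t n)" for w
        using bounded_translation[OF bounded_scaling[OF bounded_shadow[of t n]], of "node t w / 3 ^ N" "1 / 3 ^ N"]
        by (simp add: image_image)
      then have "?f w ` shadow t n \<in> fmeasurable lborel" for w
        using emeasure_bounded_finite opf by (intro fmeasurableI) (auto intro: borel_open)
      then have "(\<Union>w\<in>R. ?f w ` shadow t n) \<in> fmeasurable lborel"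
        using finR by (intro fmeasurable.finite_UN)
      moreover have "(\<Union>p\<in>C. wide p) \<in> fmeasurable lborel"
        using finC by (intro fmeasurable.finite_UN fmeasurable_compact) auto
      ultimately show "(\<Union>p\<in>C. wide p) \<union> (\<Union>w\<in>R. ?f w ` shadow t n) \<in> fmeasurable lborel"
        by (rule fmeasurable.Un[rotated])
    qed simp
    also have "\<dots> \<le> measure lborel (\<Union>p\<in>C. wide p) + measure lborel (\<Union>w\<in>R. ?f w ` shadow t n)"
      by (rule measure_Un_le) (use finC finR opf in \<open>auto intro!: sets.finite_UN borel_open\<close>)
    also have "measure lborel (\<Union>p\<in>C. wide p) \<le> (\<Sum>p\<in>C. measure lborel (wide p))"
      by (rule measure_UNION_le[OF finC]) auto
    also have "(\<Sum>p\<in>C. measure lborel (wide p)) = 11 * s"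
      unfolding s_def sum_distrib_left by (intro sum.cong) (auto simp: cball_eq_atLeastAtMost field_simps)
    also have "measure lborel (\<Union>w\<in>R. ?f w ` shadow t n) \<le> (\<Sum>w\<in>R. measure lborel (?f w ` shadow t n))"
      by (rule measure_UNION_le[OF finR]) (simp only: sets_lborel borel_open[OF opf])
    also have "\<dots> = (\<Sum>w\<in>R. 1 / 3 ^ N * measure lborel (shadow t n))"
      by (intro sum.cong refl mf)
    also have "\<dots> = card R * (1 / 3 ^ N * measure lborel (shadow t n))" by simp
    also have "\<dots> \<le> ((1 - K * s) * 3 ^ N) * (1 / 3 ^ N * measure lborel (shadow t n))"
      by (rule mult_right_mono[OF cardR]) simp
    finally show ?thesis by simp
  qed
  show ?thesis using C(3) Ks contr by (intro exI[of _ s] conjI allI) (simp_all add: s_def)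
qed

text \<open>The map \<open>x -> 11 * s + (1 - K * s) * x\<close> has the fixed point 11/K, whatever
  s is. Iteration from the initial length 4 approaches it at a rate governed by a lower bound for
  \<open>K * s\<close>.\<close>

lemma shadow_small_of_large_stop_mass:
  assumes t: "-1 \<le> t" "t \<le> 2" and K: "2 \<le> K" and large: "1 < 72 * real K ^ 2 * stop_mass t K N"
  shows "measure lborel (shadow t (K\<^sup>2 * N)) \<le> 16000 / K"
proof -
  obtain s :: real where s: "stop_mass t K N \<le> 55 * s" "real K * s \<le> 1"
    "\<And>n. measure lborel (shadow t (N + n)) \<le> 11 * s + (1 - K * s) * measure lborel (shadow t n)"
    using shadow_contraction[OF t K, of N] by blast
  define k where "k = real K"
  have k: "2 \<le> k" using K by (simp add: k_def)
  \<comment> \<open>The lower bound for \<open>K * s\<close> that follows from the hypothesis; 3960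
    = 72 * 55.\<close>
  define a where "a = 1 / (3960 * k)"
  have "72 * k ^ 2 * stop_mass t K N \<le> 72 * k ^ 2 * (55 * s)"
    by (rule mult_left_mono[OF s(1)]) simp
  with large have "1 < 72 * k ^ 2 * (55 * s)" unfolding k_def by (rule less_le_trans)
  also have "\<dots> = k * s * (3960 * k)" unfolding power2_eq_square by simp
  finally have "1 \<le> k * s * (3960 * k)" by (rule less_imp_le)
  then have Ks: "a \<le> k * s" unfolding a_def by (subst pos_divide_le_eq) (use k in auto)
  have a1: "a \<le> 1" using k by (simp add: a_def divide_le_eq)
  have bound: "measure lborel (shadow t (i * N)) \<le> 11 / k + 4 * (1 - a) ^ i" for i
  proof (induction i)
    case 0
    then show ?case using k by (simp add: measure_shadow_0)
  next
    case (Suc i)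
    let ?g = "measure lborel (shadow t (i * N))"
    have "measure lborel (shadow t (Suc i * N)) \<le> 11 * s + (1 - k * s) * ?g"
      using s(3)[of "i * N"] by (simp add: k_def)
    also have "\<dots> \<le> 11 * s + (1 - k * s) * (11 / k + 4 * (1 - a) ^ i)"
      using s(2) by (intro add_left_mono mult_left_mono Suc) (simp add: k_def)
    also have "11 * s = k * s * (11 / k)" using k by simp
    also have "k * s * (11 / k) + (1 - k * s) * (11 / k + 4 * (1 - a) ^ i) = 11 / k + (1 - k * s) * (4 * (1 - a) ^ i)"
      unfolding distrib_left left_diff_distrib by simp
    also have "\<dots> \<le> 11 / k + (1 - a) * (4 * (1 - a) ^ i)"
      using Ks a1 by (intro add_left_mono mult_right_mono mult_nonneg_nonneg zero_le_power) auto
    finally show ?case by simp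
  qed
  have "(1 - a) ^ (K\<^sup>2) \<le> exp (- a) ^ (K\<^sup>2)"
    by (rule power_mono) (use exp_ge_add_one_self[of "- a"] a1 in linarith)+
  also have "\<dots> = exp (- (k / 3960))"
  proof -
    have "exp (- a) ^ (K\<^sup>2) = exp (real (K\<^sup>2) * - a)" by (rule exp_of_nat_mult[symmetric])
    also have "real (K\<^sup>2) * - a = - (k / 3960)"
      using k unfolding a_def k_def of_nat_power power2_eq_square by simp
    finally show ?thesis .
  qed
  \<comment> \<open>Order 1/k is enough here, because the fixed point 11/k already has that
    size.\<close>
  also have "\<dots> \<le> 3960 / k"
  proof -
    have "k / 3960 \<le> exp (k / 3960)" using exp_ge_add_one_self[of "k / 3960"] by linarith
    then show ?thesis using k by (simp add: exp_minus field_simps)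
  qed
  finally have "(1 - a) ^ (K\<^sup>2) \<le> 3960 / k" .
  with bound[of "K\<^sup>2"] have "measure lborel (shadow t (K\<^sup>2 * N)) \<le> 11 / k + 4 * (3960 / k)" by linarith
  also have "\<dots> \<le> 16000 / k" using k by (simp add: divide_right_mono flip: add_divide_distrib)
  finally show ?thesis by (simp add: k_def)
qed

section \<open>The trigonometric product\<close>

definition trinom :: "real \<Rightarrow> real \<Rightarrow> complex" where
  "trinom a b = 1 + cis a + cis b"

definition defect :: "real \<Rightarrow> real \<Rightarrow> real" where
  "defect a b = 9 - (cmod (trinom a b))\<^sup>2"

text \<open>Two independent variables are kept. Along \<open>b = t * a\<close> this is the
  exponential sum over the projected words, while in (a, b) it is periodic and its exponentials are
  orthogonal.\<close>

definition riesz :: "nat \<Rightarrow> real \<Rightarrow> real \<Rightarrow> complex" where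
  "riesz n a b = (\<Prod>k<n. trinom (3 ^ k * a) (3 ^ k * b))"

text \<open>Lagrange's identity for the three unit vectors 1, \<open>cis a\<close>,
  \<open>cis b\<close>. It shows that the defect is small only if all three nearly coincide.\<close>

lemma defect_eq: "defect a b = (cmod (1 - cis a))\<^sup>2 + (cmod (1 - cis b))\<^sup>2 + (cmod (cis a - cis b))\<^sup>2"
proof -
  have *: "(cos a)\<^sup>2 = 1 - (sin a)\<^sup>2" "(cos b)\<^sup>2 = 1 - (sin b)\<^sup>2" by (simp_all add: cos_squared_eq)
  show ?thesis
    unfolding defect_def trinom_def cmod_power2
    by (simp add: power2_eq_square[of "_ + _"] power2_eq_square[of "_ - _"] algebra_simps)
       (use * in \<open>simp add: power2_eq_square\<close>)
qed

lemma defect_nonneg: "0 \<le> defect a b"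
  by (simp add: defect_eq)

lemma cmod_trinom_le: "cmod (trinom a b) \<le> 3"
  using norm_triangle_ineq[of "1 + cis a" "cis b"] norm_triangle_ineq[of 1 "cis a"]
  by (simp add: trinom_def)

lemma defect_le: "defect a b \<le> 9"
  by (simp add: defect_def)

text \<open>On the unit circle the cofactor \<open>A^2 + A*B + B^2\<close> equals
  \<open>A * B * (|A + B|^2 - 1)\<close>. Its modulus factors into \<open>| |A + B| - 1 |\<close>,
  which is at most \<open>|A + B + D|\<close> since D is a unit vector, and
  \<open>|A + B| + 1 <= 3\<close>.\<close>

lemma cmod_cubes_diff_le:
  fixes A B D :: complex
  assumes "cmod A = 1" "cmod B = 1" "cmod D = 1"
  shows "cmod (A ^ 3 - B ^ 3) \<le> 3 * cmod (A - B) * cmod (A + B + D)"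
proof -
  have u: "A * cnj A = 1" "B * cnj B = 1" using assms by (simp_all add: complex_norm_square[symmetric])
  have "A * B * complex_of_real ((cmod (A + B))\<^sup>2 - 1) = A * B * ((A + B) * (cnj A + cnj B) - 1)"
    by (simp only: of_real_diff complex_norm_square complex_cnj_add of_real_1)
  also have "\<dots> = A\<^sup>2 * (B * cnj B) + A * B * (A * cnj A + B * cnj B) + B\<^sup>2 * (A * cnj A) - A * B"
    by (simp add: algebra_simps power2_eq_square)
  also have "\<dots> = A\<^sup>2 + A * B + B\<^sup>2" unfolding u by simp
  finally have "A ^ 3 - B ^ 3 = (A - B) * (A * B * complex_of_real ((cmod (A + B))\<^sup>2 - 1))"
    by (simp add: algebra_simps power2_eq_square power3_eq_cube)
  then have "cmod (A ^ 3 - B ^ 3) = cmod (A - B) * \<bar>(cmod (A + B))\<^sup>2 - 1\<bar>"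
    using assms by (simp only: norm_mult norm_of_real mult_1)
  also have "\<bar>(cmod (A + B))\<^sup>2 - 1\<bar> = \<bar>cmod (A + B) - 1\<bar> * (cmod (A + B) + 1)"
  proof -
    have "(cmod (A + B))\<^sup>2 - 1 = (cmod (A + B) - 1) * (cmod (A + B) + 1)" by (simp add: algebra_simps power2_eq_square)
    then show ?thesis by (simp only: abs_mult) simp
  qed
  also have "cmod (A - B) * (\<bar>cmod (A + B) - 1\<bar> * (cmod (A + B) + 1)) \<le> cmod (A - B) * (cmod (A + B + D) * 3)"
  proof (rule mult_left_mono[OF mult_mono])
    have "\<bar>cmod (A + B) - cmod D\<bar> \<le> cmod (A + B + D)" using norm_triangle_ineq3[of "A + B" "- D"] by simp
    then show "\<bar>cmod (A + B) - 1\<bar> \<le> cmod (A + B + D)" using assms by simp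
    show "cmod (A + B) + 1 \<le> 3" using norm_triangle_ineq[of A B] assms by simp
  qed simp_all
  finally show ?thesis by (simp only: mult_ac)
qed

text \<open>Each side of the triangle formed by 1, \<open>cis a\<close>, \<open>cis b\<close> is
  treated separately, with the third vertex in the role of D. The zeros of \<open>trinom\<close>
  cause no contradiction because the tripled point has defect 0 there.\<close>

lemma defect_triple: "defect (3 * a) (3 * b) \<le> 9 * (cmod (trinom a b))\<^sup>2 * defect a b"
proof -
  have c: "cis (3 * x) = cis x ^ 3" for x using Complex.DeMoivre[of x 3] by simp
  let ?s = "cmod (trinom a b)"
  have "cmod (1 - cis (3 * a)) \<le> 3 * cmod (1 - cis a) * ?s"
    using cmod_cubes_diff_le[of 1 "cis a" "cis b"] by (simp add: c trinom_def)
  moreover have "cmod (1 - cis (3 * b)) \<le> 3 * cmod (1 - cis b) * ?s"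
    using cmod_cubes_diff_le[of 1 "cis b" "cis a"] by (simp add: c trinom_def add_ac)
  moreover have "cmod (cis (3 * a) - cis (3 * b)) \<le> 3 * cmod (cis a - cis b) * ?s"
    using cmod_cubes_diff_le[of "cis a" "cis b" 1] by (simp add: c trinom_def add_ac)
  ultimately have "defect (3 * a) (3 * b) \<le> (3 * cmod (1 - cis a) * ?s)\<^sup>2 + (3 * cmod (1 - cis b) * ?s)\<^sup>2 + (3 * cmod (cis a - cis b) * ?s)\<^sup>2"
    unfolding defect_eq by (intro add_mono power_mono) simp_all
  also have "\<dots> = 9 * ?s\<^sup>2 * defect a b" unfolding defect_eq by (simp add: power_mult_distrib algebra_simps)
  finally show ?thesis .
qed

lemma riesz_0 [simp]: "riesz 0 a b = 1"
  by (simp add: riesz_def)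

lemma riesz_Suc: "riesz (Suc n) a b = riesz n a b * trinom (3 ^ n * a) (3 ^ n * b)"
  by (simp add: riesz_def)

lemma riesz_add: "riesz (p + q) a b = riesz p a b * riesz q (3 ^ p * a) (3 ^ p * b)"
  by (induction q) (simp_all add: riesz_Suc power_add mult_ac)

lemma cmod_riesz_le: "cmod (riesz n a b) \<le> 3 ^ n"
  unfolding riesz_def prod_norm[symmetric]
  using prod_mono[of "{..<n}" "\<lambda>k. cmod (trinom (3 ^ k * a) (3 ^ k * b))" "\<lambda>_. 3"] cmod_trinom_le by simp

lemma riesz_ge_defect: "defect (3 ^ m * a) (3 ^ m * b) \<le> 9 ^ Suc m * (cmod (riesz m a b))\<^sup>2"
proof (induction m)
  case 0
  then show ?case using defect_le by simp
next
  case (Suc m)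
  let ?s = "(cmod (trinom (3 ^ m * a) (3 ^ m * b)))\<^sup>2"
  have "defect (3 ^ Suc m * a) (3 ^ Suc m * b) \<le> 9 * ?s * defect (3 ^ m * a) (3 ^ m * b)"
    using defect_triple[of "3 ^ m * a" "3 ^ m * b"] by (simp add: mult.assoc)
  also have "\<dots> \<le> 9 * ?s * (9 ^ Suc m * (cmod (riesz m a b))\<^sup>2)" by (rule mult_left_mono[OF Suc]) simp
  also have "\<dots> = 9 ^ Suc (Suc m) * (cmod (riesz (Suc m) a b))\<^sup>2"
    by (simp add: riesz_Suc norm_mult power_mult_distrib)
  finally show ?case .
qed

lemma cmod_cis_diff_sq: "(cmod (cis a - cis b))\<^sup>2 = 4 * (sin ((a - b) / 2))\<^sup>2"
proof -
  have "(cmod (cis a - cis b))\<^sup>2 = (cos a - cos b)\<^sup>2 + (sin a - sin b)\<^sup>2"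
    by (simp add: cmod_power2)
  also have "\<dots> = ((sin a)\<^sup>2 + (cos a)\<^sup>2) + ((sin b)\<^sup>2 + (cos b)\<^sup>2) - 2 * (cos a * cos b + sin a * sin b)"
    unfolding power2_diff by algebra
  also have "\<dots> = 2 - 2 * cos (a - b)" by (simp add: cos_diff)
  also have "a - b = 2 * ((a - b) / 2)" by simp
  also have "2 - 2 * cos (2 * ((a - b) / 2)) = 4 * (sin ((a - b) / 2))\<^sup>2" unfolding cos_double_sin by simp
  finally show ?thesis .
qed

lemma cmod_cis_diff_sq_le: "(cmod (cis a - cis b))\<^sup>2 \<le> (a - b)\<^sup>2"
proof -
  have "\<bar>sin ((a - b) / 2)\<bar>\<^sup>2 \<le> \<bar>(a - b) / 2\<bar>\<^sup>2" by (rule power_mono[OF abs_sin_x_le_abs_x]) simp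
  then show ?thesis unfolding cmod_cis_diff_sq by (simp add: power_divide)
qed

lemma defect_slope_le:
  assumes t: "-1 \<le> t" "t \<le> 2"
  shows "defect a (t * a) \<le> 9 * a\<^sup>2"
proof -
  have c: "(cmod (1 - cis x))\<^sup>2 \<le> x\<^sup>2" for x using cmod_cis_diff_sq_le[of 0 x] by simp
  have "defect a (t * a) \<le> a\<^sup>2 + (t * a)\<^sup>2 + (a - t * a)\<^sup>2"
    unfolding defect_eq by (intro add_mono c cmod_cis_diff_sq_le)
  also have "\<dots> = (1 + t\<^sup>2 + (1 - t)\<^sup>2) * a\<^sup>2" by (simp add: power2_eq_square algebra_simps)
  also have "\<dots> \<le> 9 * a\<^sup>2"
  proof (rule mult_right_mono)
    have "0 \<le> (2 + t) * (2 - t)" "0 \<le> (3 - t) * (1 + t)" using t by simp_all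
    then have "t\<^sup>2 \<le> 4" "(1 - t)\<^sup>2 \<le> 4" by (simp_all add: power2_eq_square algebra_simps)
    then show "1 + t\<^sup>2 + (1 - t)\<^sup>2 \<le> 9" by simp
  qed simp
  finally show ?thesis .
qed

text \<open>Up to scale \<open>1/|a|\<close> every factor is close to its maximum 3. The relative
  losses \<open>h k\<close> grow like \<open>9^k * a^2\<close>, hence sum to at most 1/8, and the
  Weierstrass product inequality keeps at least a quarter of \<open>9^p\<close>.\<close>

lemma riesz_ge_near_0:
  assumes t: "-1 \<le> t" "t \<le> 2" and a: "3 ^ p * \<bar>a\<bar> \<le> 1"
  shows "9 ^ p / 4 \<le> (cmod (riesz p a (t * a)))\<^sup>2"
proof -
  define h where "h k = defect (3 ^ k * a) (3 ^ k * (t * a)) / 9" for k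
  have h: "0 \<le> h k" "h k \<le> 9 ^ k * a\<^sup>2" for k
  proof -
    show "0 \<le> h k" by (simp add: h_def defect_nonneg)
    have "(3 ^ k * a)\<^sup>2 = 9 ^ k * a\<^sup>2" by (simp add: power_mult_distrib flip: power_mult) (simp add: power_mult mult.commute[of k])
    then show "h k \<le> 9 ^ k * a\<^sup>2" using defect_slope_le[OF t, of "3 ^ k * a"] by (simp add: h_def mult_ac)
  qed
  have "(3 ^ p * \<bar>a\<bar>)\<^sup>2 \<le> 1" using a by (simp add: abs_square_le_1)
  then have a2: "9 ^ p * a\<^sup>2 \<le> 1" by (simp add: power_mult_distrib flip: power_mult) (simp add: power_mult mult.commute[of p])
  have geo: "(\<Sum>k<p. (9::real) ^ k) = (9 ^ p - 1) / 8" by (induction p) (auto simp: field_simps)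
  have "(\<Sum>k<p. h k) \<le> (\<Sum>k<p. 9 ^ k * a\<^sup>2)" by (intro sum_mono h)
  also have "\<dots> = (9 ^ p * a\<^sup>2 - a\<^sup>2) / 8"
    unfolding sum_distrib_right[symmetric] geo by (simp add: algebra_simps)
  also have "\<dots> \<le> (1 - 0) / 8" using a2 by (intro divide_right_mono diff_mono) auto
  finally have sum: "(\<Sum>k<p. h k) \<le> 1/8" by simp
  have h1: "h k \<le> 1" for k using defect_le by (simp add: h_def)
  have "1 - (\<Sum>k<p. h k) \<le> (\<Prod>k<p. 1 - h k)"
    by (rule Weierstrass_prod_ineq) (use h h1 in auto)
  with sum have "1 / 4 \<le> (\<Prod>k<p. 1 - h k)" by linarith
  then have "9 ^ p * (1 / 4) \<le> 9 ^ p * (\<Prod>k<p. 1 - h k)" by (rule mult_left_mono) simp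
  also have "9 ^ p * (\<Prod>k<p. 1 - h k) = (\<Prod>k<p. 9 * (1 - h k))" unfolding prod.distrib by simp
  also have "\<dots> = (\<Prod>k<p. (cmod (trinom (3 ^ k * a) (3 ^ k * (t * a))))\<^sup>2)"
    by (intro prod.cong refl) (simp add: h_def defect_def diff_divide_distrib)
  also have "\<dots> = (cmod (riesz p a (t * a)))\<^sup>2"
    by (simp add: riesz_def prod_power_distrib flip: prod_norm)
  finally show ?thesis by simp
qed

section \<open>The product as an exponential sum over words\<close>

lemma node_linear: "node t w = node 0 w + t * (node 1 w - node 0 w)"
  by (induction w) (auto simp: digit_def algebra_simps)

text \<open>Choosing one of the three terms in every factor is choosing a word. Its frequency is the
  pair of coefficients of \<open>node t w\<close> as an affine function of t, which are
  integers.\<close>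

lemma riesz_eq_sum_words: "riesz n a b = (\<Sum>w\<in>words n. cis (node 0 w * a + (node 1 w - node 0 w) * b))"
proof (induction n)
  case (Suc n)
  have inj: "inj_on (\<lambda>(d, w). d # w) ({-1, 0, 1} \<times> words n)" by (auto simp: inj_on_def)
  let ?e = "\<lambda>w. cis (node 0 w * a + (node 1 w - node 0 w) * b)"
  have step: "?e (d # w) = cis (3 ^ n * (digit 0 d * a + (digit 1 d - digit 0 d) * b)) * ?e w" if "w \<in> words n" for d w
    using that by (simp add: cis_mult algebra_simps)
  have "(\<Sum>w\<in>words (Suc n). ?e w) = (\<Sum>(d, w)\<in>{-1, 0, 1} \<times> words n. ?e (d # w))"
    unfolding words_Suc by (subst sum.reindex[OF inj]) (simp add: case_prod_beta)
  also have "\<dots> = (\<Sum>d\<in>{-1, 0, 1}. \<Sum>w\<in>words n. cis (3 ^ n * (digit 0 d * a + (digit 1 d - digit 0 d) * b)) * ?e w)"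
    unfolding sum.cartesian_product[symmetric] by (intro sum.cong refl step)
  also have "\<dots> = (\<Sum>d\<in>{-1, 0, 1}. cis (3 ^ n * (digit 0 d * a + (digit 1 d - digit 0 d) * b))) * riesz n a b"
    unfolding Suc sum_product ..
  also have "(\<Sum>d\<in>{-1, 0, 1}. cis (3 ^ n * (digit 0 d * a + (digit 1 d - digit 0 d) * b))) = trinom (3 ^ n * a) (3 ^ n * b)"
    by (simp add: digit_def trinom_def)
  finally show ?case by (simp add: riesz_Suc mult.commute)
qed simp

lemma riesz_slope_eq_sum_words: "riesz n u (t * u) = (\<Sum>w\<in>words n. cis (u * node t w))"
  unfolding riesz_eq_sum_words
proof (intro sum.cong refl)
  fix w show "cis (node 0 w * u + (node 1 w - node 0 w) * (t * u)) = cis (u * node t w)"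
    unfolding node_linear[of t w] by (simp add: algebra_simps)
qed

lemma cmod_sum_cis_sq:
  "(cmod (\<Sum>w\<in>A. cis (f w)))\<^sup>2 = (\<Sum>v\<in>A. \<Sum>w\<in>A. cos (f v - f w))"
proof -
  have "(cmod (\<Sum>w\<in>A. cis (f w)))\<^sup>2 = (\<Sum>w\<in>A. cos (f w))\<^sup>2 + (\<Sum>w\<in>A. sin (f w))\<^sup>2"
    by (simp add: cmod_power2)
  also have "\<dots> = (\<Sum>v\<in>A. \<Sum>w\<in>A. cos (f v - f w))"
    by (simp add: power2_eq_square sum_product sum.distrib[symmetric] cos_diff)
  finally show ?thesis .
qed

lemma node_unit_bounds:
  assumes "0 \<le> t" "t \<le> 1"
  shows "0 \<le> node t w \<and> 2 * node t w < 3 ^ length w"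
proof (induction w)
  case (Cons d w)
  have "0 \<le> digit t d" "digit t d \<le> 1" using assms by (auto simp: digit_def)
  then have "0 \<le> 3 ^ length w * digit t d" "3 ^ length w * digit t d \<le> 3 ^ length w * 1"
    by (simp, intro mult_left_mono, simp_all)
  moreover have "0 \<le> node t w" "2 * node t w < 3 ^ length w" using Cons by simp_all
  ultimately have "0 \<le> 3 ^ length w * digit t d + node t w" "2 * (3 ^ length w * digit t d + node t w) < 3 * 3 ^ length w"
    by (linarith, argo)
  then show ?case by simp
qed simp

text \<open>For t = 0 and t = 1 the node is a base-3 expansion with digits 0 and 1 only, so it
  determines those digits. The two digit patterns together separate -1, 0 and 1. Distinct words
  therefore have distinct frequencies on the torus.\<close>

lemma node_pair_inj:
  assumes "v \<in> words n" "w \<in> words n" "node 0 v = node 0 w" "node 1 v = node 1 w"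
  shows "v = w"
  using assms
proof (induction n arbitrary: v w)
  case (Suc n)
  obtain d v' where v: "v = d # v'" "d \<in> {-1, 0, 1}" "v' \<in> words n" using Suc.prems(1) by (auto simp: words_Suc)
  obtain e w' where w: "w = e # w'" "e \<in> {-1, 0, 1}" "w' \<in> words n" using Suc.prems(2) by (auto simp: words_Suc)
  have dig: "digit t d = digit t e" if t: "t = 0 \<or> t = 1" for t
  proof -
    have eq: "3 ^ n * digit t d + node t v' = 3 ^ n * digit t e + node t w'"
      using Suc.prems(3,4) t v(3) w(3) by (auto simp: v(1) w(1))
    have "\<bar>node t v' - node t w'\<bar> < 3 ^ n"
      using node_unit_bounds[of t v'] node_unit_bounds[of t w'] t v(3) w(3) by auto
    then have "\<bar>3 ^ n * (digit t d - digit t e)\<bar> < 3 ^ n * 1" using eq by (simp add: algebra_simps)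
    then have "\<bar>digit t d - digit t e\<bar> < 1" by (simp only: abs_mult power_abs abs_numeral) simp
    then show ?thesis using t by (auto simp: digit_def split: if_splits)
  qed
  from dig[of 0] dig[of 1] v(2) w(2) have "d = e" by (auto simp: digit_def)
  moreover have "v' = w'"
    using Suc.prems(3,4) v w \<open>d = e\<close> by (intro Suc.IH) auto
  ultimately show ?case by (simp add: v w)
qed simp

section \<open>Mean squares along a fixed slope\<close>

text \<open>The cosine transform of the triangular weight \<open>1 - u / U\<close> on [0, U]. This
  weight is chosen because its transform is nonnegative, which a sharp cutoff would not
  give.\<close>

definition fejer :: "real \<Rightarrow> real \<Rightarrow> real" where
  "fejer U D = (if D = 0 then U / 2 else (1 - cos (U * D)) / (U * D\<^sup>2))"

lemma fejer_has_integral: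
  assumes "0 < U"
  shows "((\<lambda>u. (1 - u / U) * cos (u * D)) has_integral fejer U D) {0..U}"
proof (cases "D = 0")
  case True
  have "((\<lambda>u. 1 - u / U) has_integral (U - U\<^sup>2 / (2 * U)) - (0 - 0\<^sup>2 / (2 * U))) {0..U}"
    by (rule fundamental_theorem_of_calculus)
      (use assms in \<open>auto intro!: derivative_eq_intros simp flip: has_real_derivative_iff_has_vector_derivative\<close>)
  moreover have "U - U\<^sup>2 / (2 * U) = U / 2" using assms by (simp add: power2_eq_square)
  ultimately show ?thesis using True by (simp add: fejer_def)
next
  case False
  define F where "F u = (1 - u / U) * (sin (u * D) / D) - cos (u * D) / (U * D\<^sup>2)" for u
  have "((\<lambda>u. (1 - u / U) * cos (u * D)) has_integral F U - F 0) {0..U}"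
  proof (rule fundamental_theorem_of_calculus)
    fix u
    have "(F has_real_derivative (1 - u / U) * cos (u * D)) (at u within {0..U})"
      unfolding F_def using assms False
      by (auto intro!: derivative_eq_intros simp: field_simps power2_eq_square)
    then show "(F has_vector_derivative (1 - u / U) * cos (u * D)) (at u within {0..U})"
      by (simp add: has_real_derivative_iff_has_vector_derivative)
  qed (use assms in simp)
  moreover have "F U - F 0 = fejer U D"
    using assms False by (simp add: F_def fejer_def diff_divide_distrib)
  ultimately show ?thesis by simp
qed

lemma fejer_nonneg: "0 < U \<Longrightarrow> 0 \<le> fejer U D"
  by (simp add: fejer_def)

lemma fejer_1_le: "fejer 1 D \<le> 1 / 2"
proof (cases "D = 0")
  case False
  have "1 - cos D = 2 * (sin (D / 2))\<^sup>2" using cos_double_sin[of "D / 2"] by simp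
  also have "\<dots> \<le> 2 * \<bar>D / 2\<bar>\<^sup>2"
    using power_mono[OF abs_sin_x_le_abs_x[of "D / 2"], of 2] by simp
  finally show ?thesis using False by (simp add: fejer_def divide_le_eq power_divide)
qed (simp add: fejer_def)

lemma fejer_1_le_inverse_square: "D \<noteq> 0 \<Longrightarrow> fejer 1 D \<le> 2 / D\<^sup>2"
  using cos_ge_minus_one[of D] by (auto simp: fejer_def intro!: divide_right_mono)

abbreviation rho :: "real \<Rightarrow> nat \<Rightarrow> real \<Rightarrow> real" where
  "rho t n u \<equiv> (cmod (riesz n u (t * u)))\<^sup>2"

lemma rho_fejer_integral:
  assumes "0 < U"
  shows "((\<lambda>u. (1 - u / U) * rho t n u) has_integral (\<Sum>v\<in>words n. \<Sum>w\<in>words n. fejer U (node t v - node t w))) {0..U}"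
proof -
  have "(1 - u / U) * rho t n u = (\<Sum>v\<in>words n. \<Sum>w\<in>words n. (1 - u / U) * cos (u * (node t v - node t w)))" for u
    unfolding riesz_slope_eq_sum_words cmod_sum_cis_sq sum_distrib_left right_diff_distrib[of u] ..
  then show ?thesis by (simp only:) (intro has_integral_sum finite_words fejer_has_integral assms)
qed

lemma borel_measurable_riesz [measurable]:
  assumes [measurable]: "f \<in> borel_measurable M" "g \<in> borel_measurable M"
  shows "(\<lambda>x. cmod (riesz n (f x) (g x))) \<in> borel_measurable M"
proof -
  have "continuous_on UNIV (\<lambda>p. cmod (riesz n (fst p) (snd p)))"
    unfolding riesz_def trinom_def by (intro continuous_intros)
  then have "(\<lambda>p. cmod (riesz n (fst p) (snd p))) \<in> borel_measurable borel" by (rule borel_measurable_continuous_onI)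
  from measurable_compose[OF borel_measurable_Pair[OF assms] this] show ?thesis by simp
qed

lemma borel_measurable_defect [measurable]:
  assumes [measurable]: "f \<in> borel_measurable M" "g \<in> borel_measurable M"
  shows "(\<lambda>x. defect (f x) (g x)) \<in> borel_measurable M"
proof -
  have "continuous_on UNIV (\<lambda>p. defect (fst p) (snd p))"
    unfolding defect_def trinom_def by (intro continuous_intros)
  then have "(\<lambda>p. defect (fst p) (snd p)) \<in> borel_measurable borel" by (rule borel_measurable_continuous_onI)
  from measurable_compose[OF borel_measurable_Pair[OF assms] this] show ?thesis by simp
qed

text \<open>By nonnegativity of the kernel all off-diagonal pairs may be dropped; each of the
  \<open>3^n\<close> diagonal ones gives U/2.\<close>

lemma rho_integral_ge:
  assumes "0 < U"
  shows "ennreal (3 ^ n * U / 2) \<le> (\<integral>\<^sup>+u\<in>{0..U}. rho t n u \<partial>lborel)"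
proof -
  have "3 ^ n * U / 2 = (\<Sum>v\<in>words n. fejer U 0)" by (simp add: fejer_def)
  also have "\<dots> \<le> (\<Sum>v\<in>words n. \<Sum>w\<in>words n. fejer U (node t v - node t w))"
  proof (rule sum_mono)
    fix v assume "v \<in> words n"
    then show "fejer U 0 \<le> (\<Sum>w\<in>words n. fejer U (node t v - node t w))"
      using member_le_sum[of v "words n" "\<lambda>w. fejer U (node t v - node t w)"] fejer_nonneg[OF assms] by simp
  qed
  finally have "ennreal (3 ^ n * U / 2) \<le> ennreal (\<Sum>v\<in>words n. \<Sum>w\<in>words n. fejer U (node t v - node t w))"
    by (rule ennreal_leI)
  also have "\<dots> = (\<integral>\<^sup>+u. ennreal ((1 - u / U) * rho t n u) * indicator {0..U} u \<partial>lborel)"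
    by (rule nn_integral_has_integral_lebesgue'[OF _ rho_fejer_integral[OF assms], symmetric]) (use assms in auto)
  also have "\<dots> \<le> (\<integral>\<^sup>+u\<in>{0..U}. rho t n u \<partial>lborel)"
    by (intro nn_integral_mono) (use assms in \<open>auto simp: indicator_def intro!: ennreal_leI mult_left_le_one_le\<close>)
  finally show ?thesis .
qed

lemma sum_inverse_square_like_le:
  fixes S :: "int set"
  assumes "finite S"
  shows "(\<Sum>k\<in>S. if k \<in> {-1, 0} then 1 / 2 else if 0 < k then 2 / (of_int k)\<^sup>2 else 2 / (of_int k + 1)\<^sup>2) \<le> (24::real)"
    (is "sum ?psi S \<le> _")
proof -
  \<comment> \<open>The summand is dominated by the increments of a bounded monotone function, so the sum telescopes.\<close>
  define F :: "real \<Rightarrow> real" where "F x = 12 * (x / (1 + \<bar>x\<bar>))" for x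
  have F_minus: "F (- x) = - F x" for x by (simp add: F_def)
  have step: "?psi k \<le> F (of_int k + 1) - F (of_int k)" for k :: int
  proof -
    have pos: "2 / x\<^sup>2 \<le> 12 * ((x + 1) / (1 + \<bar>x + 1\<bar>)) - 12 * (x / (1 + \<bar>x\<bar>))" if "1 \<le> x" for x :: real
    proof -
      have "12 * ((x + 1) / (1 + \<bar>x + 1\<bar>)) - 12 * (x / (1 + \<bar>x\<bar>)) = 12 / ((x + 1) * (x + 2))"
        using that by (simp add: divide_simps) (simp add: algebra_simps)
      moreover have "2 / x\<^sup>2 \<le> 12 / ((x + 1) * (x + 2))"
      proof -
        have "0 \<le> (x - 1) * (10 * x + 4)" using that by simp
        then have "2 * ((x + 1) * (x + 2)) \<le> 12 * x\<^sup>2" by (simp add: algebra_simps power2_eq_square)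
        moreover have "0 < x\<^sup>2" "0 < (x + 1) * (x + 2)" using that by auto
        ultimately show ?thesis by (subst divide_le_eq, subst times_divide_eq_left, subst le_divide_eq) simp
      qed
      ultimately show ?thesis by simp
    qed
    consider "k = 0" | "k = -1" | "1 \<le> k" | "k \<le> -2" by linarith
    then show ?thesis
    proof cases
      case 3
      then show ?thesis using pos[of "of_int k"] by (simp add: F_def)
    next
      case 4
      have "1 \<le> - (of_int k + 1 :: real)" using 4 by linarith
      from pos[OF this] have "2 / (of_int k + 1)\<^sup>2 \<le> F (- (of_int k)) - F (- (of_int k + 1))"
        unfolding power2_minus by (simp add: F_def)
      also have "\<dots> = F (of_int k + 1) - F (of_int k)" unfolding F_minus by simp
      finally show ?thesis using 4 by simp
    qed (auto simp: F_def)
  qed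
  have Fb: "\<bar>F x\<bar> \<le> 12" for x by (simp add: F_def abs_mult divide_le_eq)
  obtain M :: nat where M: "S \<subseteq> (\<lambda>i. int i - int M) ` {..<2 * M}"
  proof -
    obtain M where "\<forall>n\<in>(\<lambda>k. nat \<bar>k\<bar>) ` S. n < M"
      using finite_nat_set_iff_bounded[of "(\<lambda>k. nat \<bar>k\<bar>) ` S"] assms by blast
    then have M: "\<bar>k\<bar> < int M" if "k \<in> S" for k using that by (simp add: nat_less_iff)
    have "S \<subseteq> (\<lambda>i. int i - int M) ` {..<2 * M}"
    proof
      fix k assume "k \<in> S"
      from M[OF this] show "k \<in> (\<lambda>i. int i - int M) ` {..<2 * M}"
        by (intro image_eqI[of _ _ "nat (k + int M)"]) auto
    qed
    then show ?thesis by (rule that)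
  qed
  have "sum ?psi S \<le> sum ?psi ((\<lambda>i. int i - int M) ` {..<2 * M})"
    by (rule sum_mono2[OF _ M]) auto
  also have "\<dots> = (\<Sum>i<2 * M. ?psi (int i - int M))"
    by (rule sum.reindex_cong[of "\<lambda>i. int i - int M"]) (auto simp: inj_on_def)
  also have "\<dots> \<le> (\<Sum>i<2 * M. F (of_int (int i - int M) + 1) - F (of_int (int i - int M)))"
    by (intro sum_mono step)
  also have "\<dots> = (\<Sum>i<2 * M. F (real (Suc i) - real M) - F (real i - real M))"
    by (intro sum.cong) (auto simp: algebra_simps)
  also have "\<dots> = F (real (2 * M) - real M) - F (real 0 - real M)"
    by (rule sum_lessThan_telescope)
  also have "\<dots> \<le> 24" using Fb[of "real (2 * M) - real M"] Fb[of "real 0 - real M"] by linarith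
  finally show ?thesis .
qed

text \<open>Pairs are sorted by the floor k of their difference. Each class is a set of close pairs
  up to a shift, hence has at most 4 times the energy many elements, and the kernel decays like an
  inverse square. For negative k the difference closest to 0 is near k + 1, which explains the
  asymmetric summand. The constant is 96 = 4 * 24.\<close>

lemma sum_fejer_le_energy:
  "(\<Sum>v\<in>words n. \<Sum>w\<in>words n. fejer 1 (node t v - node t w)) \<le> 96 * real (energy t n)"
proof -
  let ?P = "words n \<times> words n"
  let ?D = "\<lambda>p. node t (fst p) - node t (snd p)"
  let ?psi = "\<lambda>k::int. if k \<in> {-1, 0} then 1 / 2 else if 0 < k then 2 / (of_int k)\<^sup>2 else 2 / (of_int k + 1)\<^sup>2 :: real"
  let ?S = "(\<lambda>p. \<lfloor>?D p\<rfloor>) ` ?P"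
  have psi: "fejer 1 D \<le> ?psi \<lfloor>D\<rfloor>" for D
  proof -
    consider "\<lfloor>D\<rfloor> = -1 \<or> \<lfloor>D\<rfloor> = 0" | "1 \<le> \<lfloor>D\<rfloor>" | "\<lfloor>D\<rfloor> \<le> -2" by linarith
    then show ?thesis
    proof cases
      case 1
      then show ?thesis using fejer_1_le by auto
    next
      case 2
      have "of_int \<lfloor>D\<rfloor> \<le> D" "1 \<le> (of_int \<lfloor>D\<rfloor> :: real)" using 2 by linarith+
      then have "2 / D\<^sup>2 \<le> 2 / (of_int \<lfloor>D\<rfloor>)\<^sup>2"
        by (intro divide_left_mono power_mono mult_pos_pos zero_less_power) linarith+
      moreover have "D \<noteq> 0" using 2 by (intro notI) simp
      ultimately have "fejer 1 D \<le> 2 / (of_int \<lfloor>D\<rfloor>)\<^sup>2"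
        using fejer_1_le_inverse_square[of D] by linarith
      moreover have n: "(\<lfloor>D\<rfloor> \<in> {-1, 0}) = False" "(0 < \<lfloor>D\<rfloor>) = True"
        using 2 unfolding insert_iff empty_iff by presburger+
      ultimately show ?thesis by (simp only: n if_True if_False)
    next
      case 3
      have "D \<le> of_int \<lfloor>D\<rfloor> + 1" "of_int \<lfloor>D\<rfloor> + 1 \<le> (-1 :: real)" using 3 by linarith+
      then have "(- (of_int \<lfloor>D\<rfloor> + 1))\<^sup>2 \<le> (- D)\<^sup>2" "0 < (- (of_int \<lfloor>D\<rfloor> + 1 :: real))\<^sup>2"
        by (intro power_mono zero_less_power; linarith)+
      then have "(of_int \<lfloor>D\<rfloor> + 1)\<^sup>2 \<le> D\<^sup>2" "0 < (of_int \<lfloor>D\<rfloor> + 1 :: real)\<^sup>2"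
        unfolding power2_minus by -
      then have "2 / D\<^sup>2 \<le> 2 / (of_int \<lfloor>D\<rfloor> + 1)\<^sup>2" by (intro divide_left_mono mult_pos_pos) auto
      moreover have "D \<noteq> 0" using 3 by (intro notI) simp
      ultimately have "fejer 1 D \<le> 2 / (of_int \<lfloor>D\<rfloor> + 1)\<^sup>2"
        using fejer_1_le_inverse_square[of D] by linarith
      moreover have n: "(\<lfloor>D\<rfloor> \<in> {-1, 0}) = False" "(0 < \<lfloor>D\<rfloor>) = False"
        using 3 unfolding insert_iff empty_iff by presburger+
      ultimately show ?thesis by (simp only: n if_False)
    qed
  qed
  have cnt: "card {p \<in> ?P. \<lfloor>?D p\<rfloor> = k} \<le> 4 * energy t n" for k
  proof -
    have "card {p \<in> ?P. \<lfloor>?D p\<rfloor> = k} \<le> card {(v, w) \<in> words n \<times> words n. \<bar>node t v - node t w - (of_int k + 1 / 2)\<bar> < 1}"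
    proof (rule card_mono)
      show "{p \<in> ?P. \<lfloor>?D p\<rfloor> = k} \<subseteq> {(v, w) \<in> words n \<times> words n. \<bar>node t v - node t w - (of_int k + 1 / 2)\<bar> < 1}"
      proof safe
        fix v w show "\<bar>node t v - node t w - (of_int \<lfloor>?D (v, w)\<rfloor> + 1 / 2)\<bar> < 1"
          unfolding fst_conv snd_conv by linarith
      qed
      show "finite {(v, w) \<in> words n \<times> words n. \<bar>node t v - node t w - (of_int k + 1 / 2)\<bar> < 1}"
        by (rule finite_subset[of _ ?P]) auto
    qed
    also have "\<dots> \<le> 4 * energy t n" unfolding energy_def by (rule card_near_pairs_shift_le) simp
    finally show ?thesis .
  qed
  have "(\<Sum>v\<in>words n. \<Sum>w\<in>words n. fejer 1 (node t v - node t w)) = (\<Sum>p\<in>?P. fejer 1 (?D p))"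
    by (simp add: sum.cartesian_product case_prod_beta)
  also have "\<dots> \<le> (\<Sum>p\<in>?P. ?psi \<lfloor>?D p\<rfloor>)" by (intro sum_mono psi)
  also have "\<dots> = (\<Sum>k\<in>?S. \<Sum>p\<in>{p \<in> ?P. \<lfloor>?D p\<rfloor> = k}. ?psi \<lfloor>?D p\<rfloor>)"
    by (rule sum.image_gen) simp
  also have "\<dots> = (\<Sum>k\<in>?S. real (card {p \<in> ?P. \<lfloor>?D p\<rfloor> = k}) * ?psi k)"
  proof (rule sum.cong[OF refl])
    fix k
    have "(\<Sum>p\<in>{p \<in> ?P. \<lfloor>?D p\<rfloor> = k}. ?psi \<lfloor>?D p\<rfloor>) = (\<Sum>p\<in>{p \<in> ?P. \<lfloor>?D p\<rfloor> = k}. ?psi k)"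
      by (rule sum.cong) auto
    then show "(\<Sum>p\<in>{p \<in> ?P. \<lfloor>?D p\<rfloor> = k}. ?psi \<lfloor>?D p\<rfloor>) = real (card {p \<in> ?P. \<lfloor>?D p\<rfloor> = k}) * ?psi k"
      by (simp only: sum_constant)
  qed
  also have "\<dots> \<le> (\<Sum>k\<in>?S. real (4 * energy t n) * ?psi k)"
    by (intro sum_mono mult_right_mono of_nat_mono cnt) auto
  also have "\<dots> = real (4 * energy t n) * (\<Sum>k\<in>?S. ?psi k)" by (rule sum_distrib_left[symmetric])
  also have "\<dots> \<le> real (4 * energy t n) * 24"
    by (intro mult_left_mono sum_inverse_square_like_le) auto
  finally show ?thesis by simp
qed

text \<open>On [0, 1/2] the triangular weight with U = 1 is at least 1/2, which costs a factor
  2.\<close>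

lemma rho_integral_le_energy:
  "(\<integral>\<^sup>+x\<in>{0..1/2}. rho t n x \<partial>lborel) \<le> ennreal (192 * real (energy t n))"
proof -
  have "(\<integral>\<^sup>+x\<in>{0..1/2}. rho t n x \<partial>lborel) \<le> (\<integral>\<^sup>+x. 2 * (ennreal ((1 - x / 1) * rho t n x) * indicator {0..1} x) \<partial>lborel)"
  proof (rule nn_integral_mono)
    fix x :: real
    show "ennreal (rho t n x) * indicator {0..1/2} x \<le> 2 * (ennreal ((1 - x / 1) * rho t n x) * indicator {0..1} x)"
    proof (cases "x \<in> {0..1/2}")
      case True
      then have "1 * rho t n x \<le> (2 * (1 - x)) * rho t n x" by (intro mult_right_mono) auto
      then have "ennreal (rho t n x) \<le> ennreal (2 * ((1 - x) * rho t n x))" by (intro ennreal_leI) (simp only: mult_1 mult.assoc)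
      also have "\<dots> = 2 * ennreal ((1 - x) * rho t n x)" using True by (subst ennreal_mult) auto
      finally show ?thesis using True by (simp add: indicator_def)
    qed simp
  qed
  also have "\<dots> = 2 * (\<integral>\<^sup>+x. ennreal ((1 - x / 1) * rho t n x) * indicator {0..1} x \<partial>lborel)"
    by (rule nn_integral_cmult) measurable
  also have "\<dots> = 2 * ennreal (\<Sum>v\<in>words n. \<Sum>w\<in>words n. fejer 1 (node t v - node t w))"
    by (subst nn_integral_has_integral_lebesgue'[OF _ rho_fejer_integral]) auto
  also have "\<dots> \<le> 2 * ennreal (96 * real (energy t n))"
    by (intro mult_left_mono ennreal_leI sum_fejer_le_energy) simp
  also have "\<dots> = ennreal (192 * real (energy t n))"
    by (subst (1) ennreal_numeral[symmetric], subst ennreal_mult[symmetric]) auto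
  finally show ?thesis .
qed

section \<open>Mass in frequency blocks\<close>

text \<open>With \<open>u = 3^d * x\<close> the product of length d + l splits into its first d
  factors, whose square is at least \<open>9^d / 4\<close> near 0, and the product of length l at u.
  The Jacobian \<open>3^d\<close> against \<open>4 / 9^d\<close> leaves
  \<open>4 / 3^d\<close>.\<close>

lemma rho_integral_low_level:
  assumes t: "-1 \<le> t" "t \<le> 2"
  shows "(\<integral>\<^sup>+u\<in>{0..1/2}. rho t l u \<partial>lborel) \<le> ennreal (4 / 3 ^ d) * (\<integral>\<^sup>+x\<in>{0..1/2}. rho t (d + l) x \<partial>lborel)"
proof -
  let ?f = "\<lambda>u. ennreal (rho t l u) * indicator {0..1/2} u"
  have "?f \<in> borel_measurable borel" by measurable
  then have eq: "(\<integral>\<^sup>+u\<in>{0..1/2}. rho t l u \<partial>lborel) =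
      ennreal \<bar>3 ^ d\<bar> * (\<integral>\<^sup>+x. ennreal (rho t l (0 + 3 ^ d * x)) * indicator {0..1/2} (0 + 3 ^ d * x) \<partial>lborel)"
    by (rule nn_integral_real_affine) simp
  have "(\<integral>\<^sup>+x. ennreal (rho t l (0 + 3 ^ d * x)) * indicator {0..1/2} (0 + 3 ^ d * x) \<partial>lborel)
      \<le> (\<integral>\<^sup>+x. ennreal (4 / 9 ^ d) * (ennreal (rho t (d + l) x) * indicator {0..1/2} x) \<partial>lborel)"
  proof (rule nn_integral_mono)
    fix x :: real
    show "ennreal (rho t l (0 + 3 ^ d * x)) * indicator {0..1/2} (0 + 3 ^ d * x)
        \<le> ennreal (4 / 9 ^ d) * (ennreal (rho t (d + l) x) * indicator {0..1/2} x)"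
    proof (cases "3 ^ d * x \<in> {0..1/2}")
      case True
      then have x: "0 \<le> x" "3 ^ d * x \<le> 1 / 2" using mult_le_cancel_left_pos[of "3 ^ d" 0 x] by simp_all
      have "1 * x \<le> 3 ^ d * x" by (rule mult_right_mono) (use x in auto)
      then have x2: "x \<le> 1 / 2" using x by simp
      have "9 ^ d / 4 \<le> rho t d x" by (rule riesz_ge_near_0[OF t]) (use x in auto)
      then have "9 ^ d / 4 * rho t l (3 ^ d * x) \<le> rho t d x * rho t l (3 ^ d * x)" by (rule mult_right_mono) simp
      also have "\<dots> = rho t (d + l) x" by (simp add: riesz_add norm_mult power_mult_distrib mult_ac)
      finally have "4 / 9 ^ d * (9 ^ d / 4 * rho t l (3 ^ d * x)) \<le> 4 / 9 ^ d * rho t (d + l) x"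
        by (rule mult_left_mono) simp
      then have "rho t l (3 ^ d * x) \<le> 4 / 9 ^ d * rho t (d + l) x" by simp
      then have "ennreal (rho t l (3 ^ d * x)) \<le> ennreal (4 / 9 ^ d * rho t (d + l) x)" by (rule ennreal_leI)
      also have "\<dots> = ennreal (4 / 9 ^ d) * ennreal (rho t (d + l) x)" by (rule ennreal_mult) simp_all
      finally have "ennreal (rho t l (3 ^ d * x)) \<le> ennreal (4 / 9 ^ d) * ennreal (rho t (d + l) x)" .
      then show ?thesis using True x x2 by (simp add: indicator_def)
    qed simp
  qed
  also have "\<dots> = ennreal (4 / 9 ^ d) * (\<integral>\<^sup>+x\<in>{0..1/2}. rho t (d + l) x \<partial>lborel)"
    by (rule nn_integral_cmult) measurable
  finally have le: "(\<integral>\<^sup>+x. ennreal (rho t l (0 + 3 ^ d * x)) * indicator {0..1/2} (0 + 3 ^ d * x) \<partial>lborel)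
      \<le> ennreal (4 / 9 ^ d) * (\<integral>\<^sup>+x\<in>{0..1/2}. rho t (d + l) x \<partial>lborel)" .
  have "ennreal \<bar>3 ^ d\<bar> * (ennreal (4 / 9 ^ d) * (\<integral>\<^sup>+x\<in>{0..1/2}. rho t (d + l) x \<partial>lborel))
      = ennreal (3 ^ d * (4 / 9 ^ d)) * (\<integral>\<^sup>+x\<in>{0..1/2}. rho t (d + l) x \<partial>lborel)"
    by (subst ennreal_mult) (auto simp: mult.assoc)
  also have "(3::real) ^ d * (4 / 9 ^ d) = 4 / 3 ^ d"
  proof -
    have "(9::real) ^ d = 3 ^ d * 3 ^ d" by (simp flip: power_mult_distrib)
    then show ?thesis by simp
  qed
  finally show ?thesis using mult_left_mono[OF le, of "ennreal \<bar>3 ^ d\<bar>"] unfolding eq by simp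
qed

text \<open>With \<open>u = 3^(p + m) * x\<close> the product splits into three parts. The first p
  factors are near their maximum since \<open>3^p * x <= 1\<close>, the next m are bounded below by
  the defect at u, and the last l form the product at u. The prefactor collects
  \<open>9^p / 4\<close>, \<open>1 / 9^(m + 1)\<close> and the Jacobian.\<close>

lemma rho_block_ge:
  assumes t: "-1 \<le> t" "t \<le> 2" and U: "U \<le> 3 ^ m"
  shows "ennreal (3 ^ (p + m) / (36 * 81 ^ m)) * (\<integral>\<^sup>+u\<in>{1/2<..U}. defect u (t * u) * rho t l u \<partial>lborel)
    \<le> (\<integral>\<^sup>+x\<in>{1/2 / 3 ^ (p + m)<..U / 3 ^ (p + m)}. rho t (p + m + l) x \<partial>lborel)"
proof -
  define c :: real where "c = 3 ^ (p + m)"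
  have c: "0 < c" by (simp add: c_def)
  let ?f = "\<lambda>u. ennreal (defect u (t * u) * rho t l u) * indicator {1/2<..U} u"
  have "(\<integral>\<^sup>+u. ?f u \<partial>lborel) = ennreal \<bar>c\<bar> * (\<integral>\<^sup>+x. ?f (0 + c * x) \<partial>lborel)"
    by (rule nn_integral_real_affine) (measurable, use c in simp)
  then have "ennreal (c / (36 * 81 ^ m)) * (\<integral>\<^sup>+u. ?f u \<partial>lborel) = ennreal (c\<^sup>2 / (36 * 81 ^ m)) * (\<integral>\<^sup>+x. ?f (0 + c * x) \<partial>lborel)"
    using c by (simp add: mult.assoc[symmetric] power2_eq_square flip: ennreal_mult)
  also have "\<dots> = (\<integral>\<^sup>+x. ennreal (c\<^sup>2 / (36 * 81 ^ m)) * ?f (0 + c * x) \<partial>lborel)"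
    by (rule nn_integral_cmult[symmetric]) measurable
  also have "\<dots> \<le> (\<integral>\<^sup>+x\<in>{1/2 / c<..U / c}. rho t (p + m + l) x \<partial>lborel)"
  proof (rule nn_integral_mono)
    fix x :: real
    show "ennreal (c\<^sup>2 / (36 * 81 ^ m)) * ?f (0 + c * x) \<le> ennreal (rho t (p + m + l) x) * indicator {1/2 / c<..U / c} x"
    proof (cases "c * x \<in> {1/2<..U}")
      case True
      then have mem: "x \<in> {1/2 / c<..U / c}" using c by (auto simp: field_simps)
      have "0 \<le> x" using zero_less_mult_pos[OF _ c, of x] True by simp
      have cc: "c = 3 ^ m * 3 ^ p" by (simp add: c_def power_add)
      have "c * x \<le> 3 ^ m" using True U by simp
      then have "3 ^ m * (3 ^ p * x) \<le> 3 ^ m * 1" by (simp only: cc mult.assoc mult_1_right)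
      then have "3 ^ p * x \<le> 1" by (rule mult_left_le_imp_le) simp
      then have "3 ^ p * \<bar>x\<bar> \<le> 1" using \<open>0 \<le> x\<close> by simp
      note A = riesz_ge_near_0[OF t this]
      have B: "defect (c * x) (t * (c * x)) / 9 ^ Suc m \<le> (cmod (riesz m (3 ^ p * x) (3 ^ p * (t * x))))\<^sup>2"
        using riesz_ge_defect[of m "3 ^ p * x" "3 ^ p * (t * x)"] by (simp add: cc field_simps)
      have "c\<^sup>2 / (36 * 81 ^ m) * (defect (c * x) (t * (c * x)) * rho t l (c * x))
        = (9 ^ p / 4) * (defect (c * x) (t * (c * x)) / 9 ^ Suc m) * rho t l (c * x)"
      proof -
        have "c\<^sup>2 = 9 ^ p * 9 ^ m" unfolding cc power_mult_distrib power_mult[symmetric] by (simp add: power_mult mult.commute[of _ 2])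
        moreover have "(81::real) ^ m = 9 ^ m * 9 ^ m" by (simp flip: power_mult_distrib)
        ultimately show ?thesis by (simp add: field_simps)
      qed
      also have "\<dots> \<le> rho t p x * (cmod (riesz m (3 ^ p * x) (3 ^ p * (t * x))))\<^sup>2 * rho t l (c * x)"
        by (intro mult_right_mono mult_mono A B) (auto simp: defect_nonneg)
      also have "\<dots> = rho t (p + m + l) x"
        by (simp add: riesz_add norm_mult power_mult_distrib c_def mult_ac)
      finally have "ennreal (c\<^sup>2 / (36 * 81 ^ m) * (defect (c * x) (t * (c * x)) * rho t l (c * x))) \<le> ennreal (rho t (p + m + l) x)"
        by (rule ennreal_leI)
      then show ?thesis using True mem by (simp add: indicator_def defect_nonneg flip: ennreal_mult)
    qed simp
  qed
  finally show ?thesis by (simp add: c_def)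
qed

text \<open>The condition \<open>U <= 3^m / 2\<close> makes the frequency interval of block i end no
  later than that of block i - 1 begins. The intervals are open on the left, hence disjoint, and
  their union lies in [0, 1/2], where the mass is controlled by the energy.\<close>

lemma sum_rho_blocks_le_energy:
  assumes t: "-1 \<le> t" "t \<le> 2" and U: "0 < U" "U \<le> 3 ^ m / 2" and I: "(I + 1) * m \<le> N"
  shows "(\<Sum>i<I. ennreal (3 ^ (i * m + m) / (36 * 81 ^ m)) * (\<integral>\<^sup>+u\<in>{1/2<..U}. defect u (t * u) * rho t (N - (i * m + m)) u \<partial>lborel))
    \<le> ennreal (192 * real (energy t N))"
proof -
  let ?A = "\<lambda>i. {1/2 / 3 ^ (i * m + m)<..U / 3 ^ (i * m + m)} :: real set"
  have U3: "U \<le> 3 ^ m" using U by linarith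
  have upper: "U / 3 ^ (i * m + m) \<le> 1/2 / 3 ^ (i * m)" for i
    using U(2) by (simp add: power_add field_simps)
  have disj: "?A i \<inter> ?A j = {}" if "i < j" for i j
  proof -
    have "(3::real) ^ (i * m + m) \<le> 3 ^ (j * m)"
    proof (rule power_increasing)
      have "Suc i * m \<le> j * m" using that by (intro mult_right_mono) auto
      then show "i * m + m \<le> j * m" by simp
    qed simp
    then have "1/2 / 3 ^ (j * m) \<le> (1/2 / 3 ^ (i * m + m) :: real)" by (intro divide_left_mono) auto
    then show ?thesis using upper[of j] by auto
  qed
  have disjf: "disjoint_family_on ?A {..<I}"
    unfolding disjoint_family_on_def using disj by (metis inf_commute linorder_neqE_nat)
  have sub: "(\<Union>i<I. ?A i) \<subseteq> {0..1/2}"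
  proof
    fix x assume "x \<in> (\<Union>i<I. ?A i)"
    then obtain i where "1/2 / 3 ^ (i * m + m) < x" "x \<le> U / 3 ^ (i * m + m)" by auto
    moreover have "1/2 / 3 ^ (i * m) \<le> (1/2 :: real)" "0 \<le> (1/2 / 3 ^ (i * m + m) :: real)" by (auto simp: divide_le_eq)
    ultimately have "0 \<le> x" "x \<le> 1/2" using upper[of i] by linarith+
    then show "x \<in> {0..1/2}" by simp
  qed
  have "(\<Sum>i<I. ennreal (3 ^ (i * m + m) / (36 * 81 ^ m)) * (\<integral>\<^sup>+u\<in>{1/2<..U}. defect u (t * u) * rho t (N - (i * m + m)) u \<partial>lborel))
    \<le> (\<Sum>i<I. \<integral>\<^sup>+x\<in>?A i. rho t N x \<partial>lborel)"
  proof (rule sum_mono)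
    fix i assume "i \<in> {..<I}"
    then have "Suc i * m \<le> (I + 1) * m" by (intro mult_right_mono) auto
    then have "Suc i * m \<le> N" using I by (rule order.trans)
    then have "i * m + m + (N - (i * m + m)) = N" by simp
    then show "ennreal (3 ^ (i * m + m) / (36 * 81 ^ m)) * (\<integral>\<^sup>+u\<in>{1/2<..U}. defect u (t * u) * rho t (N - (i * m + m)) u \<partial>lborel)
        \<le> (\<integral>\<^sup>+x\<in>?A i. rho t N x \<partial>lborel)"
      using rho_block_ge[OF t U3, of "i * m" "N - (i * m + m)"] by simp
  qed
  also have "\<dots> = (\<integral>\<^sup>+x. (\<Sum>i<I. ennreal (rho t N x) * indicator (?A i) x) \<partial>lborel)"
    by (rule nn_integral_sum[symmetric]) measurable
  also have "\<dots> = (\<integral>\<^sup>+x\<in>(\<Union>i<I. ?A i). rho t N x \<partial>lborel)"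
    by (intro nn_integral_cong) (simp only: indicator_UN_disjoint[OF finite_lessThan disjf] sum_distrib_left)
  also have "\<dots> \<le> (\<integral>\<^sup>+x\<in>{0..1/2}. rho t N x \<partial>lborel)"
    by (intro nn_integral_mono mult_left_mono indicator_leI subsetD[OF sub]; (assumption | simp))
  also have "\<dots> \<le> ennreal (192 * real (energy t N))" by (rule rho_integral_le_energy)
  finally show ?thesis .
qed

text \<open>Of the total \<open>3^l * U / 2\<close> on [0, U], the part below 1/2 is at most
  \<open>1536 * K * 3^l\<close> with 1536 = 4 * 192 * 2. The choice 6144 = 4 * 1536 makes this at
  most half of the total.\<close>

lemma rho_integral_high_ge:
  fixes K :: real
  assumes t: "-1 \<le> t" "t \<le> 2" and e: "real (energy t N) \<le> 2 * K * 3 ^ N" and "l \<le> N"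
    and U: "6144 * K \<le> U" "1 \<le> U" and K: "0 \<le> K"
  shows "ennreal (3 ^ l * U / 4) \<le> (\<integral>\<^sup>+u\<in>{1/2<..U}. rho t l u \<partial>lborel)"
proof -
  have "(\<integral>\<^sup>+u\<in>{0..1/2}. rho t l u \<partial>lborel) \<le> ennreal (4 / 3 ^ (N - l)) * (\<integral>\<^sup>+x\<in>{0..1/2}. rho t (N - l + l) x \<partial>lborel)"
    by (rule rho_integral_low_level[OF t])
  also have "\<dots> \<le> ennreal (4 / 3 ^ (N - l)) * ennreal (192 * real (energy t N))"
    using rho_integral_le_energy[of N t] \<open>l \<le> N\<close> by (intro mult_left_mono) auto
  also have "\<dots> \<le> ennreal (4 / 3 ^ (N - l)) * ennreal (192 * (2 * K * 3 ^ N))"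
    using e by (intro mult_left_mono ennreal_leI) auto
  also have "\<dots> = ennreal (1536 * K * 3 ^ l)"
    using \<open>l \<le> N\<close> K by (subst ennreal_mult[symmetric]) (auto simp: power_diff)
  also have "\<dots> \<le> ennreal (3 ^ l * U / 4)"
  proof (rule ennreal_leI)
    have "(1536 * K) * 3 ^ l \<le> (U / 4) * 3 ^ l" by (rule mult_right_mono) (use U in auto)
    then show "1536 * K * 3 ^ l \<le> 3 ^ l * U / 4" by (simp add: mult_ac)
  qed
  finally have low: "(\<integral>\<^sup>+u\<in>{0..1/2}. rho t l u \<partial>lborel) \<le> ennreal (3 ^ l * U / 4)" .
  have "ennreal (3 ^ l * U / 4) + ennreal (3 ^ l * U / 4) = ennreal (3 ^ l * U / 2)"
    using U by (subst ennreal_plus[symmetric]) auto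
  also have "\<dots> \<le> (\<integral>\<^sup>+u\<in>{0..U}. rho t l u \<partial>lborel)" by (rule rho_integral_ge) (use U in auto)
  also have "\<dots> = (\<integral>\<^sup>+u. ennreal (rho t l u) * indicator {0..1/2} u + ennreal (rho t l u) * indicator {1/2<..U} u \<partial>lborel)"
    by (intro nn_integral_cong) (use U in \<open>auto simp: indicator_def\<close>)
  also have "\<dots> = (\<integral>\<^sup>+u\<in>{0..1/2}. rho t l u \<partial>lborel) + (\<integral>\<^sup>+u\<in>{1/2<..U}. rho t l u \<partial>lborel)"
    by (rule nn_integral_add) measurable
  also have "\<dots> \<le> ennreal (3 ^ l * U / 4) + (\<integral>\<^sup>+u\<in>{1/2<..U}. rho t l u \<partial>lborel)"
    by (rule add_right_mono[OF low])
  finally show ?thesis unfolding ennreal_add_left_cancel_le by simp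
qed

section \<open>Averaging over the slopes\<close>

lemma nn_integral_scale:
  fixes f :: "real \<Rightarrow> ennreal"
  assumes [measurable]: "f \<in> borel_measurable borel" and c: "0 < c"
  shows "(\<integral>\<^sup>+x. f (c * x) \<partial>lborel) = ennreal (1 / c) * (\<integral>\<^sup>+x. f x \<partial>lborel)"
proof -
  have eq: "(\<integral>\<^sup>+x. f x \<partial>lborel) = ennreal \<bar>c\<bar> * (\<integral>\<^sup>+x. f (0 + c * x) \<partial>lborel)"
    by (rule nn_integral_real_affine) (use c in auto)
  have "ennreal (1 / c) * ennreal \<bar>c\<bar> = 1" using c by (simp flip: ennreal_mult)
  then show ?thesis unfolding eq by (simp add: mult.assoc[symmetric])
qed

lemma nn_integral_periodic_le:
  fixes h :: "real \<Rightarrow> ennreal"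
  assumes [measurable]: "h \<in> borel_measurable borel" and per: "\<And>x. h (x + 2 * pi) = h x" and ab: "a \<le> b"
  shows "(\<integral>\<^sup>+x\<in>{a..b}. h x \<partial>lborel) \<le> ennreal ((b - a) / (2 * pi) + 2) * (\<integral>\<^sup>+x\<in>{-pi..pi}. h x \<partial>lborel)"
proof -
  let ?I = "\<integral>\<^sup>+x\<in>{-pi..pi}. h x \<partial>lborel"
  have per_nat: "h (x + real n * (2 * pi)) = h x" for x n
  proof (induction n)
    case (Suc n)
    have "h (x + real (Suc n) * (2 * pi)) = h ((x + real n * (2 * pi)) + 2 * pi)" by (simp add: algebra_simps)
    then show ?case using per Suc by simp
  qed simp
  have per_int: "h (of_int k * (2 * pi) + x) = h x" for x k
  proof (cases "0 \<le> k")
    case True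
    then show ?thesis using per_nat[of x "nat k"] by (simp add: add.commute)
  next
    case False
    then show ?thesis using per_nat[of "of_int k * (2 * pi) + x" "nat (- k)"] by simp
  qed
  define k0 where "k0 = \<lfloor>(a + pi) / (2 * pi)\<rfloor>"
  define k1 where "k1 = \<lfloor>(b + pi) / (2 * pi)\<rfloor>"
  let ?J = "\<lambda>k::int. {of_int k * (2 * pi) - pi..of_int k * (2 * pi) + pi}"
  have cell: "(\<integral>\<^sup>+x\<in>?J k. h x \<partial>lborel) = ?I" for k
  proof -
    let ?f = "\<lambda>x. h x * indicator (?J k) x"
    have "?f \<in> borel_measurable borel" by measurable
    then have "(\<integral>\<^sup>+x. ?f x \<partial>lborel) = ennreal \<bar>1\<bar> * (\<integral>\<^sup>+x. ?f (of_int k * (2 * pi) + 1 * x) \<partial>lborel)"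
      by (rule nn_integral_real_affine) simp
    also have "\<dots> = (\<integral>\<^sup>+x. ?f (of_int k * (2 * pi) + 1 * x) \<partial>lborel)" by simp
    also have "\<dots> = ?I" by (intro nn_integral_cong) (auto simp: per_int indicator_def)
    finally show ?thesis .
  qed
  have cover: "h x * indicator {a..b} x \<le> (\<Sum>k\<in>{k0..k1}. h x * indicator (?J k) x)" for x
  proof (cases "x \<in> {a..b}")
    case True
    define k where "k = \<lfloor>(x + pi) / (2 * pi)\<rfloor>"
    have "k0 \<le> k" "k \<le> k1"
      unfolding k0_def k1_def k_def using True by (auto intro!: floor_mono divide_right_mono)
    have "of_int k \<le> (x + pi) / (2 * pi)" "(x + pi) / (2 * pi) < of_int k + 1" unfolding k_def by linarith+
    then have "of_int k * (2 * pi) \<le> x + pi" "x + pi < (of_int k + 1) * (2 * pi)"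
      by (simp_all add: pos_le_divide_eq pos_divide_less_eq)
    then have "x \<in> ?J k" by (simp add: algebra_simps)
    then have "h x * indicator {a..b} x = h x * indicator (?J k) x" using True by (simp add: indicator_def)
    also have "\<dots> \<le> (\<Sum>k\<in>{k0..k1}. h x * indicator (?J k) x)"
      by (rule member_le_sum[where f = "\<lambda>k. h x * indicator (?J k) x"]) (use \<open>k0 \<le> k\<close> \<open>k \<le> k1\<close> in auto)
    finally show ?thesis .
  qed simp
  have "(\<integral>\<^sup>+x\<in>{a..b}. h x \<partial>lborel) \<le> (\<integral>\<^sup>+x. (\<Sum>k\<in>{k0..k1}. h x * indicator (?J k) x) \<partial>lborel)"
    by (rule nn_integral_mono[OF cover])
  also have "\<dots> = (\<Sum>k\<in>{k0..k1}. \<integral>\<^sup>+x\<in>?J k. h x \<partial>lborel)" by (rule nn_integral_sum) measurable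
  also have "\<dots> = of_nat (card {k0..k1}) * ?I" unfolding cell by simp
  also have "\<dots> \<le> ennreal ((b - a) / (2 * pi) + 2) * ?I"
  proof (rule mult_right_mono)
    have "k0 \<le> k1" unfolding k0_def k1_def using ab by (intro floor_mono divide_right_mono) auto
    then have "real (card {k0..k1}) = of_int (k1 - k0 + 1)" by simp
    also have "\<dots> \<le> (b + pi) / (2 * pi) - ((a + pi) / (2 * pi) - 1) + 1"
      unfolding k0_def k1_def by linarith
    also have "\<dots> = (b - a) / (2 * pi) + 2" by (simp add: diff_divide_distrib add_divide_distrib)
    finally show "(of_nat (card {k0..k1}) :: ennreal) \<le> ennreal ((b - a) / (2 * pi) + 2)"
      unfolding ennreal_of_nat_eq_real_of_nat by (rule ennreal_leI)
  qed simp
  finally show ?thesis .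
qed

text \<open>For fixed u the substitution \<open>v = t * u\<close> turns the slopes into an interval
  of length \<open>3 * u\<close>. It meets at most \<open>3 * u / (2 * pi) + 2\<close> periods, and
  division by the Jacobian u leaves a bounded factor because u stays above 1/2. A second count of
  periods in u gives the factor U.\<close>

lemma slope_integral_le:
  fixes f :: "real \<Rightarrow> real \<Rightarrow> ennreal"
  assumes f[measurable]: "case_prod f \<in> borel_measurable (borel \<Otimes>\<^sub>M borel)"
    and per1: "\<And>a b. f (a + 2 * pi) b = f a b" and per2: "\<And>a b. f a (b + 2 * pi) = f a b"
    and U: "3 \<le> U"
  shows "(\<integral>\<^sup>+t\<in>{-1..2}. (\<integral>\<^sup>+u\<in>{1/2<..U}. f u (t * u) \<partial>lborel) \<partial>lborel)
    \<le> ennreal (5 * U) * (\<integral>\<^sup>+a\<in>{-pi..pi}. (\<integral>\<^sup>+b\<in>{-pi..pi}. f a b \<partial>lborel) \<partial>lborel)"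
proof -
  define Phi where "Phi a = (\<integral>\<^sup>+b\<in>{-pi..pi}. f a b \<partial>lborel)" for a
  have f1[measurable]: "(\<lambda>b. f a b) \<in> borel_measurable borel" for a by measurable
  have Phi[measurable]: "Phi \<in> borel_measurable borel" unfolding Phi_def by measurable
  have Phiper: "Phi (a + 2 * pi) = Phi a" for a unfolding Phi_def per1 ..
  have inner: "(\<integral>\<^sup>+t. f u (t * u) * indicator {-1..2} t \<partial>lborel) \<le> 5 * Phi u" if u: "1/2 < u" for u
  proof -
    let ?g = "\<lambda>v. f u v * indicator {-u..2 * u} v"
    have gm: "?g \<in> borel_measurable borel" by measurable
    have "(\<integral>\<^sup>+t. f u (t * u) * indicator {-1..2} t \<partial>lborel) = (\<integral>\<^sup>+t. ?g (u * t) \<partial>lborel)"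
    proof (rule nn_integral_cong)
      fix t
      have "- u \<le> u * t \<longleftrightarrow> -1 \<le> t" "u * t \<le> 2 * u \<longleftrightarrow> t \<le> 2"
        using mult_le_cancel_left_pos[of u "-1" t] mult_le_cancel_left_pos[of u t 2] u by (simp_all add: mult.commute)
      then show "f u (t * u) * indicator {-1..2} t = ?g (u * t)"
        by (simp add: indicator_def mult.commute)
    qed
    also have "\<dots> = ennreal (1 / u) * (\<integral>\<^sup>+v. ?g v \<partial>lborel)" by (rule nn_integral_scale[OF gm]) (use u in simp)
    also have "\<dots> \<le> ennreal (1 / u) * (ennreal ((2 * u - - u) / (2 * pi) + 2) * Phi u)"
      unfolding Phi_def by (intro mult_left_mono nn_integral_periodic_le per2 f1) (use u in auto)
    also have "\<dots> = ennreal (1 / u * ((2 * u - - u) / (2 * pi) + 2)) * Phi u"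
      using u by (subst ennreal_mult) (auto simp: mult.assoc)
    also have "\<dots> \<le> ennreal 5 * Phi u"
    proof (intro mult_right_mono ennreal_leI)
      have "1 / u * ((2 * u - - u) / (2 * pi) + 2) = 3 / (2 * pi) + 2 / u" using u by (simp add: field_simps)
      also have "\<dots> \<le> 1 + 4" using u pi_gt3 by (intro add_mono) (auto simp: field_simps)
      finally show "1 / u * ((2 * u - - u) / (2 * pi) + 2) \<le> 5" by simp
    qed simp
    finally show ?thesis by simp
  qed
  have m: "(\<lambda>(t, u). f u (t * u) * indicator {1/2<..U} u * indicator {-1..2} t) \<in> borel_measurable (lborel \<Otimes>\<^sub>M lborel)"
    by measurable
  have "(\<integral>\<^sup>+t\<in>{-1..2}. (\<integral>\<^sup>+u\<in>{1/2<..U}. f u (t * u) \<partial>lborel) \<partial>lborel)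
      = (\<integral>\<^sup>+t. (\<integral>\<^sup>+u. f u (t * u) * indicator {1/2<..U} u * indicator {-1..2} t \<partial>lborel) \<partial>lborel)"
    by (intro nn_integral_cong nn_integral_multc[symmetric]) measurable
  also have "\<dots> = (\<integral>\<^sup>+u. (\<integral>\<^sup>+t. f u (t * u) * indicator {1/2<..U} u * indicator {-1..2} t \<partial>lborel) \<partial>lborel)"
    by (rule lborel_pair.Fubini'[OF m, symmetric])
  also have "\<dots> \<le> (\<integral>\<^sup>+u. 5 * (Phi u * indicator {1/2..U} u) \<partial>lborel)"
  proof (rule nn_integral_mono)
    fix u :: real
    show "(\<integral>\<^sup>+t. f u (t * u) * indicator {1/2<..U} u * indicator {-1..2} t \<partial>lborel) \<le> 5 * (Phi u * indicator {1/2..U} u)"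
      using inner[of u] by (cases "u \<in> {1/2<..U}") (simp_all add: indicator_def)
  qed
  also have "\<dots> = 5 * (\<integral>\<^sup>+u\<in>{1/2..U}. Phi u \<partial>lborel)" by (rule nn_integral_cmult) measurable
  also have "\<dots> \<le> 5 * (ennreal ((U - 1/2) / (2 * pi) + 2) * (\<integral>\<^sup>+a\<in>{-pi..pi}. Phi a \<partial>lborel))"
    by (intro mult_left_mono nn_integral_periodic_le Phi Phiper) (use U in auto)
  also have "\<dots> \<le> 5 * (ennreal U * (\<integral>\<^sup>+a\<in>{-pi..pi}. Phi a \<partial>lborel))"
  proof (intro mult_left_mono mult_right_mono ennreal_leI)
    have "(U - 1/2) / (2 * pi) \<le> U / 6" using U pi_gt3 by (intro frac_le) auto
    then show "(U - 1/2) / (2 * pi) + 2 \<le> U" using U by linarith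
  qed auto
  also have "\<dots> = ennreal (5 * U) * (\<integral>\<^sup>+a\<in>{-pi..pi}. Phi a \<partial>lborel)"
    using U by (subst ennreal_mult) (auto simp: mult.assoc)
  finally show ?thesis unfolding Phi_def .
qed

section \<open>Orthogonality on the torus\<close>

lemma cos_linear_has_integral:
  assumes "k \<in> \<int>"
  shows "((\<lambda>b. cos (c + k * b)) has_integral (if k = 0 then 2 * pi * cos c else 0)) {-pi..pi}"
proof (cases "k = 0")
  case True
  then show ?thesis using has_integral_const_real[of "cos c" "-pi" pi] by simp
next
  case False
  obtain i :: int where i: "k = of_int i" using assms by (auto elim: Ints_cases)
  define F where "F b = sin (c + k * b) / k" for b
  have "((\<lambda>b. cos (c + k * b)) has_integral F pi - F (-pi)) {-pi..pi}"
  proof (rule fundamental_theorem_of_calculus)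
    fix b
    have "(F has_real_derivative cos (c + k * b)) (at b within {-pi..pi})"
      unfolding F_def using False by (auto intro!: derivative_eq_intros)
    then show "(F has_vector_derivative cos (c + k * b)) (at b within {-pi..pi})"
      by (simp add: has_real_derivative_iff_has_vector_derivative)
  qed simp
  moreover have "F pi - F (-pi) = 0"
    using sin_npi_int[of i] by (simp add: F_def i sin_add sin_diff mult.commute)
  ultimately show ?thesis using False by simp
qed

lemma node_Ints: "t \<in> \<int> \<Longrightarrow> node t w \<in> \<int>"
  by (induction w) (auto simp: digit_def)

lemma riesz_torus_integral:
  "(\<integral>\<^sup>+a\<in>{-pi..pi}. (\<integral>\<^sup>+b\<in>{-pi..pi}. (cmod (riesz n a b))\<^sup>2 \<partial>lborel) \<partial>lborel) = ennreal (4 * pi\<^sup>2 * 3 ^ n)"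
proof -
  define p where "p v w = node 0 v - node 0 w" for v w
  define q where "q v w = node 1 v - node 0 v - (node 1 w - node 0 w)" for v w
  have int: "p v w \<in> \<int>" "q v w \<in> \<int>" for v w by (auto simp: p_def q_def intro!: Ints_diff node_Ints)
  have sq: "(cmod (riesz n a b))\<^sup>2 = (\<Sum>v\<in>words n. \<Sum>w\<in>words n. cos (p v w * a + q v w * b))" for a b
    unfolding riesz_eq_sum_words cmod_sum_cis_sq by (intro sum.cong refl arg_cong[of _ _ cos]) (simp add: p_def q_def algebra_simps)
  define g where "g a = (\<Sum>v\<in>words n. \<Sum>w\<in>words n. if q v w = 0 then 2 * pi * cos (p v w * a) else 0)" for a
  have ib: "((\<lambda>b. (cmod (riesz n a b))\<^sup>2) has_integral g a) {-pi..pi}" for a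
    unfolding sq g_def by (intro has_integral_sum finite_words cos_linear_has_integral int)
  have g0: "0 \<le> g a" for a by (rule has_integral_nonneg[OF ib]) simp
  have ia: "(g has_integral (\<Sum>v\<in>words n. \<Sum>w\<in>words n. if q v w = 0 \<and> p v w = 0 then 4 * pi\<^sup>2 else 0)) {-pi..pi}"
    unfolding g_def
  proof (intro has_integral_sum finite_words)
    fix v w
    show "((\<lambda>a. if q v w = 0 then 2 * pi * cos (p v w * a) else 0) has_integral (if q v w = 0 \<and> p v w = 0 then 4 * pi\<^sup>2 else 0)) {-pi..pi}"
    proof (cases "q v w = 0")
      case True
      have "((\<lambda>a. 2 * pi * cos (0 + p v w * a)) has_integral 2 * pi * (if p v w = 0 then 2 * pi * cos 0 else 0)) {-pi..pi}"
        by (intro has_integral_mult_right cos_linear_has_integral int)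
      then show ?thesis using True by (cases "p v w = 0") (simp_all add: power2_eq_square)
    qed simp
  qed
  have "(\<Sum>v\<in>words n. \<Sum>w\<in>words n. if q v w = 0 \<and> p v w = 0 then 4 * pi\<^sup>2 else 0) = (\<Sum>v\<in>words n. \<Sum>w\<in>words n. if w = v then 4 * pi\<^sup>2 else 0)"
  proof (intro sum.cong refl)
    fix v w assume "v \<in> words n" "w \<in> words n"
    then show "(if q v w = 0 \<and> p v w = 0 then 4 * pi\<^sup>2 else 0) = (if w = v then 4 * pi\<^sup>2 else 0)"
      using node_pair_inj[of v n w] by (auto simp: p_def q_def)
  qed
  also have "\<dots> = 4 * pi\<^sup>2 * 3 ^ n" by (simp add: sum.delta)
  finally have sum: "(\<Sum>v\<in>words n. \<Sum>w\<in>words n. if q v w = 0 \<and> p v w = 0 then 4 * pi\<^sup>2 else 0) = 4 * pi\<^sup>2 * 3 ^ n" .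
  have inner: "(\<integral>\<^sup>+b\<in>{-pi..pi}. (cmod (riesz n a b))\<^sup>2 \<partial>lborel) = ennreal (g a)" for a
    by (rule nn_integral_has_integral_lebesgue'[OF _ ib]) simp
  show ?thesis unfolding inner
    by (rule nn_integral_has_integral_lebesgue'[OF g0 ia[unfolded sum]])
qed

lemma sin_ge_half:
  assumes "0 \<le> y" "y \<le> pi / 2"
  shows "y / 2 \<le> sin y"
proof -
  have "\<bar>sin y - (\<Sum>m<3. sin_coeff m * y ^ m)\<bar> \<le> inverse (fact 3) * \<bar>y\<bar> ^ 3" by (rule Maclaurin_sin_bound)
  then have "\<bar>sin y - y\<bar> \<le> y ^ 3 / 6"
    using assms by (simp add: sin_coeff_def eval_nat_numeral fact_numeral)
  then have "y - y ^ 3 / 6 \<le> sin y" by linarith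
  moreover have "y ^ 3 \<le> 3 * y"
  proof -
    have "pi \<le> 3.2" using pi_approx(2) by simp
    then have "y \<le> 1.7" using assms by linarith
    then have "y * y \<le> 1.7 * 1.7" using assms by (intro mult_mono) auto
    then have "(y * y) * y \<le> 3 * y" using assms by (intro mult_right_mono) auto
    then show ?thesis by (simp add: power3_eq_cube)
  qed
  ultimately show ?thesis by linarith
qed

lemma abs_le_of_cmod_cis_small:
  assumes "\<bar>a\<bar> \<le> pi" "(cmod (1 - cis a))\<^sup>2 < 1 / 9 ^ q"
  shows "3 ^ q * \<bar>a\<bar> \<le> pi"
proof -
  have "(\<bar>a\<bar> / 2)\<^sup>2 \<le> (2 * sin (\<bar>a\<bar> / 2))\<^sup>2" using sin_ge_half[of "\<bar>a\<bar> / 2"] assms(1) by (intro power_mono) auto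
  also have "\<dots> = (cmod (1 - cis a))\<^sup>2"
    using cmod_cis_diff_sq[of 0 a] by (simp add: power_mult_distrib abs_if)
  also have "\<dots> < 1 / 9 ^ q" by fact
  also have "\<dots> = (1 / 3 ^ q)\<^sup>2"
    unfolding power_divide power_one power_mult[symmetric] by (simp add: power_mult mult.commute[of q])
  finally have "\<bar>a\<bar> / 2 < 1 / 3 ^ q" by (rule power_less_imp_less_base) simp
  then have "3 ^ q * \<bar>a\<bar> < 2" by (simp add: field_simps)
  then show ?thesis using pi_gt3 by linarith
qed

text \<open>In the square the only lattice point is the origin, and small defect forces
  \<open>3^q * |a|\<close> and \<open>3^q * |b|\<close> below pi. There the first q factors are
  bounded trivially by \<open>3^q\<close>, and the others form the product of length l - q at the
  rescaled point, which runs within one period square. The loss \<open>9^q\<close> and the area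
  factor \<open>9^-q\<close> cancel, so the mass is smaller than that of the whole torus by about
  \<open>3^-q\<close>.\<close>

lemma riesz_torus_integral_near_lattice:
  assumes "q \<le> l"
  shows "(\<integral>\<^sup>+a\<in>{-pi..pi}. (\<integral>\<^sup>+b\<in>{-pi..pi}. ennreal ((cmod (riesz l a b))\<^sup>2) * indicator {p. defect (fst p) (snd p) < 1 / 9 ^ q} (a, b) \<partial>lborel) \<partial>lborel)
    \<le> ennreal (40 * 3 ^ (l - q))"
proof -
  define c :: real where "c = 3 ^ q"
  have c: "0 < c" by (simp add: c_def)
  define G where "G a b = ennreal ((cmod (riesz (l - q) a b))\<^sup>2) * indicator {-pi..pi} b * indicator {-pi..pi} a" for a b
  have G[measurable]: "(\<lambda>x. G (f x) (g x)) \<in> borel_measurable M" if [measurable]: "f \<in> borel_measurable M" "g \<in> borel_measurable M" for f g M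
    unfolding G_def by measurable
  define H where "H a = (\<integral>\<^sup>+b. G a b \<partial>lborel)" for a
  have H[measurable]: "H \<in> borel_measurable borel" unfolding H_def by measurable
  have Hint: "(\<integral>\<^sup>+a. H a \<partial>lborel) = ennreal (4 * pi\<^sup>2 * 3 ^ (l - q))"
  proof -
    have "(\<integral>\<^sup>+a. H a \<partial>lborel) = (\<integral>\<^sup>+a\<in>{-pi..pi}. (\<integral>\<^sup>+b\<in>{-pi..pi}. (cmod (riesz (l - q) a b))\<^sup>2 \<partial>lborel) \<partial>lborel)"
      unfolding H_def G_def by (intro nn_integral_cong nn_integral_multc) measurable
    then show ?thesis unfolding riesz_torus_integral .
  qed
  have pt: "ennreal ((cmod (riesz l a b))\<^sup>2) * indicator {p. defect (fst p) (snd p) < 1 / 9 ^ q} (a, b) * indicator {-pi..pi} b * indicator {-pi..pi} a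
      \<le> ennreal (9 ^ q) * G (c * a) (c * b)" for a b
  proof (cases "defect a b < 1 / 9 ^ q \<and> a \<in> {-pi..pi} \<and> b \<in> {-pi..pi}")
    case True
    have "(cmod (1 - cis a))\<^sup>2 < 1 / 9 ^ q" "(cmod (1 - cis b))\<^sup>2 < 1 / 9 ^ q"
      using True unfolding defect_eq by (smt (verit) zero_le_power2)+
    then have "c * \<bar>a\<bar> \<le> pi" "c * \<bar>b\<bar> \<le> pi"
      unfolding c_def using True by (intro abs_le_of_cmod_cis_small; auto)+
    then have "\<bar>c * a\<bar> \<le> pi" "\<bar>c * b\<bar> \<le> pi" using c by (simp_all add: abs_mult)
    then have mem: "c * a \<in> {-pi..pi}" "c * b \<in> {-pi..pi}" by (auto simp: abs_le_iff)
    have "riesz l a b = riesz q a b * riesz (l - q) (c * a) (c * b)"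
      using riesz_add[of q "l - q" a b] assms by (simp add: c_def)
    then have "(cmod (riesz l a b))\<^sup>2 = (cmod (riesz q a b))\<^sup>2 * (cmod (riesz (l - q) (c * a) (c * b)))\<^sup>2"
      by (simp add: norm_mult power_mult_distrib)
    also have "\<dots> \<le> 9 ^ q * (cmod (riesz (l - q) (c * a) (c * b)))\<^sup>2"
    proof (rule mult_right_mono)
      have "(cmod (riesz q a b))\<^sup>2 \<le> (3 ^ q)\<^sup>2" by (rule power_mono[OF cmod_riesz_le]) simp
      also have "(3 ^ q)\<^sup>2 = (9::real) ^ q" unfolding power_mult[symmetric] by (simp add: power_mult mult.commute[of q])
      finally show "(cmod (riesz q a b))\<^sup>2 \<le> 9 ^ q" .
    qed simp
    finally have "ennreal ((cmod (riesz l a b))\<^sup>2) \<le> ennreal (9 ^ q) * ennreal ((cmod (riesz (l - q) (c * a) (c * b)))\<^sup>2)"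
      by (simp add: ennreal_leI flip: ennreal_mult)
    then show ?thesis using True mem by (simp add: G_def indicator_def)
  qed (auto simp: indicator_def)
  have "(\<integral>\<^sup>+a\<in>{-pi..pi}. (\<integral>\<^sup>+b\<in>{-pi..pi}. ennreal ((cmod (riesz l a b))\<^sup>2) * indicator {p. defect (fst p) (snd p) < 1 / 9 ^ q} (a, b) \<partial>lborel) \<partial>lborel)
    = (\<integral>\<^sup>+a. (\<integral>\<^sup>+b. ennreal ((cmod (riesz l a b))\<^sup>2) * indicator {p. defect (fst p) (snd p) < 1 / 9 ^ q} (a, b) * indicator {-pi..pi} b * indicator {-pi..pi} a \<partial>lborel) \<partial>lborel)"
    by (intro nn_integral_cong nn_integral_multc[symmetric]) measurable
  also have "\<dots> \<le> (\<integral>\<^sup>+a. (\<integral>\<^sup>+b. ennreal (9 ^ q) * G (c * a) (c * b) \<partial>lborel) \<partial>lborel)"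
    by (intro nn_integral_mono pt)
  also have "\<dots> = (\<integral>\<^sup>+a. ennreal (9 ^ q) * (ennreal (1 / c) * H (c * a)) \<partial>lborel)"
  proof (rule nn_integral_cong)
    fix a
    have "(\<integral>\<^sup>+b. ennreal (9 ^ q) * G (c * a) (c * b) \<partial>lborel) = ennreal (9 ^ q) * (\<integral>\<^sup>+b. G (c * a) (c * b) \<partial>lborel)"
      by (rule nn_integral_cmult) measurable
    also have "(\<integral>\<^sup>+b. G (c * a) (c * b) \<partial>lborel) = ennreal (1 / c) * H (c * a)"
      unfolding H_def by (rule nn_integral_scale[OF _ c]) measurable
    finally show "(\<integral>\<^sup>+b. ennreal (9 ^ q) * G (c * a) (c * b) \<partial>lborel) = ennreal (9 ^ q) * (ennreal (1 / c) * H (c * a))" .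
  qed
  also have "\<dots> = (\<integral>\<^sup>+a. ennreal (9 ^ q * (1 / c)) * H (c * a) \<partial>lborel)"
    using c by (subst ennreal_mult) (auto simp: mult.assoc)
  also have "\<dots> = ennreal (9 ^ q * (1 / c)) * (\<integral>\<^sup>+a. H (c * a) \<partial>lborel)"
    by (rule nn_integral_cmult) measurable
  also have "\<dots> = ennreal (9 ^ q * (1 / c)) * (ennreal (1 / c) * ennreal (4 * pi\<^sup>2 * 3 ^ (l - q)))"
    unfolding nn_integral_scale[OF H c] Hint ..
  also have "\<dots> = ennreal (9 ^ q * (1 / c) * (1 / c * (4 * pi\<^sup>2 * 3 ^ (l - q))))"
    using c by (simp flip: ennreal_mult)
  also have "9 ^ q * (1 / c) * (1 / c * (4 * pi\<^sup>2 * 3 ^ (l - q))) = 4 * pi\<^sup>2 * 3 ^ (l - q)"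
  proof -
    have "(9::real) ^ q = c * c" by (simp add: c_def flip: power_mult_distrib)
    then show ?thesis using c by simp
  qed
  also have "ennreal (4 * pi\<^sup>2 * 3 ^ (l - q)) \<le> ennreal (40 * 3 ^ (l - q))"
  proof (intro ennreal_leI mult_right_mono)
    have "pi * pi \<le> 3.15 * 3.15" using pi_approx(2) by (intro mult_mono) auto
    then show "4 * pi\<^sup>2 \<le> 40" by (simp add: power2_eq_square)
  qed simp
  finally show ?thesis .
qed

lemma slope_integral_near_lattice:
  assumes "q \<le> l" and U: "3 \<le> U"
  shows "(\<integral>\<^sup>+t\<in>{-1..2}. (\<integral>\<^sup>+u\<in>{1/2<..U}. ennreal (rho t l u) * indicator {p. defect (fst p) (snd p) < 1 / 9 ^ q} (u, t * u) \<partial>lborel) \<partial>lborel)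
    \<le> ennreal (200 * U * 3 ^ (l - q))"
proof -
  define f where "f a b = ennreal ((cmod (riesz l a b))\<^sup>2) * indicator {p. defect (fst p) (snd p) < 1 / 9 ^ q} (a, b)" for a b
  have cis_per: "cis (of_nat k * (2 * pi) + x) = cis x" for k x
    by (induction k) (simp_all add: cis_mult[symmetric] distrib_right)
  have tper: "trinom (3 ^ k * (a + 2 * pi)) b = trinom (3 ^ k * a) b" "trinom b (3 ^ k * (a + 2 * pi)) = trinom b (3 ^ k * a)" for k a b
    using cis_per[of "3 ^ k" "3 ^ k * a"] by (simp_all add: trinom_def algebra_simps)
  have "(\<integral>\<^sup>+t\<in>{-1..2}. (\<integral>\<^sup>+u\<in>{1/2<..U}. f u (t * u) \<partial>lborel) \<partial>lborel)
    \<le> ennreal (5 * U) * (\<integral>\<^sup>+a\<in>{-pi..pi}. (\<integral>\<^sup>+b\<in>{-pi..pi}. f a b \<partial>lborel) \<partial>lborel)"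
  proof (rule slope_integral_le[OF _ _ _ U])
    show "case_prod f \<in> borel_measurable (borel \<Otimes>\<^sub>M borel)" unfolding f_def by measurable
    show "f (a + 2 * pi) b = f a b" for a b
      using tper(1)[of 0] by (simp add: f_def riesz_def defect_def tper indicator_def)
    show "f a (b + 2 * pi) = f a b" for a b
      using tper(2)[of _ 0] by (simp add: f_def riesz_def defect_def tper indicator_def)
  qed
  also have "\<dots> \<le> ennreal (5 * U) * ennreal (40 * 3 ^ (l - q))"
    unfolding f_def by (intro mult_left_mono riesz_torus_integral_near_lattice assms) simp
  also have "\<dots> = ennreal (200 * U * 3 ^ (l - q))" using U by (simp flip: ennreal_mult)
  finally show ?thesis unfolding f_def .
qed

section \<open>Slopes of small energy\<close>

lemma borel_measurable_node [measurable]: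
  assumes [measurable]: "f \<in> borel_measurable M"
  shows "(\<lambda>x. node (f x) w) \<in> borel_measurable M"
  by (subst node_linear) measurable

text \<open>The slopes at which the counting function of the projected words stays bounded by about K
  in mean square.\<close>

definition flat_slopes :: "nat \<Rightarrow> nat \<Rightarrow> real set" where
  "flat_slopes K N = {t \<in> {-1..2}. real (energy t N) \<le> 2 * real K * 3 ^ N}"

lemma borel_measurable_energy [measurable]: "(\<lambda>t. real (energy t N)) \<in> borel_measurable borel"
proof -
  have "real (energy t N) = (\<Sum>p\<in>words N \<times> words N. if \<bar>node t (fst p) - node t (snd p)\<bar> < 1 then 1 else 0)" for t
  proof -
    have "{(v, w) \<in> words N \<times> words N. \<bar>node t v - node t w\<bar> < 1} = (words N \<times> words N) \<inter> {p. \<bar>node t (fst p) - node t (snd p)\<bar> < 1}"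
      by auto
    then show ?thesis unfolding energy_def by (simp add: sum.If_cases)
  qed
  then show ?thesis by simp
qed

lemma flat_slopes_sets [measurable, simp]: "flat_slopes K N \<in> sets borel"
  unfolding flat_slopes_def by measurable

lemma emeasure_flat_slopes_le: "emeasure lborel (flat_slopes K N) \<le> 3"
proof -
  have "emeasure lborel (flat_slopes K N) \<le> emeasure lborel {-1..2::real}"
    by (rule emeasure_mono) (auto simp: flat_slopes_def)
  then show ?thesis by simp
qed

text \<open>Where the defect is at least \<open>9^-m\<close> it may be inserted at the cost of
  \<open>9^m\<close>. The remaining frequencies are near the lattice and contribute little after
  integration over all slopes. The constant 12288 = 2 * 6144 makes \<open>U = 3^m / 2\<close>
  admissible for the lower bound on the high frequencies.\<close>

lemma block_lower_bound:
  assumes mK: "12288 * real K \<le> 3 ^ m" "1 \<le> K" and l: "m \<le> l" "l \<le> N"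
  defines "U \<equiv> 3 ^ m / 2 :: real"
  shows "ennreal (3 ^ l * U / 4) * emeasure lborel (flat_slopes K N)
    \<le> ennreal (9 ^ m) * (\<integral>\<^sup>+t\<in>flat_slopes K N. (\<integral>\<^sup>+u\<in>{1/2<..U}. defect u (t * u) * rho t l u \<partial>lborel) \<partial>lborel)
      + ennreal (200 * U * 3 ^ (l - m))"
proof -
  let ?T = "flat_slopes K N"
  have U: "6144 * real K \<le> U" "3 \<le> U" using mK by (auto simp: U_def)
  define B where "B t = (\<integral>\<^sup>+u\<in>{1/2<..U}. defect u (t * u) * rho t l u \<partial>lborel)" for t
  define D where "D t = (\<integral>\<^sup>+u\<in>{1/2<..U}. ennreal (rho t l u) * indicator {p. defect (fst p) (snd p) < 1 / 9 ^ m} (u, t * u) \<partial>lborel)" for t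
  have B[measurable]: "B \<in> borel_measurable borel" unfolding B_def by measurable
  have D[measurable]: "D \<in> borel_measurable borel" unfolding D_def by measurable
  have split: "ennreal (3 ^ l * U / 4) \<le> ennreal (9 ^ m) * B t + D t" if "t \<in> ?T" for t
  proof -
    have t: "-1 \<le> t" "t \<le> 2" "real (energy t N) \<le> 2 * real K * 3 ^ N" using that by (auto simp: flat_slopes_def)
    have "ennreal (3 ^ l * U / 4) \<le> (\<integral>\<^sup>+u\<in>{1/2<..U}. rho t l u \<partial>lborel)"
      by (rule rho_integral_high_ge[OF t l(2) U(1)]) (use U in auto)
    also have "\<dots> \<le> (\<integral>\<^sup>+u. ennreal (9 ^ m) * (ennreal (defect u (t * u) * rho t l u) * indicator {1/2<..U} u)
        + ennreal (rho t l u) * indicator {p. defect (fst p) (snd p) < 1 / 9 ^ m} (u, t * u) * indicator {1/2<..U} u \<partial>lborel)"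
    proof (rule nn_integral_mono)
      fix u
      show "ennreal (rho t l u) * indicator {1/2<..U} u \<le> ennreal (9 ^ m) * (ennreal (defect u (t * u) * rho t l u) * indicator {1/2<..U} u)
        + ennreal (rho t l u) * indicator {p. defect (fst p) (snd p) < 1 / 9 ^ m} (u, t * u) * indicator {1/2<..U} u"
      proof (cases "defect u (t * u) < 1 / 9 ^ m")
        case True
        then show ?thesis by (simp add: indicator_def)
      next
        case False
        then have "1 \<le> 9 ^ m * defect u (t * u)" by (simp add: field_simps)
        then have "1 * rho t l u \<le> 9 ^ m * defect u (t * u) * rho t l u" by (rule mult_right_mono) simp
        then have "ennreal (rho t l u) \<le> ennreal (9 ^ m * (defect u (t * u) * rho t l u))" by (intro ennreal_leI) (simp only: mult_1 mult.assoc)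
        also have "\<dots> = ennreal (9 ^ m) * ennreal (defect u (t * u) * rho t l u)"
          by (rule ennreal_mult) (simp_all add: defect_nonneg)
        finally show ?thesis using False by (simp add: indicator_def)
      qed
    qed
    also have "\<dots> = (\<integral>\<^sup>+u. ennreal (9 ^ m) * (ennreal (defect u (t * u) * rho t l u) * indicator {1/2<..U} u) \<partial>lborel) + D t"
      unfolding D_def by (rule nn_integral_add) measurable
    also have "(\<integral>\<^sup>+u. ennreal (9 ^ m) * (ennreal (defect u (t * u) * rho t l u) * indicator {1/2<..U} u) \<partial>lborel) = ennreal (9 ^ m) * B t"
      unfolding B_def by (rule nn_integral_cmult) measurable
    finally show ?thesis .
  qed
  have "ennreal (3 ^ l * U / 4) * emeasure lborel ?T = (\<integral>\<^sup>+t. ennreal (3 ^ l * U / 4) * indicator ?T t \<partial>lborel)"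
    by (simp add: nn_integral_cmult_indicator)
  also have "\<dots> \<le> (\<integral>\<^sup>+t. ennreal (9 ^ m) * (B t * indicator ?T t) + D t * indicator {-1..2} t \<partial>lborel)"
  proof (rule nn_integral_mono)
    fix t
    show "ennreal (3 ^ l * U / 4) * indicator ?T t \<le> ennreal (9 ^ m) * (B t * indicator ?T t) + D t * indicator {-1..2} t"
    proof (cases "t \<in> ?T")
      case True
      then have "t \<in> {-1..2}" by (simp add: flat_slopes_def)
      then show ?thesis using True split[OF True] by simp
    qed simp
  qed
  also have "\<dots> = (\<integral>\<^sup>+t. ennreal (9 ^ m) * (B t * indicator ?T t) \<partial>lborel) + (\<integral>\<^sup>+t. D t * indicator {-1..2} t \<partial>lborel)"
    by (rule nn_integral_add) measurable
  also have "\<dots> \<le> ennreal (9 ^ m) * (\<integral>\<^sup>+t\<in>?T. B t \<partial>lborel) + ennreal (200 * U * 3 ^ (l - m))"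
  proof (rule add_mono)
    have "(\<integral>\<^sup>+t. ennreal (9 ^ m) * (B t * indicator ?T t) \<partial>lborel) = ennreal (9 ^ m) * (\<integral>\<^sup>+t\<in>?T. B t \<partial>lborel)"
      by (rule nn_integral_cmult) measurable
    then show "(\<integral>\<^sup>+t. ennreal (9 ^ m) * (B t * indicator ?T t) \<partial>lborel) \<le> ennreal (9 ^ m) * (\<integral>\<^sup>+t\<in>?T. B t \<partial>lborel)" by simp
    show "(\<integral>\<^sup>+t. D t * indicator {-1..2} t \<partial>lborel) \<le> ennreal (200 * U * 3 ^ (l - m))"
      unfolding D_def by (rule slope_integral_near_lattice[OF l(1) U(2)])
  qed
  finally show ?thesis unfolding B_def .
qed

text \<open>Every block carries about the same mass on the flat slopes, while the sum over the
  blocks is bounded by the energy; so there cannot be many blocks. The base 243 arises as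
  \<open>9 * 81 / 3\<close>: the inverse defect, the loss in each block, and the length U of the
  frequency range.\<close>

lemma block_count_bound:
  assumes mK: "12288 * real K \<le> 3 ^ m" "1 \<le> K" and I: "(I + 1) * m \<le> N"
    and large: "1 / real K < measure lborel (flat_slopes K N)"
  shows "real I \<le> 221184 * real K * 243 ^ m"
proof -
  let ?T = "flat_slopes K N"
  define mu where "mu = measure lborel ?T"
  have emu: "emeasure lborel ?T = ennreal mu"
    unfolding mu_def using emeasure_flat_slopes_le[of K N]
    by (intro emeasure_eq_ennreal_measure) (auto simp: top_unique)
  define U :: real where "U = 3 ^ m / 2"
  have U: "0 < U" by (simp add: U_def)
  define l where "l i = N - (i * m + m)" for i
  define c :: "nat \<Rightarrow> real" where "c i = 3 ^ (i * m + m) / (36 * 81 ^ m)" for i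
  define B where "B i t = (\<integral>\<^sup>+u\<in>{1/2<..U}. defect u (t * u) * rho t (l i) u \<partial>lborel)" for i t
  have B[measurable]: "B i \<in> borel_measurable borel" for i unfolding B_def by measurable
  define b where "b i = (\<integral>\<^sup>+t\<in>?T. B i t \<partial>lborel)" for i
  have li: "m \<le> l i" "l i \<le> N" "i * m + m + l i = N" if "i < I" for i
  proof -
    have "Suc (Suc i) * m \<le> (I + 1) * m" using that by (intro mult_right_mono) auto
    then have "Suc (Suc i) * m \<le> N" using I by (rule order.trans)
    then show "m \<le> l i" "l i \<le> N" "i * m + m + l i = N" by (auto simp: l_def)
  qed
  have pow: "3 ^ (i * m + m) * 3 ^ l i = (3::real) ^ N" if "i < I" for i
    using li(3)[OF that] by (simp flip: power_add)
  have upper: "(\<Sum>i<I. ennreal (c i) * b i) \<le> ennreal (384 * real K * 3 ^ N * mu)"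
  proof -
    have "(\<Sum>i<I. ennreal (c i) * b i) = (\<Sum>i<I. \<integral>\<^sup>+t. ennreal (c i) * (B i t * indicator ?T t) \<partial>lborel)"
      unfolding b_def by (intro sum.cong refl nn_integral_cmult[symmetric]) measurable
    also have "\<dots> = (\<integral>\<^sup>+t. (\<Sum>i<I. ennreal (c i) * (B i t * indicator ?T t)) \<partial>lborel)"
      by (rule nn_integral_sum[symmetric]) measurable
    also have "\<dots> \<le> (\<integral>\<^sup>+t. ennreal (384 * real K * 3 ^ N) * indicator ?T t \<partial>lborel)"
    proof (rule nn_integral_mono)
      fix t
      show "(\<Sum>i<I. ennreal (c i) * (B i t * indicator ?T t)) \<le> ennreal (384 * real K * 3 ^ N) * indicator ?T t"
      proof (cases "t \<in> ?T")
        case True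
        then have t: "-1 \<le> t" "t \<le> 2" "real (energy t N) \<le> 2 * real K * 3 ^ N" by (auto simp: flat_slopes_def)
        have "(\<Sum>i<I. ennreal (c i) * B i t) \<le> ennreal (192 * real (energy t N))"
          unfolding c_def B_def l_def
          by (rule sum_rho_blocks_le_energy[OF t(1,2) U _ I]) (simp add: U_def)
        also have "\<dots> \<le> ennreal (384 * real K * 3 ^ N)" using t(3) by (intro ennreal_leI) simp
        finally show ?thesis using True by simp
      qed simp
    qed
    also have "\<dots> = ennreal (384 * real K * 3 ^ N) * ennreal mu"
      by (simp add: nn_integral_cmult_indicator emu)
    also have "\<dots> = ennreal (384 * real K * 3 ^ N * mu)"
      by (rule ennreal_mult[symmetric]) (simp_all add: mu_def)
    finally show ?thesis .
  qed
  \<comment> \<open>X and Y do not depend on the block, because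
    \<open>3^(i * m + m) * 3^(l i)\<close> is always \<open>3^N\<close>.\<close>
  define X where "X = 3 ^ N * U / (144 * 81 ^ m) * mu"
  define Y where "Y = 200 * U * 3 ^ N / (36 * 243 ^ m)"
  have mu0: "0 \<le> mu" by (simp add: mu_def)
  have XY: "0 \<le> X" "0 \<le> Y" using U mu0 by (simp_all add: X_def Y_def)
  have each: "ennreal X \<le> ennreal (9 ^ m) * (ennreal (c i) * b i) + ennreal Y" if i: "i < I" for i
  proof -
    have c0: "0 \<le> c i" by (simp add: c_def)
    have "c i * (3 ^ l i * U / 4 * mu) = (3 ^ (i * m + m) * 3 ^ l i) * U / (144 * 81 ^ m) * mu" by (simp add: c_def)
    then have x: "c i * (3 ^ l i * U / 4 * mu) = X" unfolding pow[OF i] X_def .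
    have "(243::real) ^ m = 81 ^ m * 3 ^ m" by (simp flip: power_mult_distrib)
    then have "c i * (200 * U * 3 ^ (l i - m)) = 200 * U * (3 ^ (i * m + m) * 3 ^ l i) / (36 * 243 ^ m)"
      using li(1)[OF i] by (simp add: c_def power_diff)
    then have y: "c i * (200 * U * 3 ^ (l i - m)) = Y" unfolding pow[OF i] Y_def .
    have "ennreal X = ennreal (c i) * ennreal (3 ^ l i * U / 4 * mu)"
      unfolding x[symmetric] by (rule ennreal_mult) (use c0 U mu0 in simp_all)
    also have "ennreal (3 ^ l i * U / 4 * mu) = ennreal (3 ^ l i * U / 4) * emeasure lborel ?T"
      unfolding emu by (rule ennreal_mult) (use U mu0 in simp_all)
    also have "ennreal (c i) * (ennreal (3 ^ l i * U / 4) * emeasure lborel ?T) \<le> ennreal (c i) * (ennreal (9 ^ m) * b i + ennreal (200 * U * 3 ^ (l i - m)))"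
      unfolding b_def B_def U_def by (intro mult_left_mono block_lower_bound[OF mK li(1,2)[OF i]]) simp
    also have "\<dots> = ennreal (9 ^ m) * (ennreal (c i) * b i) + ennreal (c i) * ennreal (200 * U * 3 ^ (l i - m))"
      by (simp add: distrib_left mult_ac)
    also have "ennreal (c i) * ennreal (200 * U * 3 ^ (l i - m)) = ennreal Y"
      unfolding y[symmetric] using c0 U by (simp add: ennreal_mult)
    finally show ?thesis .
  qed
  have "ennreal (real I * X) = (\<Sum>i<I. ennreal X)"
    using XY by (simp add: ennreal_mult ennreal_of_nat_eq_real_of_nat)
  also have "\<dots> \<le> (\<Sum>i<I. ennreal (9 ^ m) * (ennreal (c i) * b i) + ennreal Y)"
    by (intro sum_mono each) simp
  also have "\<dots> = ennreal (9 ^ m) * (\<Sum>i<I. ennreal (c i) * b i) + ennreal (real I * Y)"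
    using XY by (simp add: sum.distrib sum_distrib_left ennreal_mult ennreal_of_nat_eq_real_of_nat)
  also have "\<dots> \<le> ennreal (9 ^ m) * ennreal (384 * real K * 3 ^ N * mu) + ennreal (real I * Y)"
    by (intro add_right_mono mult_left_mono upper) simp
  also have "\<dots> = ennreal (9 ^ m * (384 * real K * 3 ^ N * mu) + real I * Y)"
    using XY mu0 by (simp add: ennreal_mult ennreal_plus)
  finally have "real I * X \<le> 9 ^ m * (384 * real K * 3 ^ N * mu) + real I * Y"
    using XY mu0 by (subst (asm) ennreal_le_iff) auto
  \<comment> \<open>Y/X is \<open>800 / (3^m * mu)\<close>. This is small since \<open>3^m\<close>
    exceeds K by the factor 12288 and \<open>mu\<close> exceeds 1/K.\<close>
  moreover have "Y \<le> X / 2"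
  proof -
    have K: "0 < real K" using mK by simp
    have "(243::real) ^ m = 81 ^ m * 3 ^ m" by (simp flip: power_mult_distrib)
    then have "Y = (U * 3 ^ N / 81 ^ m) * (200 / 36 / 3 ^ m)" by (simp add: Y_def mult_ac)
    also have "\<dots> \<le> (U * 3 ^ N / 81 ^ m) * (mu / 288)"
    proof (rule mult_left_mono)
      have "200 / 36 / 3 ^ m \<le> 200 / 36 / (12288 * real K)"
        using mK K by (intro divide_left_mono) auto
      also have "\<dots> \<le> (1 / real K) / 288" using K by (simp add: divide_simps)
      also have "\<dots> \<le> mu / 288" using large by (simp add: mu_def)
      finally show "200 / 36 / 3 ^ m \<le> mu / 288" .
    qed (use U in simp)
    also have "\<dots> = X / 2" by (simp add: X_def mult_ac)
    finally show ?thesis .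
  qed
  then have "real I * Y \<le> real I * (X / 2)" by (rule mult_left_mono) simp
  ultimately have "real I * X \<le> 2 * (9 ^ m * (384 * real K * 3 ^ N * mu))" by linarith
  moreover have "real I * X = (3 ^ N * mu) * (real I * 3 ^ m / (288 * 81 ^ m))"
    by (simp add: X_def U_def)
  moreover have "2 * (9 ^ m * (384 * real K * 3 ^ N * mu)) = (3 ^ N * mu) * (768 * real K * 9 ^ m)" by simp
  ultimately have "(3 ^ N * mu) * (real I * 3 ^ m / (288 * 81 ^ m)) \<le> (3 ^ N * mu) * (768 * real K * 9 ^ m)" by simp
  moreover have "0 < 3 ^ N * mu"
  proof -
    have "0 < 1 / real K" using mK by simp
    then have "0 < mu" using large unfolding mu_def by linarith
    then show ?thesis by simp
  qed
  ultimately have "real I * 3 ^ m / (288 * 81 ^ m) \<le> 768 * real K * 9 ^ m" by (rule mult_left_le_imp_le)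
  then have "real I * 3 ^ m \<le> (768 * real K * 9 ^ m) * (288 * 81 ^ m)" by (simp only: divide_le_eq) simp
  also have "\<dots> = 221184 * real K * 243 ^ m * 3 ^ m"
  proof -
    have "(243::real) ^ m * 3 ^ m = 9 ^ m * 81 ^ m" by (simp flip: power_mult_distrib)
    then show ?thesis by simp
  qed
  finally show ?thesis by simp
qed

text \<open>With m the least admissible value, \<open>3^m\<close> is of order K and the block count
  is at most of order \<open>K^6\<close>. About \<open>K^9 / 36864\<close> blocks fit into
  \<open>K^10\<close> levels, so the surplus \<open>K^3\<close>, at least \<open>10^36\<close>, has
  to beat the accumulated constants; this fixes the lower bound \<open>10^12\<close>.\<close>

lemma measure_flat_slopes_le:
  assumes K: "10 ^ 12 \<le> K"
  shows "measure lborel (flat_slopes K (K ^ 10)) \<le> 1 / real K"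
proof (rule ccontr)
  assume "\<not> ?thesis"
  then have large: "1 / real K < measure lborel (flat_slopes K (K ^ 10))" by simp
  have K1: "1 \<le> K" using K by simp
  define m where "m = (LEAST m. 12288 * K \<le> 3 ^ m)"
  have "12288 * K \<le> 3 ^ (12288 * K)" using less_exp[of "12288 * K"] power_mono[of 2 "3::nat" "12288 * K"] by linarith
  then have m: "12288 * K \<le> 3 ^ m" unfolding m_def by (rule LeastI)
  have m0: "m \<noteq> 0" using m K1 by (intro notI) simp
  have "\<not> 12288 * K \<le> 3 ^ (m - 1)" using m0 unfolding m_def by (intro not_less_Least) simp
  then have "3 * 3 ^ (m - 1) < 36864 * K" by simp
  then have m3: "3 ^ m < 36864 * K" using m0 by (simp add: power_eq_if)
  \<comment> \<open>Although m is only logarithmic in K, the crude \<open>m < 3^m\<close>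
    suffices.\<close>
  have m_le: "m \<le> 36864 * K"
    using less_exp[of m] power_mono[of 2 "3::nat" m] m3 by linarith
  define I where "I = K ^ 9 div 36864 - 1"
  have K9: "36864 \<le> K ^ 9"
  proof -
    have "(36864::nat) \<le> 10 ^ 12" by simp
    also have "\<dots> \<le> K ^ 1" using K by simp
    also have "\<dots> \<le> K ^ 9" using K1 by (intro power_increasing) auto
    finally show ?thesis .
  qed
  then have "1 \<le> K ^ 9 div 36864" by (simp add: div_greater_zero_iff Suc_le_eq)
  then have I1: "I + 1 = K ^ 9 div 36864" by (simp add: I_def)
  have "(I + 1) * m \<le> (K ^ 9 div 36864) * (36864 * K)" unfolding I1 by (rule mult_left_mono[OF m_le]) simp
  also have "\<dots> = (K ^ 9 div 36864 * 36864) * K" by simp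
  also have "\<dots> \<le> K ^ 9 * K" by (rule mult_right_mono) simp_all
  finally have "(I + 1) * m \<le> K ^ 10" by (simp add: eval_nat_numeral mult_ac)
  moreover have "12288 * real K \<le> 3 ^ m" using m by (metis of_nat_le_iff of_nat_mult of_nat_numeral of_nat_power)
  ultimately have "real I \<le> 221184 * real K * 243 ^ m"
    using block_count_bound[OF _ K1 _ large] by blast
  also have "(243::real) ^ m = (3 ^ m) ^ 5" by (simp flip: power_mult) (simp add: power_mult mult.commute[of m])
  also have "221184 * real K * (3 ^ m) ^ 5 \<le> 221184 * real K * (36864 * real K) ^ 5"
  proof (intro mult_left_mono power_mono)
    have "real (3 ^ m) \<le> real (36864 * K)" using m3 by (simp only: of_nat_le_iff less_imp_le)
    then show "3 ^ m \<le> 36864 * real K" by simp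
  qed simp_all
  finally have I_le: "real I \<le> 221184 * 36864 ^ 5 * real K ^ 6" by (simp add: power_mult_distrib eval_nat_numeral mult_ac)
  have "K ^ 9 < (I + 2) * 36864"
    using I1 div_mult_mod_eq[of "K ^ 9" 36864] mod_less_divisor[of 36864 "K ^ 9"] by simp
  then have "real (K ^ 9) < real ((I + 2) * 36864)" by (simp only: of_nat_less_iff)
  then have "real K ^ 9 < (real I + 2) * 36864" by simp
  also have "\<dots> \<le> (221184 * 36864 ^ 5 * real K ^ 6 + 2 * real K ^ 6) * 36864"
    using I_le K1 by (intro mult_right_mono add_mono) auto
  also have "\<dots> = (221184 * 36864 ^ 5 + 2) * 36864 * real K ^ 6" by (simp only: algebra_simps)
  also have "\<dots> \<le> real K ^ 3 * real K ^ 6"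
  proof (rule mult_right_mono)
    have "real (10 ^ 12) \<le> real K" using K by (simp only: of_nat_le_iff)
    then have "(10 ^ 12) ^ 3 \<le> real K ^ 3" by (intro power_mono) auto
    moreover have "(221184 * 36864 ^ 5 + 2) * 36864 \<le> (10 ^ 12 :: real) ^ 3" by simp
    ultimately show "(221184 * 36864 ^ 5 + 2) * 36864 \<le> real K ^ 3" by linarith
  qed simp
  also have "\<dots> = real K ^ 9" by (simp flip: power_add)
  finally show False by simp
qed

section \<open>Nested shadows and their average over the slopes\<close>

text \<open>The last digit moves the centre by at most \<open>2 / 3^(n + 1)\<close>. Together with
  the new radius this is at most two thirds of the old radius.\<close>

lemma shadow_Suc_subset:
  assumes t: "-1 \<le> t" "t \<le> 2"
  shows "shadow t (Suc n) \<subseteq> shadow t n"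
proof
  fix x assume "x \<in> shadow t (Suc n)"
  then obtain w where w: "w \<in> words (Suc n)" "\<bar>node t w / 3 ^ Suc n - x\<bar> < 2 / 3 ^ Suc n"
    by (auto simp: shadow_def dist_real_def)
  have u: "take n w \<in> words n" by (rule take_words[OF w(1)]) simp
  have "w = take n w @ [w ! n]" using take_Suc_conv_app_nth[of n w] w(1) by simp
  moreover have "node t (take n w @ [w ! n]) = 3 * node t (take n w) + digit t (w ! n)" by (simp add: node_append)
  ultimately have "node t w = 3 * node t (take n w) + digit t (w ! n)" by simp
  then have eq: "node t w / 3 ^ Suc n = node t (take n w) / 3 ^ n + digit t (w ! n) / 3 ^ Suc n"
    by (simp add: add_divide_distrib)
  have "\<bar>digit t (w ! n) / 3 ^ Suc n\<bar> \<le> 2 / 3 ^ Suc n"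
    using digit_bounds[OF t, of "w ! n"] by (simp add: abs_le_iff divide_right_mono)
  moreover have "2 / 3 ^ Suc n + 2 / 3 ^ Suc n \<le> (2 / 3 ^ n :: real)" by (simp add: divide_simps)
  ultimately have "\<bar>node t (take n w) / 3 ^ n - x\<bar> < 2 / 3 ^ n"
    using w(2) unfolding eq by linarith
  then show "x \<in> shadow t n" using u by (auto simp: shadow_def dist_real_def)
qed

lemma shadow_antimono:
  assumes t: "-1 \<le> t" "t \<le> 2" and "m \<le> n"
  shows "shadow t n \<subseteq> shadow t m"
  using \<open>m \<le> n\<close> shadow_Suc_subset[OF t] by (rule lift_Suc_antimono_le[where f = "shadow t", rotated])

lemma emeasure_shadow_antimono:
  assumes "-1 \<le> t" "t \<le> 2" and "m \<le> n"
  shows "emeasure lborel (shadow t n) \<le> emeasure lborel (shadow t m)"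
  by (rule emeasure_mono[OF shadow_antimono[OF assms]]) simp

lemma emeasure_shadow_le_4:
  assumes "-1 \<le> t" "t \<le> 2"
  shows "emeasure lborel (shadow t n) \<le> 4"
  using emeasure_shadow_antimono[OF assms, of 0 n] by (simp add: emeasure_shadow[of t 0] measure_shadow_0)

text \<open>As t varies, the shadows are the sections of one subset of the plane given by finitely
  many strict inequalities.\<close>

lemma borel_measurable_emeasure_shadow [measurable]:
  "(\<lambda>t. emeasure lborel (shadow t n)) \<in> borel_measurable borel"
proof -
  let ?Q = "{p :: real \<times> real. \<exists>w\<in>words n. \<bar>node (fst p) w / 3 ^ n - snd p\<bar> < 2 / 3 ^ n}"
  have "?Q \<inter> space (borel \<Otimes>\<^sub>M lborel) \<in> sets (borel \<Otimes>\<^sub>M lborel)"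
    by measurable
  then have "?Q \<in> sets (borel \<Otimes>\<^sub>M lborel)" by (simp add: space_pair_measure)
  from lborel.measurable_emeasure_Pair[OF this]
  show ?thesis by (simp add: vimage_def shadow_def ball_def dist_real_def Bex_def Collect_ex_eq[symmetric] UNION_eq)
qed

text \<open>Flat slopes have measure at most 1/K, and there the trivial length 4 is used. For any
  other slope the energy bound fails, so the stops are heavy and the contraction applies. The
  constant is 48004 = 4 + 3 * 16000.\<close>

lemma shadow_integral_le:
  assumes K: "10 ^ 12 \<le> K" and n: "K ^ 12 \<le> n"
  shows "(\<integral>\<^sup>+t\<in>{-1..2}. emeasure lborel (shadow t n) \<partial>lborel) \<le> ennreal (48004 / real K)"
proof -
  let ?T = "flat_slopes K (K ^ 10)"
  have K2: "2 \<le> K" using K by simp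
  have emu: "emeasure lborel ?T \<le> ennreal (1 / real K)"
  proof -
    have "emeasure lborel ?T = ennreal (measure lborel ?T)"
      using emeasure_flat_slopes_le[of K "K ^ 10"]
      by (intro emeasure_eq_ennreal_measure) (auto simp: top_unique)
    then show ?thesis using measure_flat_slopes_le[OF K] by (simp add: ennreal_leI)
  qed
  have "(\<integral>\<^sup>+t\<in>{-1..2}. emeasure lborel (shadow t n) \<partial>lborel)
    \<le> (\<integral>\<^sup>+t. 4 * indicator ?T t + ennreal (16000 / real K) * indicator {-1..2} t \<partial>lborel)"
  proof (rule nn_integral_mono)
    fix t
    show "emeasure lborel (shadow t n) * indicator {-1..2} t \<le> 4 * indicator ?T t + ennreal (16000 / real K) * indicator {-1..2} t"
    proof (cases "t \<in> {-1..2}")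
      case True
      then have t: "-1 \<le> t" "t \<le> 2" by auto
      show ?thesis
      proof (cases "t \<in> ?T")
        case True
        then show ?thesis using emeasure_shadow_le_4[OF t, of n] t by (simp add: add_increasing2)
      next
        case False
        then have "\<not> real (energy t (K ^ 10)) \<le> 2 * real K * 3 ^ (K ^ 10)" using t by (simp add: flat_slopes_def)
        then have "1 < 72 * real K ^ 2 * stop_mass t K (K ^ 10)"
          using energy_le_of_small_stop_mass[OF t K2, of "K ^ 10" "K ^ 10"] by force
        from shadow_small_of_large_stop_mass[OF t K2 this]
        have "emeasure lborel (shadow t (K\<^sup>2 * K ^ 10)) \<le> ennreal (16000 / real K)"
          unfolding emeasure_shadow by (rule ennreal_leI)
        moreover have "K\<^sup>2 * K ^ 10 = K ^ 12" by (simp flip: power_add)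
        ultimately have "emeasure lborel (shadow t n) \<le> ennreal (16000 / real K)"
          using emeasure_shadow_antimono[OF t n] by (metis order.trans)
        then show ?thesis using t False by simp
      qed
    qed simp
  qed
  also have "\<dots> = (\<integral>\<^sup>+t. 4 * indicator ?T t \<partial>lborel) + (\<integral>\<^sup>+t. ennreal (16000 / real K) * indicator {-1..2::real} t \<partial>lborel)"
    by (rule nn_integral_add) measurable
  also have "\<dots> = 4 * emeasure lborel ?T + ennreal (16000 / real K) * 3"
    by (simp add: nn_integral_cmult_indicator)
  also have "\<dots> \<le> 4 * ennreal (1 / real K) + ennreal (16000 / real K) * 3"
    by (intro add_right_mono mult_left_mono emu) simp
  also have "\<dots> = ennreal 4 * ennreal (1 / real K) + ennreal (16000 / real K) * ennreal 3" by simp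
  also have "\<dots> = ennreal (4 * (1 / real K) + 16000 / real K * 3)"
    by (simp only: ennreal_mult[symmetric] ennreal_plus[symmetric] of_nat_0_le_iff zero_le_divide_iff
        zero_le_mult_iff zero_le_numeral zero_le_one simp_thms)
  also have "4 * (1 / real K) + 16000 / real K * 3 = 48004 / real K" by (simp flip: add_divide_distrib)
  finally show ?thesis .
qed

section \<open>Projections of the gasket\<close>

lemma inner_cis: "cis a \<bullet> cis b = cos (a - b)"
  by (simp add: inner_complex_def cos_diff)

lemma node_map: "node t (map f [1..<Suc n]) / 3 ^ n = (\<Sum>k=1..n. digit t (f k) / 3 ^ k)"
proof (induction n)
  case (Suc n)
  have "node t (map f [1..<Suc (Suc n)]) = 3 * node t (map f [1..<Suc n]) + digit t (f (Suc n))"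
    by (simp add: node_append)
  then have "node t (map f [1..<Suc (Suc n)]) / 3 ^ Suc n = node t (map f [1..<Suc n]) / 3 ^ n + digit t (f (Suc n)) / 3 ^ Suc n"
    by (simp add: add_divide_distrib)
  then show ?case unfolding Suc by simp
qed simp

definition slope :: "real \<Rightarrow> real" where
  "slope \<theta> = 1 / 2 + sqrt 3 / 2 * tan \<theta>"

text \<open>In the coordinate x a ball of radius \<open>3^-n\<close> gets radius
  \<open>3^-n / A\<close>, at most \<open>2 / 3^n\<close>. The map \<tau> allows the three
  directions to be assigned to the digits in any suitable way, which is how rotated angles are
  reduced to the basic range.\<close>

lemma gasket_projection_subset:
  fixes \<tau> :: "int \<Rightarrow> int"
  assumes A: "1 / 2 \<le> A"
    and \<tau>: "\<And>a. a \<in> {-1, 0, 1} \<Longrightarrow> \<tau> a \<in> {-1, 0, 1} \<and>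
      cos (pi * (1/2 + 2/3 * real_of_int a) - \<theta>) = B + A * digit t (\<tau> a)"
  shows "(\<lambda>z. z \<bullet> cis \<theta>) ` gasket n \<subseteq> (\<lambda>x. B * (\<Sum>k=1..n. 1 / 3 ^ k) + A * x) ` shadow t n"
proof safe
  fix z assume "z \<in> gasket n"
  then obtain \<alpha> where \<alpha>: "\<alpha> \<in> {1..n} \<rightarrow>\<^sub>E {-1, 0, 1}" and z: "dist (gasket_centre n \<alpha>) z < 1 / 3 ^ n"
    by (auto simp: gasket_def)
  have range: "\<alpha> k \<in> {-1, 0, 1}" if "k \<in> {1..n}" for k using \<alpha> that by blast
  let ?s = "\<Sum>k=1..n. 1 / 3 ^ k :: real"
  define w where "w = map (\<tau> \<circ> \<alpha>) [1..<Suc n]"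
  have w: "w \<in> words n"
    unfolding words_def w_def using \<tau> range by (simp add: image_subset_iff)
  have "gasket_centre n \<alpha> \<bullet> cis \<theta> = (\<Sum>k=1..n. 1 / 3 ^ k * cos (pi * (1/2 + 2/3 * real_of_int (\<alpha> k)) - \<theta>))"
    by (simp add: gasket_centre_def inner_sum_left inner_cis)
  also have "\<dots> = (\<Sum>k=1..n. 1 / 3 ^ k * (B + A * digit t (\<tau> (\<alpha> k))))"
    by (intro sum.cong refl arg_cong2[of _ _ _ _ "(*)"] \<tau>[THEN conjunct2] range)
  also have "\<dots> = B * ?s + A * (\<Sum>k=1..n. digit t ((\<tau> \<circ> \<alpha>) k) / 3 ^ k)"
    by (simp add: sum_distrib_left sum.distrib[symmetric] algebra_simps)
  also have "\<dots> = B * ?s + A * (node t w / 3 ^ n)" unfolding w_def node_map ..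
  finally have c: "gasket_centre n \<alpha> \<bullet> cis \<theta> = B * ?s + A * (node t w / 3 ^ n)" .
  define x where "x = (z \<bullet> cis \<theta> - B * ?s) / A"
  have zx: "z \<bullet> cis \<theta> = B * ?s + A * x" using A by (simp add: x_def)
  have "\<bar>gasket_centre n \<alpha> \<bullet> cis \<theta> - z \<bullet> cis \<theta>\<bar> \<le> norm (gasket_centre n \<alpha> - z) * norm (cis \<theta>)"
    unfolding inner_diff_left[symmetric] by (rule Cauchy_Schwarz_ineq2)
  also have "\<dots> < 1 / 3 ^ n" using z by (simp add: dist_norm)
  finally have "\<bar>A * (node t w / 3 ^ n) - A * x\<bar> < 1 / 3 ^ n" unfolding c zx by simp
  moreover have "A * (node t w / 3 ^ n) - A * x = A * (node t w / 3 ^ n - x)" by (simp only: right_diff_distrib)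
  ultimately have "A * \<bar>node t w / 3 ^ n - x\<bar> < 1 / 3 ^ n" using A by (simp add: abs_mult)
  then have "1 / 2 * \<bar>node t w / 3 ^ n - x\<bar> < 1 / 3 ^ n"
    by (rule le_less_trans[OF mult_right_mono[OF A abs_ge_zero]])
  then have "\<bar>node t w / 3 ^ n - x\<bar> < 2 / 3 ^ n" by simp
  then have "x \<in> shadow t n" using w by (auto simp: shadow_def dist_real_def)
  then show "z \<bullet> cis \<theta> \<in> (\<lambda>x. B * ?s + A * x) ` shadow t n" unfolding zx by (rule imageI)
qed

lemma line_measure_gasket_le:
  fixes \<tau> :: "int \<Rightarrow> int"
  assumes A: "1 / 2 \<le> A" "A \<le> 2"
    and \<tau>: "\<And>a. a \<in> {-1, 0, 1} \<Longrightarrow> \<tau> a \<in> {-1, 0, 1} \<and>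
      cos (pi * (1/2 + 2/3 * real_of_int a) - \<theta>) = B + A * digit t (\<tau> a)"
  shows "line_measure \<theta> (proj_line \<theta> ` gasket n) \<le> 2 * emeasure lborel (shadow t n)"
proof -
  let ?I = "(\<lambda>x. B * (\<Sum>k=1..n. 1 / 3 ^ k) + A * x) ` shadow t n"
  have "open ?I" using open_affinity[of "shadow t n" A "B * (\<Sum>k=1..n. 1 / 3 ^ k)"] A by simp
  then have I: "?I \<in> sets borel" by simp
  have "line_measure \<theta> (proj_line \<theta> ` gasket n) \<le> emeasure lebesgue ?I"
    unfolding line_measure_proj_line
    by (rule emeasure_mono[OF gasket_projection_subset[OF A(1) \<tau>]]) (use I in auto)
  also have "\<dots> = emeasure lborel ?I" using I by simp
  also have "\<dots> = ennreal A * emeasure lborel (shadow t n)"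
    by (rule emeasure_lborel_affine_image) (use A in auto)
  also have "\<dots> \<le> ennreal 2 * emeasure lborel (shadow t n)"
    by (intro mult_right_mono ennreal_leI A) simp
  finally show ?thesis by simp
qed

lemma cos_directions:
  "cos (pi * (1/2 + 2/3 * real_of_int 0) - \<theta>) = sin \<theta>"
  "cos (pi * (1/2 + 2/3 * real_of_int 1) - \<theta>) = - (sqrt 3 / 2 * cos \<theta>) - sin \<theta> / 2"
  "cos (pi * (1/2 + 2/3 * real_of_int (-1)) - \<theta>) = sqrt 3 / 2 * cos \<theta> - sin \<theta> / 2"
proof -
  have "pi * (1/2 + 2/3 * real_of_int 0) - \<theta> = pi / 2 - \<theta>" by simp
  then show "cos (pi * (1/2 + 2/3 * real_of_int 0) - \<theta>) = sin \<theta>" by (simp add: sin_cos_eq)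
  have "pi * (1/2 + 2/3 * real_of_int 1) - \<theta> = (pi / 6 - \<theta>) + pi" by simp
  then show "cos (pi * (1/2 + 2/3 * real_of_int 1) - \<theta>) = - (sqrt 3 / 2 * cos \<theta>) - sin \<theta> / 2"
    by (simp only: cos_periodic_pi cos_diff cos_30 sin_30)
  have "pi * (1/2 + 2/3 * real_of_int (-1)) - \<theta> = - (pi / 6 + \<theta>)" by simp
  then show "cos (pi * (1/2 + 2/3 * real_of_int (-1)) - \<theta>) = sqrt 3 / 2 * cos \<theta> - sin \<theta> / 2"
    by (simp only: cos_minus cos_add cos_30 sin_30)
qed

text \<open>The affine map is fixed by sending 0 and 1 to the projections of the directions of 1 and
  -1. Solving for the preimage of the third projection gives the formula in
  \<open>slope\<close>.\<close>

lemma cos_directions_slope: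
  assumes "cos \<theta> \<noteq> 0" "a \<in> {-1, 0, 1}"
  shows "cos (pi * (1/2 + 2/3 * real_of_int a) - \<theta>)
    = (- (sqrt 3 / 2 * cos \<theta>) - sin \<theta> / 2) + sqrt 3 * cos \<theta> * digit (slope \<theta>) a"
proof -
  have s: "sqrt 3 * cos \<theta> * slope \<theta> = sqrt 3 / 2 * cos \<theta> + 3 / 2 * sin \<theta>"
  proof -
    have "sqrt 3 * cos \<theta> * slope \<theta> = sqrt 3 / 2 * cos \<theta> + (sqrt 3 * sqrt 3) / 2 * (cos \<theta> * tan \<theta>)"
      unfolding slope_def by (simp add: algebra_simps)
    also have "cos \<theta> * tan \<theta> = sin \<theta>" using assms(1) by (simp add: tan_def)
    finally show ?thesis by simp
  qed
  consider "a = -1" | "a = 0" | "a = 1" using assms(2) by auto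
  then show ?thesis
  proof cases
    case 1
    then show ?thesis using cos_directions(3)[of \<theta>] by (simp add: digit_def)
  next
    case 2
    then show ?thesis using cos_directions(1)[of \<theta>] s by (simp add: digit_def)
  next
    case 3
    then show ?thesis using cos_directions(2)[of \<theta>] by (simp add: digit_def)
  qed
qed

lemma cos_ge_half: "\<bar>\<theta>\<bar> \<le> pi / 3 \<Longrightarrow> 1 / 2 \<le> cos \<theta>"
  using cos_monotone_0_pi_le[of "\<bar>\<theta>\<bar>" "pi / 3"] cos_60 by simp

lemma sqrt3_cos_bounds:
  assumes "\<bar>\<theta>\<bar> \<le> pi / 3"
  shows "1 / 2 \<le> sqrt 3 * cos \<theta>" "sqrt 3 * cos \<theta> \<le> 2"
proof -
  have "1 \<le> sqrt 3" "sqrt 3 \<le> 2" by (auto intro: real_le_lsqrt)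
  then have "1 * (1 / 2) \<le> sqrt 3 * cos \<theta>" "sqrt 3 * cos \<theta> \<le> 2 * 1"
    using cos_ge_half[OF assms] by (intro mult_mono; simp)+
  then show "1 / 2 \<le> sqrt 3 * cos \<theta>" "sqrt 3 * cos \<theta> \<le> 2" by simp_all
qed

lemma line_measure_gasket_le_slope:
  assumes "\<bar>\<theta>\<bar> \<le> pi / 3"
  shows "line_measure \<theta> (proj_line \<theta> ` gasket n) \<le> 2 * emeasure lborel (shadow (slope \<theta>) n)"
proof (rule line_measure_gasket_le[OF sqrt3_cos_bounds[OF assms], where \<tau> = id])
  fix a :: int assume "a \<in> {-1, 0, 1}"
  moreover have "cos \<theta> \<noteq> 0" using cos_ge_half[OF assms] by auto
  ultimately show "id a \<in> {-1, 0, 1} \<and> cos (pi * (1/2 + 2/3 * real_of_int a) - \<theta>)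
    = (- (sqrt 3 / 2 * cos \<theta>) - sin \<theta> / 2) + sqrt 3 * cos \<theta> * digit (slope \<theta>) (id a)"
    using cos_directions_slope by simp
qed

text \<open>Neighbouring directions differ by \<open>2 * pi / 3\<close>, so rotation lowers the
  digit by one. For digit -1 the wrap-around to 1 is the period of the cosine.\<close>

lemma line_measure_gasket_le_slope_rotated:
  assumes "\<bar>\<theta> - 2 * pi / 3\<bar> \<le> pi / 3"
  shows "line_measure \<theta> (proj_line \<theta> ` gasket n) \<le> 2 * emeasure lborel (shadow (slope (\<theta> - 2 * pi / 3)) n)"
proof (rule line_measure_gasket_le[OF sqrt3_cos_bounds[OF assms], where \<tau> = "\<lambda>a. if a = -1 then 1 else a - 1"])
  fix a :: int assume a: "a \<in> {-1, 0, 1}"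
  define \<phi> where "\<phi> = \<theta> - 2 * pi / 3"
  define b where "b = (if a = -1 then 1 else a - 1)"
  have b: "b \<in> {-1, 0, 1}" using a by (auto simp: b_def)
  have c: "cos \<phi> \<noteq> 0" using cos_ge_half[OF assms] by (auto simp: \<phi>_def)
  have "cos (pi * (1/2 + 2/3 * real_of_int a) - \<theta>) = cos (pi * (1/2 + 2/3 * real_of_int b) - \<phi>)"
  proof (cases "a = -1")
    case True
    have "pi * (1/2 + 2/3 * real_of_int b) - \<phi> = (pi * (1/2 + 2/3 * real_of_int a) - \<theta>) + 2 * pi"
      by (simp add: b_def \<phi>_def True field_simps)
    then show ?thesis by (simp only: cos_periodic)
  next
    case False
    have "pi * (1/2 + 2/3 * real_of_int b) - \<phi> = pi * (1/2 + 2/3 * real_of_int a) - \<theta>"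
      using False by (simp add: b_def \<phi>_def field_simps)
    then show ?thesis by simp
  qed
  then show "(if a = -1 then 1 else a - 1) \<in> {-1, 0, 1} \<and> cos (pi * (1/2 + 2/3 * real_of_int a) - \<theta>)
    = (- (sqrt 3 / 2 * cos (\<theta> - 2 * pi / 3)) - sin (\<theta> - 2 * pi / 3) / 2)
      + sqrt 3 * cos (\<theta> - 2 * pi / 3) * digit (slope (\<theta> - 2 * pi / 3)) (if a = -1 then 1 else a - 1)"
    unfolding \<phi>_def[symmetric] b_def[symmetric] using cos_directions_slope[OF c b] b by simp
qed

text \<open>The derivative of \<open>slope\<close> is
  \<open>sqrt 3 / (2 * (cos \<theta>)^2)\<close>, at least 1/2, so passing to the coordinate t costs
  a factor at most 2. The end points of the angular range go to -1 and 2.\<close>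

lemma nn_integral_slope_le:
  fixes g :: "real \<Rightarrow> ennreal"
  assumes g[measurable]: "g \<in> borel_measurable borel"
  shows "(\<integral>\<^sup>+\<theta>\<in>{-(pi / 3)..pi / 3}. g (slope \<theta>) \<partial>lborel) \<le> 2 * (\<integral>\<^sup>+t\<in>{-1..2}. g t \<partial>lborel)"
proof -
  let ?d = "\<lambda>\<theta>. sqrt 3 / 2 * inverse ((cos \<theta>)\<^sup>2)"
  have cpos: "1 / 2 \<le> cos \<theta>" if "\<theta> \<in> {-(pi / 3)..pi / 3}" for \<theta> using cos_ge_half[of \<theta>] that by (auto simp: abs_le_iff)
  have ends: "slope (-(pi / 3)) = -1" "slope (pi / 3) = 2"
    by (simp_all add: slope_def tan_60)
  have "(\<integral>\<^sup>+\<theta>. g (slope \<theta>) * indicator {-(pi / 3)..pi / 3} \<theta> \<partial>lborel)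
    \<le> (\<integral>\<^sup>+\<theta>. 2 * (g (slope \<theta>) * ennreal (?d \<theta>) * indicator {-(pi / 3)..pi / 3} \<theta>) \<partial>lborel)"
  proof (rule nn_integral_mono)
    fix \<theta>
    show "g (slope \<theta>) * indicator {-(pi / 3)..pi / 3} \<theta> \<le> 2 * (g (slope \<theta>) * ennreal (?d \<theta>) * indicator {-(pi / 3)..pi / 3} \<theta>)"
    proof (cases "\<theta> \<in> {-(pi / 3)..pi / 3}")
      case True
      have "0 < (cos \<theta>)\<^sup>2" "(cos \<theta>)\<^sup>2 \<le> 1" using cpos[OF True] by (auto simp: abs_square_le_1)
      then have "1 \<le> inverse ((cos \<theta>)\<^sup>2)" by (rule one_le_inverse)
      moreover have "1 \<le> sqrt 3" by simp
      ultimately have "1 * 1 \<le> sqrt 3 * inverse ((cos \<theta>)\<^sup>2)" by (intro mult_mono) auto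
      then have "ennreal 1 \<le> ennreal (2 * ?d \<theta>)" by (intro ennreal_leI) simp
      also have "\<dots> = ennreal 2 * ennreal (?d \<theta>)" by (rule ennreal_mult) auto
      finally have "1 \<le> 2 * ennreal (?d \<theta>)" by simp
      then have "g (slope \<theta>) * 1 \<le> g (slope \<theta>) * (2 * ennreal (?d \<theta>))" by (rule mult_left_mono) simp
      then show ?thesis using True by (simp add: mult_ac)
    qed simp
  qed
  also have "\<dots> = 2 * (\<integral>\<^sup>+\<theta>. g (slope \<theta>) * ennreal (?d \<theta>) * indicator {-(pi / 3)..pi / 3} \<theta> \<partial>lborel)"
    by (rule nn_integral_cmult) (unfold slope_def tan_def, measurable)
  also have "(\<integral>\<^sup>+\<theta>. g (slope \<theta>) * ennreal (?d \<theta>) * indicator {-(pi / 3)..pi / 3} \<theta> \<partial>lborel)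
    = (\<integral>\<^sup>+t. g t * indicator {slope (-(pi / 3))..slope (pi / 3)} t \<partial>lborel)"
  proof (rule nn_integral_substitution_aux[symmetric])
    fix \<theta> assume "\<theta> \<in> {-(pi / 3)..pi / 3}"
    from cpos[OF this] have "cos \<theta> \<noteq> 0" by auto
    then show "(slope has_real_derivative ?d \<theta>) (at \<theta>)"
      unfolding slope_def by (auto intro!: derivative_eq_intros)
  next
    show "continuous_on {-(pi / 3)..pi / 3} ?d"
      using cpos by (intro continuous_intros) force
  qed auto
  finally show ?thesis unfolding ends .
qed

text \<open>The interval [0, pi] is covered by [-pi/3, pi/3] and its translate by
  \<open>2 * pi / 3\<close>. Two pieces, a factor 2 from the affine maps and a factor 2 from the
  change of variable give 8/pi, which is below 3.\<close>

lemma Fav_gasket_le: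
  "Fav (gasket n) \<le> 3 * (\<integral>\<^sup>+t\<in>{-1..2}. emeasure lborel (shadow t n) \<partial>lborel)"
proof -
  let ?g = "\<lambda>\<theta>. emeasure lborel (shadow (slope \<theta>) n)"
  let ?J = "{-(pi / 3)..pi / 3}"
  let ?X = "\<integral>\<^sup>+t\<in>{-1..2}. emeasure lborel (shadow t n) \<partial>lborel"
  let ?f = "\<lambda>\<theta>. ?g \<theta> * indicator ?J \<theta>"
  have fm[measurable]: "?f \<in> borel_measurable borel" unfolding slope_def tan_def by measurable
  have X: "(\<integral>\<^sup>+\<theta>. ?f \<theta> \<partial>lborel) \<le> 2 * ?X"
    by (rule nn_integral_slope_le[of "\<lambda>t. emeasure lborel (shadow t n)"]) measurable
  have shift: "(\<integral>\<^sup>+\<theta>. ?f (\<theta> - 2 * pi / 3) \<partial>lborel) = (\<integral>\<^sup>+\<theta>. ?f \<theta> \<partial>lborel)"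
  proof -
    have "(\<integral>\<^sup>+\<theta>. ?f \<theta> \<partial>lborel) = ennreal \<bar>1\<bar> * (\<integral>\<^sup>+\<theta>. ?f (- (2 * pi / 3) + 1 * \<theta>) \<partial>lborel)"
      by (rule nn_integral_real_affine[OF fm]) simp
    then show ?thesis by (simp add: algebra_simps)
  qed
  have "(\<integral>\<^sup>+\<theta>\<in>{0..pi}. line_measure \<theta> (proj_line \<theta> ` gasket n) \<partial>lebesgue)
    = (\<integral>\<^sup>+\<theta>\<in>{0..pi}. line_measure \<theta> (proj_line \<theta> ` gasket n) \<partial>lborel)"
    \<comment> \<open>Neither this step nor the monotonicity below asks for measurability of the
      projected length as a function of the angle.\<close>
    by (rule nn_integral_completion)
  also have "\<dots> \<le> (\<integral>\<^sup>+\<theta>. 2 * (?f \<theta> + ?f (\<theta> - 2 * pi / 3)) \<partial>lborel)"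
  proof (rule nn_integral_mono)
    fix \<theta> :: real
    show "line_measure \<theta> (proj_line \<theta> ` gasket n) * indicator {0..pi} \<theta> \<le> 2 * (?f \<theta> + ?f (\<theta> - 2 * pi / 3))"
    proof (cases "\<theta> \<in> {0..pi}")
      case True
      show ?thesis
      proof (cases "\<theta> \<le> pi / 3")
        case le: True
        then have "\<bar>\<theta>\<bar> \<le> pi / 3" "\<theta> \<in> ?J" using True by auto
        then have "line_measure \<theta> (proj_line \<theta> ` gasket n) \<le> 2 * ?f \<theta>"
          using line_measure_gasket_le_slope[of \<theta> n] by simp
        also have "\<dots> \<le> 2 * (?f \<theta> + ?f (\<theta> - 2 * pi / 3))" by (intro mult_left_mono add_increasing2) auto
        finally show ?thesis using True by simp
      next
        case False
        have "\<theta> - 2 * pi / 3 \<in> ?J" using False True by auto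
        then have "\<bar>\<theta> - 2 * pi / 3\<bar> \<le> pi / 3" unfolding atLeastAtMost_iff by linarith
        then have "line_measure \<theta> (proj_line \<theta> ` gasket n) \<le> 2 * ?f (\<theta> - 2 * pi / 3)"
          using line_measure_gasket_le_slope_rotated[of \<theta> n] \<open>\<theta> - 2 * pi / 3 \<in> ?J\<close> by simp
        also have "\<dots> \<le> 2 * (?f \<theta> + ?f (\<theta> - 2 * pi / 3))" by (intro mult_left_mono add_increasing) auto
        finally show ?thesis using True by simp
      qed
    qed simp
  qed
  also have "\<dots> = 2 * ((\<integral>\<^sup>+\<theta>. ?f \<theta> \<partial>lborel) + (\<integral>\<^sup>+\<theta>. ?f (\<theta> - 2 * pi / 3) \<partial>lborel))"
    by (subst nn_integral_cmult, measurable, subst nn_integral_add) measurable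
  also have "\<dots> \<le> 2 * (2 * ?X + 2 * ?X)" unfolding shift by (intro mult_left_mono add_mono X) simp
  also have "\<dots> = 8 * ?X" by (simp add: distrib_right[symmetric] mult.assoc[symmetric] flip: distrib_left)
  finally have "Fav (gasket n) \<le> ennreal (1 / pi) * (8 * ?X)"
    unfolding Fav_def by (rule mult_left_mono) simp
  also have "\<dots> = ennreal (1 / pi * 8) * ?X" by (subst ennreal_mult) (auto simp: mult.assoc)
  also have "\<dots> \<le> ennreal 3 * ?X"
    using pi_gt3 by (intro mult_right_mono ennreal_leI) (auto simp: divide_le_eq)
  finally show ?thesis by simp
qed

theorem theorem2:
  fixes p :: real
  assumes "p < 1/12"
  shows "\<exists>C::real. C > 0 \<and>
    (\<forall>n::nat. n \<ge> 1 \<longrightarrow> Fav (gasket n) \<le> ennreal (C * real n powr (- p)))"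
\<comment> \<open>The constant is independent of p: the bound is obtained with the exponent 1/12
  itself.\<close>
proof (intro exI[of _ "10 ^ 15"] conjI allI impI)
  fix n :: nat assume n: "1 \<le> n"
  let ?X = "\<integral>\<^sup>+t\<in>{-1..2}. emeasure lborel (shadow t n) \<partial>lborel"
  have mono: "real n powr (- (1 / 12)) \<le> real n powr (- p)"
    using n assms by (intro powr_mono) auto
  \<comment> \<open>K is the integer part of the twelfth root of n.\<close>
  obtain K where K: "K ^ 12 \<le> n" "n < (K + 1) ^ 12"
  proof -
    define m where "m = (LEAST m. n < m ^ 12)"
    have "n < (n + 1) ^ 12" using self_le_power[of "n + 1" 12] by simp
    then have m: "n < m ^ 12" unfolding m_def by (rule LeastI)
    have m0: "m \<noteq> 0" using m by (intro notI) simp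
    have "\<not> n < (m - 1) ^ 12" using m0 unfolding m_def by (intro not_less_Least) simp
    then show ?thesis using that[of "m - 1"] m m0 by simp
  qed
  have root: "real (K + 1) powr (-1) \<le> real n powr (- (1 / 12))"
  proof -
    have "real n \<le> real (K + 1) ^ 12" using K(2) by (metis less_imp_le of_nat_le_iff of_nat_power)
    also have "\<dots> = real (K + 1) powr 12" by (simp add: powr_numeral)
    finally have "(real (K + 1) powr 12) powr (- (1 / 12)) \<le> real n powr (- (1 / 12))"
      using n by (intro powr_mono2') auto
    then show ?thesis unfolding powr_powr by simp
  qed
  have bound: "?X \<le> ennreal (10 ^ 14 / real (K + 1))"
  proof (cases "10 ^ 12 \<le> K")
    case True
    have "?X \<le> ennreal (48004 / real K)" by (rule shadow_integral_le[OF True K(1)])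
    also have "\<dots> \<le> ennreal (10 ^ 14 / real (K + 1))"
      using True by (intro ennreal_leI) (simp add: divide_simps)
    finally show ?thesis .
  next
    \<comment> \<open>For K below \<open>10^12\<close> the trivial bound 12, length 4 over slopes of
      measure 3, already suffices; the size of the constant \<open>10^14\<close> comes from this
      range.\<close>
    case False
    have "?X \<le> (\<integral>\<^sup>+t. 4 * indicator {-1..2::real} t \<partial>lborel)"
    proof (rule nn_integral_mono)
      fix t show "emeasure lborel (shadow t n) * indicator {-1..2} t \<le> 4 * indicator {-1..2} t"
        using emeasure_shadow_le_4[of t n] by (auto simp: indicator_def)
    qed
    also have "\<dots> = ennreal 12" by (simp add: nn_integral_cmult_indicator)
    also have "\<dots> \<le> ennreal (10 ^ 14 / real (K + 1))"
      using False by (intro ennreal_leI) (simp add: divide_simps)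
    finally show ?thesis .
  qed
  have "Fav (gasket n) \<le> 3 * ?X" by (rule Fav_gasket_le)
  also have "\<dots> \<le> ennreal 3 * ennreal (10 ^ 14 / real (K + 1))"
    using bound by (simp add: mult_left_mono)
  also have "\<dots> = ennreal (3 * (10 ^ 14 / real (K + 1)))" by (rule ennreal_mult[symmetric]) auto
  also have "\<dots> \<le> ennreal (10 ^ 15 * real n powr (- p))"
  proof (rule ennreal_leI)
    have "3 * (10 ^ 14 / real (K + 1)) \<le> 10 ^ 15 * real (K + 1) powr (-1)"
      by (simp add: powr_minus_divide divide_simps)
    also have "\<dots> \<le> 10 ^ 15 * real n powr (- p)"
      using root mono by (intro mult_left_mono) auto
    finally show "3 * (10 ^ 14 / real (K + 1)) \<le> 10 ^ 15 * real n powr (- p)" .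
  qed
  finally show "Fav (gasket n) \<le> ennreal (10 ^ 15 * real n powr (- p))" .
qed simp

end
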